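(* Let $H$ be a Tonelli Hamiltonian on $\mathbb T^d$ with associated Lagrangian $L$. Let $(h_n)$ be mesh sizes and $(\tau_n)$ positive time steps with $\tau_n\to0$, $h_n\to0$ and $h_n/\tau_n\to0$. Assume that the continuous Mather measure $\mu$ is unique. Then $$\operatorname{spt}(\mu)=\widetilde{\mathcal M}_L\subset\liminf_{n\to\infty}\widetilde{\mathcal M}_{h_n,\tau_n},$$ where $\liminf$ is the Kuratowski lower limit, $\widetilde{\mathcal M}_L$ is the continuous Mather set and $\widetilde{\mathcal M}_{h,\tau}$ is the fully-discrete Mather set.
   Context: $\mathbb T^d=\mathbb R^d/\mathbb Z^d$. $H\in C^2(\mathbb T^d\times\mathbb R^d)$ is a Tonelli Hamiltonian: $D^2_{pp}H(x,p)>0$ everywhere and $H$ is superlinear in $p$. The Tonelli Lagrangian is $L(x,v)=\sup_{p\in\mathbb R^d}\{p\cdot v-H(x,p)\}$; it is of class $C^2$, strictly convex in $v$, and superlinear: for every $K>0$ there is $C(K)\in\mathbb R$ with $L(x,v)\ge K|v|-C(K)$ for all $(x,v)$. A probability measure $\mu$ on $\mathbb T^d\times\mathbb R^d$ is closed if $\int v\cdot D\phi(x)\,d\mu(x,v)=0$ for all $\phi\in C^1(\mathbb T^d)$. A (continuous) Mather measure is a closed probability measure minimizing $\int L\,d\mu$ among all closed probability measures; the minimum equals $-\alpha(H)$, where $\alpha(H)$ is the unique constant for which $H(x,Du)=\alpha(H)$ on $\mathbb T^d$ has a viscosity solution. The continuous Mather set $\widetilde{\mathcal M}_L$ is the closure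 in $\mathbb T^d\times\mathbb R^d$ of the union of the supports of all Mather measures. $\operatorname{spt}$ denotes the support. Mesh sizes are always of the form $h=1/N$ with $N\ge1$ an integer. The grid is $\mathcal G_h=\{x_i=ih \bmod \mathbb Z^d: i\in\{0,\dots,N-1\}^d\}$, and each grid point is identified with its representative in $[0,1)^d$. For $x_i,x_j\in\mathcal G_h$, $\ell\in\mathbb Z^d$ put $v_{ij}^\ell=(x_j+\ell-x_i)/\tau$. $\mathcal H_{h,\tau}$ is the set of fully-discrete holonomic probability measures: families $\mu=(\mu_{ij}^\ell)$ indexed by $x_i,x_j\in\mathcal G_h$, $\ell\in\mathbb Z^d$, with $\mu_{ij}^\ell\ge0$, $\sum_{i,j,\ell}\mu_{ij}^\ell=1$ and $\sum_{j,\ell}\mu_{ij}^\ell=\sum_{j,\ell}\mu_{ji}^\ell$ for every $x_i\in\mathcal G_h$. A fully-discrete Mather measure is a minimizer of $\sum_{i,j,\ell}L(x_i,v_{ij}^\ell)\mu_{ij}^\ell$ over $\mathcal H_{h,\tau}$. The fully-discrete Mather set $\widetilde{\mathcal M}_{h,\tau}\subset\mathbb T^d\times\mathbb R^d$ is the closure of the union, over all fully-discrete Mather measures $\mu$, of $\{(x_i,v_{ij}^\ell):\mu_{ij}^\ell>0\}$. Kuratowski lower limit: $z\in\liminf_kA_k$ iff there are $z_k\in A_k$ with $z_k\to z$. *)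

theory Defs
  imports "HOL-Probability.Probability"
begin

section \<open>The flat torus\<close>

definition integer_translate :: "real ^ 'n \<Rightarrow> real ^ 'n \<Rightarrow> bool" where
  "integer_translate x y \<longleftrightarrow> (\<forall>k. y $ k - x $ k \<in> \<int>)"

lemma equivp_integer_translate: "equivp (integer_translate :: real ^ 'n \<Rightarrow> real ^ 'n \<Rightarrow> bool)"
proof (rule equivpI)
  show "reflp (integer_translate :: real ^ 'n \<Rightarrow> _)"
    by (simp add: reflp_def integer_translate_def)
  show "symp (integer_translate :: real ^ 'n \<Rightarrow> _)"
    unfolding symp_def integer_translate_def by (metis Ints_minus minus_diff_eq)
  show "transp (integer_translate :: real ^ 'n \<Rightarrow> _)"
    unfolding transp_def integer_translate_def
  proof (intro allI impI)
    fix x y z :: "real ^ 'n" and k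
    assume "\<forall>k. y $ k - x $ k \<in> \<int>" "\<forall>k. z $ k - y $ k \<in> \<int>"
    then have "(z $ k - y $ k) + (y $ k - x $ k) \<in> \<int>" by (metis Ints_add)
    then show "z $ k - x $ k \<in> \<int>" by simp
  qed
qed

quotient_type 'n torus = "real ^ 'n::finite" / integer_translate
  morphisms rep_torus to_torus
  by (rule equivp_integer_translate)

text \<open>The torus carries the quotient topology; products such as \<open>'n torus \<times> (real ^ 'n)\<close>
  then get the library's product topology and its Borel sets.\<close>

instantiation torus :: (finite) topological_space
begin

definition open_torus :: "'a torus set \<Rightarrow> bool" where
  "open_torus U \<longleftrightarrow> open (to_torus -` U)"

instance
  by standard (auto simp: open_torus_def vimage_Union)

end


section \<open>Regularity\<close>

definition C1 :: "('a::real_normed_vector \<Rightarrow> real) \<Rightarrow> bool" where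
  "C1 f \<longleftrightarrow> (\<exists>f' :: 'a \<Rightarrow> 'a \<Rightarrow>\<^sub>L real.
     (\<forall>x. (f has_derivative blinfun_apply (f' x)) (at x)) \<and> continuous_on UNIV f')"

definition C2 :: "('a::real_normed_vector \<Rightarrow> real) \<Rightarrow> bool" where
  "C2 f \<longleftrightarrow> (\<exists>(f' :: 'a \<Rightarrow> 'a \<Rightarrow>\<^sub>L real) (f'' :: 'a \<Rightarrow> 'a \<Rightarrow>\<^sub>L ('a \<Rightarrow>\<^sub>L real)).
     (\<forall>x. (f has_derivative blinfun_apply (f' x)) (at x)) \<and>
     (\<forall>x. (f' has_derivative blinfun_apply (f'' x)) (at x)) \<and> continuous_on UNIV f'')"

definition C1_torus :: "('n::finite torus \<Rightarrow> real) \<Rightarrow> bool" where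
  "C1_torus \<phi> \<longleftrightarrow> C1 (\<lambda>x. \<phi> (to_torus x))"

text \<open>The gradient of the periodic lift does not depend on the representative, so the
  description below is proper for every \<open>C1_torus\<close> function.\<close>

definition torus_grad :: "('n::finite torus \<Rightarrow> real) \<Rightarrow> 'n torus \<Rightarrow> real ^ 'n" where
  "torus_grad \<phi> x = (THE g. \<forall>y. to_torus y = x \<longrightarrow> gderiv (\<lambda>z. \<phi> (to_torus z)) y g)"


section \<open>Tonelli Hamiltonians and Lagrangians\<close>

text \<open>\<open>D2pp H x p q r\<close> is the bilinear form \<open>D\<^sup>2\<^sub>p\<^sub>p H(x,p)\<close> applied to the vectors \<open>q\<close>, \<open>r\<close>.\<close>

definition D2pp :: "('n::finite torus \<Rightarrow> real ^ 'n \<Rightarrow> real) \<Rightarrow> 'n torus \<Rightarrow> real ^ 'n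
    \<Rightarrow> real ^ 'n \<Rightarrow> real ^ 'n \<Rightarrow> real" where
  "D2pp H x p q r =
     frechet_derivative (\<lambda>p'. frechet_derivative (\<lambda>p''. H x p'') (at p') q) (at p) r"

definition superlinear :: "('n::finite torus \<Rightarrow> real ^ 'n \<Rightarrow> real) \<Rightarrow> bool" where
  "superlinear F \<longleftrightarrow> (\<forall>K>0. \<exists>C. \<forall>x w. F x w \<ge> K * norm w - C)"

definition tonelli_hamiltonian :: "('n::finite torus \<Rightarrow> real ^ 'n \<Rightarrow> real) \<Rightarrow> bool" where
  "tonelli_hamiltonian H \<longleftrightarrow>
     C2 (\<lambda>(x, p). H (to_torus x) p) \<and>
     (\<forall>x p q. q \<noteq> 0 \<longrightarrow> D2pp H x p q q > 0) \<and>
     superlinear H"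

text \<open>For superlinear \<open>H\<close> continuous in \<open>p\<close> the supremum is over a nonempty set bounded above.\<close>

definition lagrangian :: "('n::finite torus \<Rightarrow> real ^ 'n \<Rightarrow> real)
    \<Rightarrow> 'n torus \<Rightarrow> real ^ 'n \<Rightarrow> real" where
  "lagrangian H x v = (SUP p. p \<bullet> v - H x p)"


section \<open>Mather measures and the Mather set\<close>

text \<open>\<open>has_bochner_integral\<close> includes integrability of \<open>v \<bullet> D\<phi>(x)\<close>. Letting \<open>\<phi>\<close> range over sines
  and cosines of the coordinates, this forces \<open>v\<close> itself to be integrable.\<close>

definition closed_prob_measure :: "('n::finite torus \<times> (real ^ 'n)) measure \<Rightarrow> bool" where
  "closed_prob_measure \<mu> \<longleftrightarrow> prob_space \<mu> \<and> sets \<mu> = sets borel \<and>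
     (\<forall>\<phi>. C1_torus \<phi> \<longrightarrow> has_bochner_integral \<mu> (\<lambda>(x, v). v \<bullet> torus_grad \<phi> x) 0)"

text \<open>A Tonelli Lagrangian is continuous and bounded below, so a closed probability measure for
  which it is not integrable has action \<open>+\<infinity>\<close>. The Bochner integral would be \<open>0\<close> there, hence the
  explicit integrability conditions. Finite action does occur: take a point mass at \<open>(x, 0)\<close>.\<close>

definition mather_measure :: "('n::finite torus \<Rightarrow> real ^ 'n \<Rightarrow> real)
    \<Rightarrow> ('n torus \<times> (real ^ 'n)) measure \<Rightarrow> bool" where
  "mather_measure L \<mu> \<longleftrightarrow>
     closed_prob_measure \<mu> \<and> integrable \<mu> (\<lambda>(x, v). L x v) \<and>
     (\<forall>\<nu>. closed_prob_measure \<nu> \<and> integrable \<nu> (\<lambda>(x, v). L x v) \<longrightarrow>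
        (\<integral>(x, v). L x v \<partial>\<mu>) \<le> (\<integral>(x, v). L x v \<partial>\<nu>))"

definition spt :: "'a::topological_space measure \<Rightarrow> 'a set" where
  "spt \<mu> = {z. \<forall>U. open U \<and> z \<in> U \<longrightarrow> emeasure \<mu> U > 0}"

definition mather_set :: "('n::finite torus \<Rightarrow> real ^ 'n \<Rightarrow> real)
    \<Rightarrow> ('n torus \<times> (real ^ 'n)) set" where
  "mather_set L = closure (\<Union>\<mu>\<in>{\<mu>. mather_measure L \<mu>}. spt \<mu>)"


section \<open>Fully-discrete Mather measures and the fully-discrete Mather set\<close>

text \<open>The mesh size is \<open>h = 1 / N\<close>. Grid points are given by their representatives in the
  half-open unit cube.\<close>

definition grid :: "nat \<Rightarrow> (real ^ 'n::finite) set" where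
  "grid N = {x. \<exists>i. (\<forall>k. i k < N) \<and> x = (\<chi> k. real (i k) * (1 / real N))}"

definition grid_velocity :: "real \<Rightarrow> real ^ 'n \<Rightarrow> real ^ 'n \<Rightarrow> int ^ 'n::finite \<Rightarrow> real ^ 'n" where
  "grid_velocity \<tau> x y l = (1 / \<tau>) *\<^sub>R (y + (\<chi> k. real_of_int (l $ k)) - x)"

text \<open>Only the weights \<open>\<mu> x y l\<close> with \<open>x\<close>, \<open>y\<close> in the grid matter; they are summable because
  \<open>has_sum\<close> is, so both sides of the holonomy constraint are genuine sums.\<close>

definition holonomic :: "nat \<Rightarrow> (real ^ 'n \<Rightarrow> real ^ 'n \<Rightarrow> int ^ 'n::finite \<Rightarrow> real) \<Rightarrow> bool" where
  "holonomic N \<mu> \<longleftrightarrow>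
     (\<forall>x\<in>grid N. \<forall>y\<in>grid N. \<forall>l. \<mu> x y l \<ge> 0) \<and>
     ((\<lambda>(x, y, l). \<mu> x y l) has_sum 1) (grid N \<times> grid N \<times> UNIV) \<and>
     (\<forall>x\<in>grid N. (\<Sum>\<^sub>\<infinity>(y, l)\<in>grid N \<times> UNIV. \<mu> x y l) = (\<Sum>\<^sub>\<infinity>(y, l)\<in>grid N \<times> UNIV. \<mu> y x l))"

definition discrete_action_integrand :: "('n::finite torus \<Rightarrow> real ^ 'n \<Rightarrow> real) \<Rightarrow> real
    \<Rightarrow> (real ^ 'n \<Rightarrow> real ^ 'n \<Rightarrow> int ^ 'n \<Rightarrow> real)
    \<Rightarrow> (real ^ 'n) \<times> (real ^ 'n) \<times> (int ^ 'n) \<Rightarrow> real" where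
  "discrete_action_integrand L \<tau> \<mu> = (\<lambda>(x, y, l). L (to_torus x) (grid_velocity \<tau> x y l) * \<mu> x y l)"

text \<open>As above, a holonomic measure with a non-summable action has action \<open>+\<infinity>\<close>, whereas
  \<open>infsum\<close> would be \<open>0\<close>.\<close>

definition discrete_mather_measure :: "('n::finite torus \<Rightarrow> real ^ 'n \<Rightarrow> real) \<Rightarrow> nat \<Rightarrow> real
    \<Rightarrow> (real ^ 'n \<Rightarrow> real ^ 'n \<Rightarrow> int ^ 'n \<Rightarrow> real) \<Rightarrow> bool" where
  "discrete_mather_measure L N \<tau> \<mu> \<longleftrightarrow>
     holonomic N \<mu> \<and>
     discrete_action_integrand L \<tau> \<mu> summable_on (grid N \<times> grid N \<times> UNIV) \<and>
     (\<forall>\<nu>. holonomic N \<nu> \<and>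
          discrete_action_integrand L \<tau> \<nu> summable_on (grid N \<times> grid N \<times> UNIV) \<longrightarrow>
        (\<Sum>\<^sub>\<infinity>e\<in>grid N \<times> grid N \<times> UNIV. discrete_action_integrand L \<tau> \<mu> e)
        \<le> (\<Sum>\<^sub>\<infinity>e\<in>grid N \<times> grid N \<times> UNIV. discrete_action_integrand L \<tau> \<nu> e))"

definition discrete_mather_set :: "('n::finite torus \<Rightarrow> real ^ 'n \<Rightarrow> real) \<Rightarrow> nat \<Rightarrow> real
    \<Rightarrow> ('n torus \<times> (real ^ 'n)) set" where
  "discrete_mather_set L N \<tau> = closure (\<Union>\<mu>\<in>{\<mu>. discrete_mather_measure L N \<tau> \<mu>}.
     {(to_torus x, grid_velocity \<tau> x y l) | x y l. x \<in> grid N \<and> y \<in> grid N \<and> \<mu> x y l > 0})"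


section \<open>Kuratowski lower limit\<close>

definition kuratowski_liminf :: "(nat \<Rightarrow> 'a::topological_space set) \<Rightarrow> 'a set" where
  "kuratowski_liminf A = {z. \<exists>w. (\<forall>k. w k \<in> A k) \<and> w \<longlonglongrightarrow> z}"

end

(*
  The Mather set is spt mu by uniqueness.  For the inclusion, the grid is a finite directed graph
  with edge costs tau L, so there are a cycle of minimal mean cost A and a potential U with
  U(b) - U(a) <= tau (L - A) on all edges and equality along the cycle.  Summing against a holonomic
  measure shows that the uniform measure on the cycle is a discrete Mather measure.  Since
  h <= tau eventually, U is Lipschitz at scale tau, hence the velocities on the cycle and the
  oscillation of U are bounded uniformly in n.  Consequently the cycle measures subconverge to a
  closed probability measure nu.  Averaging U over translates, with grid weights coming from powers of
  cosines, yields C^1 subsolutions v . Dphi <= L - A + o(1) on the continuous torus; integrating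
  against mu gives A <= int L dmu + o(1).  So nu minimizes the action and equals mu by uniqueness.
  If z in spt mu stayed away from the discrete Mather sets along a subsequence, a neighbourhood of z
  would be null for nu = mu.

  The compactness step uses no Prokhorov theorem: the cycle measures are lifted to [0,1] through
  a space-filling curve, where Helly's theorem applies.
*)

theory Submission
  imports Defs
begin

section \<open>The torus as a quotient\<close>


text \<open>The smoothing works because the edge inequality for \<open>U\<close> sees an increment
  only through its velocity: translating both endpoints by a lattice vector changes nothing but the
  base point at which \<open>L\<close> is evaluated. A convex combination of translates thus
  satisfies the same inequality with \<open>L\<close> averaged over base points, and only a modulus
  of continuity of \<open>L\<close> is lost. The weights must sum to exactly one from every real
  base point, not only from grid points. Powers of cosines do this because equispaced sampling sums
  trigonometric polynomials of degree below the number of nodes exactly.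

  The order of choices matters: the exponent of the kernel depends on the tolerance alone, so the
  bound on the gradient of the averaged potential and on its Lipschitz constant is uniform in n.
  What remains is a Taylor remainder of order \<tau> and the rounding of an arbitrary velocity to a
  multiple of h / \<tau>; the latter is where h / \<tau> \<rightarrow> 0 enters, beyond the h \<le>
  \<tau> of the a priori bounds. The inequality is first shown for bounded velocities; it yields a
  gradient bound, and superlinearity then covers all large velocities.\<close>

abbreviation int_vec :: "int ^ 'n \<Rightarrow> real ^ 'n::finite" where
  "int_vec l \<equiv> (\<chi> k. real_of_int (l $ k))"

abbreviation lift_pair :: "(real ^ 'n::finite) \<times> 'b \<Rightarrow> 'n torus \<times> 'b" where
  "lift_pair \<equiv> map_prod to_torus id"

lemma to_torus_eq_iff: "to_torus x = to_torus y \<longleftrightarrow> (\<exists>l. y = x + int_vec l)"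
proof -
  have "to_torus x = to_torus y \<longleftrightarrow> integer_translate x y"
    by (rule torus.abs_eq_iff)
  also have "\<dots> \<longleftrightarrow> (\<exists>l. y = x + int_vec l)"
  proof
    assume "integer_translate x y"
    then have "y $ k = x $ k + real_of_int \<lfloor>y $ k - x $ k\<rfloor>" for k
      by (simp add: integer_translate_def)
    then have "y = x + int_vec (\<chi> k. \<lfloor>y $ k - x $ k\<rfloor>)"
      by (simp add: vec_eq_iff)
    then show "\<exists>l. y = x + int_vec l" by blast
  qed (auto simp: integer_translate_def)
  finally show ?thesis .
qed

lemma to_torus_add_int_vec [simp]: "to_torus (x + int_vec l) = to_torus x"
  by (metis to_torus_eq_iff)

lemma to_torus_surj: obtains y where "x = to_torus y"
  by (metis Quotient3_abs_rep Quotient3_torus)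

definition frac_vec :: "real ^ 'n::finite \<Rightarrow> real ^ 'n" where
  "frac_vec x = (\<chi> k. frac (x $ k))"

lemma frac_vec_eq: "frac_vec x = x + int_vec (\<chi> k. - \<lfloor>x $ k\<rfloor>)"
  by (simp add: frac_vec_def vec_eq_iff frac_def)

lemma to_torus_frac_vec [simp]: "to_torus (frac_vec x) = to_torus x"
  by (simp only: frac_vec_eq to_torus_add_int_vec)

lemma frac_vec_in_cube: "frac_vec x \<in> cbox 0 1"
  by (auto simp: mem_box_cart frac_vec_def less_imp_le frac_lt_1)

lemma frac_vec_add_int_vec [simp]: "frac_vec (x + int_vec l) = frac_vec x"
  by (simp add: frac_vec_def vec_eq_iff frac_def)

lemma continuous_on_lift_pair: "continuous_on UNIV (lift_pair :: (real ^ 'n::finite) \<times> 'b::topological_space \<Rightarrow> _)"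
proof -
  have "continuous_on UNIV (to_torus :: real ^ 'n \<Rightarrow> _)"
    by (simp add: continuous_on_open_vimage open_torus_def)
  then have "continuous_on UNIV (\<lambda>z :: (real ^ 'n) \<times> 'b. to_torus (fst z))"
    by (rule continuous_on_compose2) (auto intro: continuous_on_fst continuous_on_id)
  then have "continuous_on UNIV (\<lambda>z :: (real ^ 'n) \<times> 'b. (to_torus (fst z), snd z))"
    by (intro continuous_on_Pair continuous_on_snd continuous_on_id)
  also have "(\<lambda>z :: (real ^ 'n) \<times> 'b. (to_torus (fst z), snd z)) = lift_pair"
    by (simp add: fun_eq_iff)
  finally show ?thesis .
qed

lemma open_image_to_torus:
  assumes "open U" shows "open (to_torus ` U :: 'n::finite torus set)"
proof -
  have "to_torus -` to_torus ` U = (\<Union>l. (\<lambda>x. x + int_vec l) ` U)"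
  proof (intro set_eqI iffI)
    fix x assume "x \<in> to_torus -` to_torus ` U"
    then obtain y where "y \<in> U" "to_torus y = to_torus x" by fastforce
    then show "x \<in> (\<Union>l. (\<lambda>x. x + int_vec l) ` U)"
      unfolding to_torus_eq_iff by blast
  qed auto
  moreover have "open \<dots>"
    using open_translation[OF assms] by (intro open_UN ballI) (simp add: add.commute[of _ "int_vec _"])
  ultimately show ?thesis by (simp add: open_torus_def)
qed

lemma open_image_lift_pair:
  fixes U :: "((real ^ 'n::finite) \<times> 'b::topological_space) set"
  assumes "open U" shows "open (lift_pair ` U)"
proof (subst open_subopen, intro ballI)
  fix z assume "z \<in> lift_pair ` U"
  then obtain x v where z: "(x, v) \<in> U" "z = (to_torus x, v)" by auto
  from assms z(1) obtain A B where "open A" "open B" "(x, v) \<in> A \<times> B" "A \<times> B \<subseteq> U"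
    by (rule open_prod_elim)
  then show "\<exists>T. open T \<and> z \<in> T \<and> T \<subseteq> lift_pair ` U"
    using z(2)
  proof (intro exI[of _ "to_torus ` A \<times> B"] conjI open_Times open_image_to_torus)
    show "to_torus ` A \<times> B \<subseteq> lift_pair ` U"
    proof clarify
      fix a b assume "a \<in> A" "b \<in> B"
      then have "lift_pair (a, b) \<in> lift_pair ` U" using \<open>A \<times> B \<subseteq> U\<close> by blast
      then show "(to_torus a, b) \<in> lift_pair ` U" by simp
    qed
  qed auto
qed

text \<open>Since \<open>lift_pair\<close> is open and onto, it is a quotient map, so continuity can
  be tested on the cover. Openness is the point: the product of a quotient map with an identity need
  not be a quotient map in general.\<close>

lemma continuous_on_torus_prodI:
  fixes f :: "'n::finite torus \<times> 'b::topological_space \<Rightarrow> 'c::topological_space"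
  assumes "continuous_on UNIV (\<lambda>z. f (lift_pair z))"
  shows "continuous_on UNIV f"
proof (subst continuous_on_open_vimage[OF open_UNIV], intro allI impI)
  fix B :: "'c set" assume "open B"
  then have "open ((\<lambda>z. f (lift_pair z)) -` B)"
    using assms by (simp add: continuous_on_open_vimage)
  then have "open (lift_pair ` ((\<lambda>z. f (lift_pair z)) -` B))"
    by (rule open_image_lift_pair)
  also have "lift_pair ` ((\<lambda>z. f (lift_pair z)) -` B) = f -` B"
  proof (intro set_eqI iffI)
    fix z assume z: "z \<in> f -` B"
    obtain x where "fst z = to_torus x" by (rule to_torus_surj)
    then have "z = lift_pair (x, snd z)" by (simp add: prod_eq_iff)
    then show "z \<in> lift_pair ` ((\<lambda>z. f (lift_pair z)) -` B)"
      by (rule image_eqI) (use z \<open>z = _\<close> in simp)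
  qed auto
  finally show "open (f -` B \<inter> UNIV)" by simp
qed

text \<open>\<open>torus_grad\<close> is a definite description over all representatives of a point.
  Evaluating it takes both the uniqueness of gradients and their invariance under integer
  translations.\<close>

lemma torus_grad_eq:
  assumes "\<And>x. GDERIV (\<lambda>x. \<phi> (to_torus x)) x :> g x"
  shows "torus_grad \<phi> (to_torus x) = g x"
proof -
  have unique: "a = b" if "GDERIV f x :> a" "GDERIV f x :> b" for f :: "real ^ 'a \<Rightarrow> real" and x a b
  proof -
    have "(\<lambda>h. h \<bullet> a) = (\<lambda>h. h \<bullet> b)"
      by (rule has_derivative_unique) (use that in \<open>simp_all only: gderiv_def\<close>)
    then have "(a - b) \<bullet> a = (a - b) \<bullet> b" by (rule fun_cong)
    then have "(a - b) \<bullet> (a - b) = 0" by (simp add: inner_diff_right)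
    then show ?thesis by simp
  qed
  have per: "g y = g x" if "to_torus y = to_torus x" for x y
  proof -
    obtain l where l: "x = y + int_vec l" using \<open>to_torus y = _\<close> unfolding to_torus_eq_iff by blast
    have "((\<lambda>z. z + int_vec l) has_derivative (\<lambda>z. z)) (at y)"
      by (auto intro!: derivative_eq_intros)
    from has_derivative_compose[OF this, of "\<lambda>x. \<phi> (to_torus x)" "\<lambda>h. h \<bullet> g x"]
    have "GDERIV (\<lambda>x. \<phi> (to_torus x)) y :> g x"
      using assms[of x] l by (simp add: gderiv_def)
    with assms[of y] show "g y = g x" by (rule unique)
  qed
  show ?thesis
    unfolding torus_grad_def
  proof (rule the_equality)
    show "\<forall>y. to_torus y = to_torus x \<longrightarrow> GDERIV (\<lambda>z. \<phi> (to_torus z)) y :> g x"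
      using assms per by metis
  next
    fix g' assume "\<forall>y. to_torus y = to_torus x \<longrightarrow> GDERIV (\<lambda>z. \<phi> (to_torus z)) y :> g'"
    then show "g' = g x" using assms[of x] unique by blast
  qed
qed

section \<open>The Lagrangian\<close>


text \<open>Continuity is phrased on the cover because the torus carries only a topology here;
  boundedness and uniform continuity are then obtained from compact sets of Euclidean space.\<close>

definition torus_continuous :: "('n::finite torus \<Rightarrow> real ^ 'n \<Rightarrow> real) \<Rightarrow> bool" where
  "torus_continuous F \<longleftrightarrow> continuous_on UNIV (\<lambda>(x, v). F (to_torus x) v)"

lemma torus_continuous_bounded:
  assumes "torus_continuous F"
  obtains M where "M \<ge> 0" "\<And>x v. norm v \<le> R \<Longrightarrow> \<bar>F x v\<bar> \<le> M"
proof -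
  let ?S = "cbox 0 1 \<times> cball 0 R :: ((real ^ 'a) \<times> (real ^ 'a)) set"
  have "continuous_on ?S (\<lambda>(x, v). F (to_torus x) v)"
    using assms unfolding torus_continuous_def by (rule continuous_on_subset) simp
  then have "compact ((\<lambda>(x, v). F (to_torus x) v) ` ?S)"
    by (intro compact_continuous_image compact_Times) auto
  then have "bounded ((\<lambda>(x, v). F (to_torus x) v) ` ?S)"
    by (rule compact_imp_bounded)
  then obtain M where M: "\<And>z. z \<in> (\<lambda>(x, v). F (to_torus x) v) ` ?S \<Longrightarrow> \<bar>z\<bar> \<le> M"
    unfolding bounded_real by blast
  have "\<bar>F x v\<bar> \<le> \<bar>M\<bar>" if "norm v \<le> R" for x v
  proof -
    obtain y where y: "x = to_torus (frac_vec y)" using to_torus_surj[of x] by auto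
    have "\<bar>F x v\<bar> \<le> M"
      by (rule M, rule image_eqI[of _ _ "(frac_vec y, v)"])
        (use frac_vec_in_cube[of y] that in \<open>auto simp: y simp del: to_torus_frac_vec\<close>)
    then show ?thesis by simp
  qed
  then show thesis using that[of "\<bar>M\<bar>"] by simp
qed

lemma torus_uniformly_continuous:
  assumes "torus_continuous F" "e > 0"
  obtains d where "d > 0" "\<And>x y v w. norm v \<le> R \<Longrightarrow> norm w \<le> R \<Longrightarrow>
    norm (x - y) < d \<Longrightarrow> norm (v - w) < d \<Longrightarrow> \<bar>F (to_torus x) v - F (to_torus y) w\<bar> < e"
proof -
  \<comment> \<open>Both points are shifted by the integer vector that brings \<open>x\<close> into
    the unit cube. Their coordinates differ by at most 1, so \<open>y\<close> lands in the cube
    enlarged by 1 on each side.\<close>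
  let ?S = "cbox (-1) 2 \<times> cball 0 R :: ((real ^ 'a) \<times> (real ^ 'a)) set"
  have "continuous_on ?S (\<lambda>(x, v). F (to_torus x) v)"
    using assms(1) unfolding torus_continuous_def by (rule continuous_on_subset) simp
  then have "uniformly_continuous_on ?S (\<lambda>(x, v). F (to_torus x) v)"
    by (intro compact_uniformly_continuous compact_Times) auto
  then obtain d where d: "d > 0" "\<And>z z'. z \<in> ?S \<Longrightarrow> z' \<in> ?S \<Longrightarrow> dist z' z < d \<Longrightarrow>
      dist ((\<lambda>(x, v). F (to_torus x) v) z') ((\<lambda>(x, v). F (to_torus x) v) z) < e"
    using \<open>e > 0\<close> unfolding uniformly_continuous_on_def by meson
  show thesis
  proof
    show "min (d / 2) 1 > 0" using d by simp
    fix x y v w :: "real ^ 'a"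
    assume *: "norm v \<le> R" "norm w \<le> R" "norm (x - y) < min (d / 2) 1" "norm (v - w) < min (d / 2) 1"
    define l where "l = (\<chi> k. - \<lfloor>x $ k\<rfloor>)"
    have x: "frac_vec x = x + int_vec l" by (simp add: frac_vec_eq l_def)
    have fx: "0 \<le> (x + int_vec l) $ k \<and> (x + int_vec l) $ k \<le> 1" for k
      using frac_vec_in_cube[of x] by (simp add: x mem_box_cart)
    moreover have "\<bar>x $ k - y $ k\<bar> \<le> 1" for k
      using component_le_norm_cart[of "x - y" k] * by simp
    ultimately have "-1 \<le> (x + int_vec l) $ k \<and> (x + int_vec l) $ k \<le> 2"
      "-1 \<le> (y + int_vec l) $ k \<and> (y + int_vec l) $ k \<le> 2" for k
      by (smt (verit, best) vector_add_component)+
    then have "(x + int_vec l, v) \<in> ?S" "(y + int_vec l, w) \<in> ?S"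
      using * by (simp_all add: mem_box_cart)
    moreover have "dist (x + int_vec l, v) (y + int_vec l, w) < d"
    proof -
      have "dist (x + int_vec l, v) (y + int_vec l, w) \<le> norm (x - y) + norm (v - w)"
        unfolding dist_Pair_Pair by (rule order_trans[OF sqrt_sum_squares_le_sum]) (auto simp: dist_norm)
      then show ?thesis using * by simp
    qed
    ultimately show "\<bar>F (to_torus x) v - F (to_torus y) w\<bar> < e"
      using d(2)[of "(y + int_vec l, w)" "(x + int_vec l, v)"] by (simp add: dist_real_def)
  qed
qed

lemma C2_imp_continuous: "C2 f \<Longrightarrow> continuous_on UNIV f"
  unfolding C2_def
  by (elim exE conjE, rule has_derivative_continuous_on, rule has_derivative_at_withinI, erule spec)

context
  fixes H :: "'n::finite torus \<Rightarrow> real ^ 'n \<Rightarrow> real"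
  assumes cont: "torus_continuous H" and super: "superlinear H"
begin

text \<open>Superlinearity with slope \<bar>R\<bar> + 1 beats the pairing with any velocity of norm
  at most \<open>R\<close> and leaves one \<open>norm p\<close> to absorb the constants. Large
  momenta therefore do no better than the zero momentum, which confines the supremum to a fixed
  ball.\<close>

lemma lagrangian_maximizer_bound:
  obtains P where "P \<ge> 0" "\<And>x p v. norm v \<le> R \<Longrightarrow> norm p > P \<Longrightarrow> p \<bullet> v - H x p \<le> 0 \<bullet> v - H x 0"
proof -
  obtain M where M: "M \<ge> 0" "\<And>x p. norm p \<le> 0 \<Longrightarrow> \<bar>H x p\<bar> \<le> M"
    using torus_continuous_bounded[OF cont, where R = 0] by blast
  have "\<bar>R\<bar> + 1 > 0" by simp
  with super obtain C where C: "\<And>x p. H x p \<ge> (\<bar>R\<bar> + 1) * norm p - C"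
    unfolding superlinear_def by blast
  show thesis
  proof
    show "\<bar>C\<bar> + M \<ge> 0" using M by simp
    fix x and p v :: "real ^ 'n" assume "norm v \<le> R" "norm p > \<bar>C\<bar> + M"
    have "p \<bullet> v \<le> norm p * norm v" by (rule norm_cauchy_schwarz)
    also have "\<dots> \<le> norm p * \<bar>R\<bar>" using \<open>norm v \<le> R\<close> by (intro mult_left_mono) auto
    finally show "p \<bullet> v - H x p \<le> 0 \<bullet> v - H x 0"
      using C[of p x] M(2)[of 0 x] \<open>norm p > _\<close> by (simp add: algebra_simps)
  qed
qed

lemma bdd_above_lagrangian: "bdd_above (range (\<lambda>p. p \<bullet> v - H x p))"
proof -
  obtain P where P: "P \<ge> 0"
    "\<And>x p w. norm w \<le> norm v \<Longrightarrow> norm p > P \<Longrightarrow> p \<bullet> w - H x p \<le> 0 \<bullet> w - H x 0"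
    using lagrangian_maximizer_bound[where R = "norm v"] by blast
  obtain M where M: "\<And>x p. norm p \<le> P \<Longrightarrow> \<bar>H x p\<bar> \<le> M"
    using torus_continuous_bounded[OF cont, where R = P] by blast
  have "p \<bullet> v - H x p \<le> P * norm v + M" for p
  proof (cases "norm p \<le> P")
    case True
    have "p \<bullet> v \<le> norm p * norm v" by (rule norm_cauchy_schwarz)
    also have "\<dots> \<le> P * norm v" using True by (intro mult_right_mono) auto
    finally show ?thesis using M[OF True, of x] by linarith
  next
    case False
    then have "p \<bullet> v - H x p \<le> - H x 0" using P(2)[of v p x] by simp
    moreover have "\<bar>H x 0\<bar> \<le> M" using P(1) M[of 0 x] by simp
    moreover have "P * norm v \<ge> 0" using P by (intro mult_nonneg_nonneg) auto
    ultimately show ?thesis by linarith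
  qed
  then show ?thesis by (intro bdd_aboveI) auto
qed

lemma lagrangian_ge: "p \<bullet> v - H x p \<le> lagrangian H x v"
  unfolding lagrangian_def by (rule cSUP_upper[OF UNIV_I bdd_above_lagrangian])

text \<open>Testing the supremum with the momentum of length \<open>K\<close> parallel to
  \<open>v\<close> gives growth with slope \<open>K\<close>.\<close>

lemma superlinear_lagrangian: "superlinear (lagrangian H)"
  unfolding superlinear_def
proof (intro allI impI)
  fix K :: real assume "K > 0"
  obtain M where M: "\<And>x p. norm p \<le> K \<Longrightarrow> \<bar>H x p\<bar> \<le> M"
    using torus_continuous_bounded[OF cont, where R = K] by blast
  have "K * norm v - M \<le> lagrangian H x v" for x v
  proof -
    define p where "p = K *\<^sub>R sgn v"
    have "norm p \<le> K" using \<open>K > 0\<close> by (simp add: p_def norm_sgn)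
    moreover have "p \<bullet> v = K * norm v"
      by (cases "v = 0") (simp_all add: p_def sgn_div_norm power2_norm_eq_inner[symmetric] power2_eq_square)
    ultimately show ?thesis using lagrangian_ge[of p v x] M[of p x] by linarith
  qed
  then show "\<exists>C. \<forall>x v. lagrangian H x v \<ge> K * norm v - C" by blast
qed

text \<open>For velocities near a given one only momenta in a fixed ball matter. On that ball a
  competitor for one point is almost as good for a nearby point: one third of \<open>e\<close> is
  lost in the pairing and one third in \<open>H\<close>.\<close>

lemma torus_continuous_lagrangian: "torus_continuous (lagrangian H)"
  unfolding torus_continuous_def continuous_on_iff
proof (intro ballI allI impI)
  fix z :: "(real ^ 'n) \<times> (real ^ 'n)" and e :: real assume "e > 0"
  define R where "R = norm (snd z) + 1"
  obtain P where P: "P \<ge> 0" "\<And>x p v. norm v \<le> R \<Longrightarrow> norm p > P \<Longrightarrow> p \<bullet> v - H x p \<le> 0 \<bullet> v - H x 0"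
    using lagrangian_maximizer_bound[where R = R] by blast
  obtain d where d: "d > 0" "\<And>x y p q. norm p \<le> P \<Longrightarrow> norm q \<le> P \<Longrightarrow> norm (x - y) < d \<Longrightarrow>
      norm (p - q) < d \<Longrightarrow> \<bar>H (to_torus x) p - H (to_torus y) q\<bar> < e / 3"
    using torus_uniformly_continuous[OF cont, where R = P and e = "e / 3"] \<open>e > 0\<close>
    by (metis zero_less_divide_iff zero_less_numeral)
  define d' where "d' = min (min d 1) (e / (3 * (P + 1)))"
  have d': "d' > 0" "d' \<le> d" "d' \<le> 1" "d' \<le> e / (3 * (P + 1))"
    using d P \<open>e > 0\<close> by (auto simp: d'_def)
  have le: "lagrangian H (to_torus y) w \<le> lagrangian H (to_torus x) v + 2 * e / 3"
    if "norm v \<le> R" "norm w \<le> R" "norm (x - y) < d'" "norm (v - w) < d'" for x y v w :: "real ^ 'n"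
  proof -
    have small: "p \<bullet> w - H (to_torus y) p \<le> lagrangian H (to_torus x) v + 2 * e / 3" if "norm p \<le> P" for p
    proof -
      have "p \<bullet> w - p \<bullet> v = p \<bullet> (w - v)" by (simp add: inner_diff_right)
      also have "\<dots> \<le> norm p * norm (w - v)" by (rule norm_cauchy_schwarz)
      also have "\<dots> \<le> (P + 1) * (e / (3 * (P + 1)))"
        using that P d' \<open>norm (v - w) < d'\<close> by (intro mult_mono) (auto simp: norm_minus_commute)
      also have "\<dots> = e / 3" using P(1) by (simp add: field_simps)
      finally have "p \<bullet> w - p \<bullet> v \<le> e / 3" .
      moreover have "\<bar>H (to_torus x) p - H (to_torus y) p\<bar> < e / 3"
        using d(2)[of p p x y] d' d that \<open>norm (x - y) < d'\<close> by simp
      ultimately show ?thesis using lagrangian_ge[of p v "to_torus x"] by linarith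
    qed
    have "p \<bullet> w - H (to_torus y) p \<le> lagrangian H (to_torus x) v + 2 * e / 3" for p
      using small[of p] small[of 0] P(1) P(2)[of w p "to_torus y"] \<open>norm w \<le> R\<close>
      by (cases "norm p \<le> P") auto
    then show ?thesis unfolding lagrangian_def[of H "to_torus y"] by (intro cSUP_least) auto
  qed
  show "\<exists>d>0. \<forall>z'\<in>UNIV. dist z' z < d \<longrightarrow>
      dist (case z' of (x, v) \<Rightarrow> lagrangian H (to_torus x) v) (case z of (x, v) \<Rightarrow> lagrangian H (to_torus x) v) < e"
  proof (intro exI[of _ d'] conjI ballI impI)
    fix z' assume "dist z' z < d'"
    then have 1: "norm (fst z - fst z') < d'" "norm (snd z - snd z') < d'"
      using dist_fst_le[of z' z] dist_snd_le[of z' z] by (auto simp: dist_norm norm_minus_commute)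
    have 2: "norm (snd z) \<le> R" "norm (snd z') \<le> R"
      using 1 d' norm_triangle_sub[of "snd z'" "snd z"] by (auto simp: R_def norm_minus_commute)
    show "dist (case z' of (x, v) \<Rightarrow> lagrangian H (to_torus x) v)
        (case z of (x, v) \<Rightarrow> lagrangian H (to_torus x) v) < e"
      using le[of "snd z" "snd z'" "fst z" "fst z'"] le[of "snd z'" "snd z" "fst z'" "fst z"] 1 2 \<open>e > 0\<close>
      by (auto simp: case_prod_unfold dist_real_def norm_minus_commute)
  qed (use d' in auto)
qed

end

section \<open>Cycles of minimal mean cost and potentials\<close>


fun walk_cost :: "('a \<Rightarrow> 'a \<Rightarrow> real) \<Rightarrow> 'a list \<Rightarrow> real" where
  "walk_cost c (x # y # zs) = c x y + walk_cost c (y # zs)"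
| "walk_cost c _ = 0"

abbreviation cycle_cost :: "('a \<Rightarrow> 'a \<Rightarrow> real) \<Rightarrow> 'a list \<Rightarrow> real" where
  "cycle_cost c xs \<equiv> walk_cost c (xs @ [hd xs])"

lemma walk_cost_append: "walk_cost c (xs @ x # ys) = walk_cost c (xs @ [x]) + walk_cost c (x # ys)"
  by (induction xs rule: induct_list012) auto

lemma walk_cost_eq_sum: "walk_cost c (x # ys) = (\<Sum>i<length ys. c ((x # ys) ! i) (ys ! i))"
  by (induction ys arbitrary: x) (auto simp: sum.lessThan_Suc_shift simp del: sum.lessThan_Suc)

lemma walk_cost_diff_const:
  "walk_cost (\<lambda>x y. c x y - A) (x # ys) = walk_cost c (x # ys) - A * length ys"
  by (induction ys arbitrary: x) (auto simp: algebra_simps)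

lemma cycle_cost_diff_const:
  "xs \<noteq> [] \<Longrightarrow> cycle_cost (\<lambda>x y. c x y - A) xs = cycle_cost c xs - A * length xs"
  by (cases xs) (auto simp: walk_cost_diff_const)

text \<open>A closed walk is cut at two visits of \<open>y\<close> into two shorter closed walks;
  this is the reduction step towards simple cycles.\<close>

lemma cycle_cost_split:
  "cycle_cost c (xs @ [y] @ ys @ [y] @ zs) = cycle_cost c (y # ys) + cycle_cost c (xs @ y # zs)"
proof -
  define a where "a = hd (xs @ [y])"
  have "cycle_cost c (xs @ [y] @ ys @ [y] @ zs) = walk_cost c (xs @ y # (ys @ y # (zs @ [a])))"
    by (cases xs) (auto simp: a_def)
  also have "\<dots> = walk_cost c (xs @ [y]) + (walk_cost c ((y # ys) @ [y]) + walk_cost c (y # zs @ [a]))"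
    using walk_cost_append[of c xs y "ys @ y # (zs @ [a])"] walk_cost_append[of c "y # ys" y "zs @ [a]"] by simp
  also have "\<dots> = walk_cost c ((y # ys) @ [y]) + walk_cost c (xs @ y # zs @ [a])"
    using walk_cost_append[of c xs y "zs @ [a]"] by simp
  also have "walk_cost c (xs @ y # zs @ [a]) = cycle_cost c (xs @ y # zs)"
    by (cases xs) (auto simp: a_def)
  finally show ?thesis by simp
qed

text \<open>There are finitely many simple cycles, and one of least mean cost is taken. A closed
  walk with a repeated vertex splits into two shorter ones whose costs and lengths add, so induction
  on the length carries the bound to all closed walks.\<close>

lemma min_mean_cycle:
  fixes c :: "'a \<Rightarrow> 'a \<Rightarrow> real"
  assumes "finite G" "G \<noteq> {}"
  obtains A :: real and xs where "xs \<noteq> []" "set xs \<subseteq> G" "cycle_cost c xs = A * length xs"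
    "\<And>ys. ys \<noteq> [] \<Longrightarrow> set ys \<subseteq> G \<Longrightarrow> cycle_cost c ys \<ge> A * length ys"
proof -
  define D where "D = {xs. set xs \<subseteq> G \<and> distinct xs} - {[]}"
  define f where "f xs = cycle_cost c xs / length xs" for xs
  have "finite D"
  proof (rule finite_subset)
    show "D \<subseteq> {xs. set xs \<subseteq> G \<and> length xs \<le> card G}"
      using \<open>finite G\<close> by (auto simp: D_def) (metis card_mono distinct_card)
  qed (use \<open>finite G\<close> in \<open>rule finite_lists_length_le\<close>)
  moreover have "D \<noteq> {}"
  proof -
    obtain g where "g \<in> G" using assms by blast
    then have "[g] \<in> D" by (simp add: D_def)
    then show ?thesis by blast
  qed
  ultimately obtain xs where xs: "xs \<in> D" "\<And>ys. ys \<in> D \<Longrightarrow> f xs \<le> f ys"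
    using arg_min_if_finite[of D f] by (meson not_le)
  have min: "cycle_cost c ys \<ge> f xs * length ys" if "ys \<noteq> []" "set ys \<subseteq> G" for ys
    using that
  proof (induction ys rule: length_induct)
    case (1 ys)
    show ?case
    proof (cases "distinct ys")
      case True
      then have "f xs \<le> f ys" using 1 xs by (auto simp: D_def)
      then show ?thesis using 1 by (auto simp: f_def field_simps)
    next
      case False
      then obtain as y bs cs where ys: "ys = as @ [y] @ bs @ [y] @ cs"
        using not_distinct_decomp by blast
      have "f xs * length (y # bs) \<le> cycle_cost c (y # bs)"
        using 1(1)[rule_format, of "y # bs"] 1(2,3) ys by simp
      moreover have "f xs * length (as @ y # cs) \<le> cycle_cost c (as @ y # cs)"
        using 1(1)[rule_format, of "as @ y # cs"] 1(2,3) ys by simp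
      moreover have "f xs * length ys = f xs * length (y # bs) + f xs * length (as @ y # cs)"
        by (simp add: ys algebra_simps)
      ultimately show ?thesis
        unfolding ys cycle_cost_split by linarith
    qed
  qed
  show thesis
    by (rule that[OF _ _ _ min]) (use xs in \<open>auto simp: D_def f_def\<close>)
qed

text \<open>The potential at \<open>y\<close> is the infimum of the costs of all walks ending at
  \<open>y\<close>, with free starting point. It is finite because a walk can be closed by one more
  edge of cost at most \<open>B\<close>, and closed walks have nonnegative cost.\<close>

lemma nonneg_cycles_imp_potential:
  fixes c :: "'a \<Rightarrow> 'a \<Rightarrow> real"
  assumes "finite G" "\<And>xs. xs \<noteq> [] \<Longrightarrow> set xs \<subseteq> G \<Longrightarrow> cycle_cost c xs \<ge> 0"
  obtains u where "\<And>x y. x \<in> G \<Longrightarrow> y \<in> G \<Longrightarrow> u y - u x \<le> c x y"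
proof -
  define W where "W y = (\<lambda>xs. walk_cost c (xs @ [y])) ` {xs. set xs \<subseteq> G}" for y
  define u where "u y = Inf (W y)" for y
  obtain B where B: "\<And>x y. x \<in> G \<Longrightarrow> y \<in> G \<Longrightarrow> c x y \<le> B"
  proof
    fix x y assume "x \<in> G" "y \<in> G"
    then show "c x y \<le> Max ((\<lambda>(x, y). c x y) ` (G \<times> G))"
      using \<open>finite G\<close> by (intro Max_ge) auto
  qed
  have bdd: "bdd_below (W y)" if "y \<in> G" for y
  proof (rule bdd_belowI)
    fix w assume "w \<in> W y"
    then obtain xs where xs: "set xs \<subseteq> G" "w = walk_cost c (xs @ [y])" by (auto simp: W_def)
    have "0 \<le> cycle_cost c (xs @ [y])" using xs that by (intro assms(2)) auto
    also have "\<dots> = w + c y (hd (xs @ [y]))"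
      using walk_cost_append[of c xs y "[hd (xs @ [y])]"] xs by simp
    also have "c y (hd (xs @ [y])) \<le> B"
      using xs that by (intro B) (cases xs; auto)+
    finally show "- B \<le> w" by simp
  qed
  show thesis
  proof
    fix x y assume xy: "x \<in> G" "y \<in> G"
    have "u y - c x y \<le> w" if w: "w \<in> W x" for w
    proof -
      obtain xs where xs: "set xs \<subseteq> G" "w = walk_cost c (xs @ [x])" using w by (auto simp: W_def)
      have "walk_cost c ((xs @ [x]) @ [y]) \<in> W y" using xs xy unfolding W_def by (intro imageI) simp
      then have "u y \<le> walk_cost c ((xs @ [x]) @ [y])" unfolding u_def by (rule cInf_lower[OF _ bdd[OF xy(2)]])
      also have "\<dots> = w + c x y" using walk_cost_append[of c xs x "[y]"] xs by simp
      finally show ?thesis by simp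
    qed
    then have "u y - c x y \<le> u x"
      unfolding u_def[of x] by (intro cInf_greatest) (auto simp: W_def intro: exI[of _ "[]"])
    then show "u y - u x \<le> c x y" by simp
  qed
qed

text \<open>Along a cycle of minimal mean the slacks in the potential inequality are nonnegative,
  and they sum to zero since the potential telescopes. Hence each of them vanishes.\<close>

lemma calibrated_cycle:
  fixes c :: "'a \<Rightarrow> 'a \<Rightarrow> real"
  assumes "finite G" "G \<noteq> {}"
  obtains A :: real and u x and k :: nat where
    "\<And>a b. a \<in> G \<Longrightarrow> b \<in> G \<Longrightarrow> u b - u a \<le> c a b - A"
    "k > 0" "\<And>i. x i \<in> G" "x k = x 0"
    "\<And>i. i < k \<Longrightarrow> u (x (Suc i)) - u (x i) = c (x i) (x (Suc i)) - A"
proof -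
  obtain A :: real and xs where xs: "xs \<noteq> []" "set xs \<subseteq> G" "cycle_cost c xs = A * length xs"
    and min: "\<And>ys. ys \<noteq> [] \<Longrightarrow> set ys \<subseteq> G \<Longrightarrow> cycle_cost c ys \<ge> A * length ys"
    using min_mean_cycle[OF assms] by metis
  have "cycle_cost (\<lambda>x y. c x y - A) ys \<ge> 0" if "ys \<noteq> []" "set ys \<subseteq> G" for ys
    using min[OF that] cycle_cost_diff_const[OF that(1)] by simp
  then obtain u where u: "\<And>x y. x \<in> G \<Longrightarrow> y \<in> G \<Longrightarrow> u y - u x \<le> c x y - A"
    using nonneg_cycles_imp_potential[OF assms(1)] by blast
  \<comment> \<open>Indexing modulo the length makes the cycle a periodic sequence, so that
    \<open>x k = x 0\<close> and membership in \<open>G\<close> holds for every index.\<close>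
  define x where "x i = xs ! (i mod length xs)" for i
  have xG: "x i \<in> G" for i using xs by (auto simp: x_def intro!: subsetD[OF xs(2)] nth_mem)
  have x_Suc: "(tl xs @ [hd xs]) ! i = x (Suc i)" if "i < length xs" for i
    using that xs(1) by (cases xs) (auto simp: x_def nth_append mod_Suc less_Suc_eq)
  have x_eq: "(xs @ [hd xs]) ! i = x i" if "i < length xs" for i
    using that by (simp add: x_def nth_append)
  have app: "xs @ [hd xs] = hd xs # (tl xs @ [hd xs])" using xs(1) by simp
  have "cycle_cost c xs = (\<Sum>i<length xs. c ((xs @ [hd xs]) ! i) ((tl xs @ [hd xs]) ! i))"
    unfolding app walk_cost_eq_sum using xs(1) by simp
  also have "\<dots> = (\<Sum>i<length xs. c (x i) (x (Suc i)))"
    using x_Suc x_eq by (intro sum.cong) auto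
  finally have "cycle_cost c xs = (\<Sum>i<length xs. c (x i) (x (Suc i)))" .
  then have "(\<Sum>i<length xs. c (x i) (x (Suc i)) - A - (u (x (Suc i)) - u (x i))) =
      - (\<Sum>i<length xs. u (x (Suc i)) - u (x i))"
    using xs(3) by (simp add: sum_subtractf mult.commute)
  also have "\<dots> = 0" using sum_lessThan_telescope[of "\<lambda>i. u (x i)" "length xs"] by (simp add: x_def)
  finally have "\<forall>i\<in>{..<length xs}. c (x i) (x (Suc i)) - A - (u (x (Suc i)) - u (x i)) = 0"
    by (subst (asm) sum_nonneg_eq_0_iff) (use u[OF xG xG] in \<open>auto simp: le_diff_eq diff_le_eq\<close>)
  then show thesis
    using that[of u A "length xs" x] u xG xs(1) by (auto simp: x_def)
qed

section \<open>Compactness of empirical measures\<close>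


definition binary_digit :: "real \<Rightarrow> nat \<Rightarrow> real" where
  "binary_digit y k = of_int (\<lfloor>2 ^ Suc k * y\<rfloor> - 2 * \<lfloor>2 ^ k * y\<rfloor>)"

lemma binary_digit_cases: "binary_digit y k = 0 \<or> binary_digit y k = 1"
proof -
  have "\<lfloor>2 ^ Suc k * y\<rfloor> - 2 * \<lfloor>2 ^ k * y\<rfloor> \<in> {0, 1}"
    using floor_correct[of "2 ^ k * y"] floor_correct[of "2 ^ Suc k * y"]
    by (simp add: mult.assoc) linarith
  then show ?thesis by (auto simp: binary_digit_def)
qed

text \<open>The digits are differences of the dyadic truncations of \<open>y\<close>, so the series
  telescopes. At \<open>y = 1\<close> all digits would be 0, which is why the interval is
  half-open.\<close>

lemma binary_digit_sums:
  assumes "0 \<le> y" "y < 1"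
  shows "(\<lambda>k. binary_digit y k / 2 ^ Suc k) sums y"
proof -
  define f where "f k = of_int \<lfloor>2 ^ k * y\<rfloor> / (2::real) ^ k" for k
  have bound: "\<bar>f k - y\<bar> \<le> (1/2) ^ k" for k
  proof -
    have "f k - y = (of_int \<lfloor>2 ^ k * y\<rfloor> - 2 ^ k * y) / 2 ^ k"
      by (simp add: f_def field_simps)
    moreover have "\<bar>of_int \<lfloor>2 ^ k * y\<rfloor> - 2 ^ k * y\<bar> \<le> 1" by linarith
    ultimately have "\<bar>f k - y\<bar> \<le> 1 / 2 ^ k" by (simp add: abs_divide divide_right_mono)
    then show ?thesis by (simp add: power_one_over)
  qed
  have "(\<lambda>k. f k - y) \<longlonglongrightarrow> 0"
    by (rule Lim_null_comparison[OF _ LIMSEQ_power_zero[of "1/2 :: real"]]) (use bound in auto)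
  then have "f \<longlonglongrightarrow> y" by (simp add: LIM_zero_iff)
  from telescope_sums[OF this] have "(\<lambda>k. f (Suc k) - f k) sums (y - f 0)" .
  moreover have "f 0 = 0" using assms by (simp add: f_def floor_eq_iff)
  moreover have "f (Suc k) - f k = binary_digit y k / 2 ^ Suc k" for k
    by (simp add: f_def binary_digit_def field_simps)
  ultimately show ?thesis by simp
qed

text \<open>Schoenberg's space-filling curve. On \<open>[0,1/3]\<close> and on \<open>[2/3,1]\<close>, modulo \<open>2\<close>, the function
  \<open>digit_fun\<close> is \<open>0\<close> and \<open>1\<close>, so along \<open>3 ^ i * t\<close> it reads off the ternary digits of a point \<open>t\<close> of the
  Cantor set.\<close>

definition digit_fun :: "real \<Rightarrow> real" where
  "digit_fun t = min 1 (max 0 (1 / 2 - cos (pi * t)))"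

lemma digit_fun_bounds: "0 \<le> digit_fun t" "digit_fun t \<le> 1"
  by (auto simp: digit_fun_def)

lemma continuous_on_digit_fun: "continuous_on UNIV (\<lambda>t. digit_fun (c * t))"
  unfolding digit_fun_def by (intro continuous_intros)

lemma digit_fun_periodic: "digit_fun (2 * of_int i + t) = digit_fun t"
proof -
  have "cos (pi * (2 * of_int i + t)) = cos (pi * t)"
    using cos_int_2pin[of i] sin_int_2pin[of i]
    by (simp add: distrib_left cos_add mult_ac)
  then show ?thesis by (simp add: digit_fun_def)
qed

lemma digit_fun_eq_0:
  assumes "0 \<le> t" "t \<le> 1 / 3" shows "digit_fun t = 0"
proof -
  have "cos (pi / 3) \<le> cos (pi * t)"
    using assms by (intro cos_monotone_0_pi_le) (auto simp: field_simps)
  then show ?thesis by (simp add: digit_fun_def cos_60)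
qed

lemma digit_fun_eq_1:
  assumes "2 / 3 \<le> t" "t \<le> 1" shows "digit_fun t = 1"
proof -
  have "cos (pi / 3) \<le> cos (pi * (1 - t))"
    using assms by (intro cos_monotone_0_pi_le) (auto simp: field_simps)
  also have "cos (pi * (1 - t)) = - cos (pi * t)"
    by (simp add: right_diff_distrib cos_diff)
  finally show ?thesis by (simp add: digit_fun_def cos_60)
qed

text \<open>Take the \<open>t\<close> with ternary digits \<open>2 * a i\<close>. Multiplication by
  \<open>3 ^ n\<close> moves the first \<open>n\<close> digits into an integer, which is even
  because the digits are 0 or 2, and the period 2 of \<open>digit_fun\<close> removes it. The
  remaining tail \<open>T n\<close> lies in [0,1/3] or [2/3,1] according to
  \<open>a n\<close>.\<close>

lemma digit_fun_cantor:
  fixes a :: "nat \<Rightarrow> real"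
  assumes a: "\<And>i. a i = 0 \<or> a i = 1"
  obtains t where "t \<in> {0..1}" "\<And>n. digit_fun (3 ^ n * t) = a n"
proof -
  define T where "T n = (\<Sum>i. 2 * a (i + n) / 3 ^ Suc i)" for n
  have geo: "(\<lambda>i. 2 / (3::real) ^ Suc i) sums 1"
    using sums_mult[OF geometric_sums[of "1/3 :: real"], of "2/3"] by (simp add: power_one_over divide_simps)
  have digit_term: "0 \<le> 2 * a (i + n) / 3 ^ Suc i" "2 * a (i + n) / 3 ^ Suc i \<le> 2 / 3 ^ Suc i" for i n
    using a[of "i + n"] by (auto simp: divide_simps)
  have sm: "summable (\<lambda>i. 2 * a (i + n) / 3 ^ Suc i)" for n
    by (rule summable_comparison_test'[OF sums_summable[OF geo], of 0]) (simp only: real_norm_def abs_of_nonneg[OF digit_term(1)] digit_term(2))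
  have T01: "0 \<le> T n" "T n \<le> 1" for n
  proof -
    show "0 \<le> T n" unfolding T_def by (rule suminf_nonneg[OF sm]) (rule digit_term)
    have "T n \<le> (\<Sum>i. 2 / (3::real) ^ Suc i)"
      unfolding T_def by (rule suminf_le[OF _ sm sums_summable[OF geo]]) (rule digit_term)
    then show "T n \<le> 1" using sums_unique[OF geo] by simp
  qed
  have step: "3 * T n = 2 * a n + T (Suc n)" for n
  proof -
    have "T n = 2 * a n / 3 + (\<Sum>i. 2 * a (Suc i + n) / 3 ^ Suc (Suc i))"
      unfolding T_def using suminf_split_head[OF sm[of n]] by simp
    also have "(\<Sum>i. 2 * a (Suc i + n) / 3 ^ Suc (Suc i)) = (\<Sum>i. 2 * a (i + Suc n) / 3 ^ Suc i / 3)"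
      by simp
    also have "\<dots> = T (Suc n) / 3" unfolding T_def by (rule suminf_divide[OF sm])
    finally show ?thesis by simp
  qed
  have ex: "\<exists>j::int. 3 ^ n * T 0 = 2 * of_int j + T n" for n
  proof (induction n)
    case (Suc n)
    then obtain j :: int where "3 ^ n * T 0 = 2 * of_int j + T n" by blast
    then have "3 ^ Suc n * T 0 = 2 * of_int (3 * j) + 2 * a n + T (Suc n)"
      using step[of n] by simp
    then show ?case using a[of n]
      by (auto intro: exI[of _ "3 * j"] exI[of _ "3 * j + 1"])
  qed (simp add: exI[of _ 0])
  show thesis
  proof
    show "T 0 \<in> {0..1}" using T01 by simp
    fix n
    obtain j :: int where j: "3 ^ n * T 0 = 2 * of_int j + T n" using ex by blast
    have "digit_fun (3 ^ n * T 0) = digit_fun (T n)" unfolding j by (rule digit_fun_periodic)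
    also have "\<dots> = a n"
      using a[of n] step[of n] T01[of "Suc n"] digit_fun_eq_0[of "T n"] digit_fun_eq_1[of "T n"] by auto
    finally show "digit_fun (3 ^ n * T 0) = a n" .
  qed
qed

text \<open>One ternary expansion encodes countably many binary ones: different \<open>j\<close>
  read disjoint sets of positions, so all coordinates can be prescribed independently.\<close>

definition schoenberg :: "nat \<Rightarrow> real \<Rightarrow> real" where
  "schoenberg j t = (\<Sum>k. digit_fun (3 ^ prod_encode (j, k) * t) / 2 ^ Suc k)"

lemma half_sums: "(\<lambda>k. 1 / (2::real) ^ Suc k) sums 1"
  using power_half_series by (simp add: power_one_over)

lemma schoenberg_term_bounds:
  "0 \<le> digit_fun s / 2 ^ Suc k" "digit_fun s / 2 ^ Suc k \<le> 1 / 2 ^ Suc k"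
  using digit_fun_bounds[of s] by (auto intro: divide_right_mono)

lemma continuous_on_schoenberg: "continuous_on UNIV (schoenberg j)"
proof -
  have "uniform_limit UNIV (\<lambda>n t. \<Sum>k<n. digit_fun (3 ^ prod_encode (j, k) * t) / 2 ^ Suc k)
      (schoenberg j) sequentially"
    unfolding schoenberg_def[abs_def]
    by (rule Weierstrass_m_test[OF _ sums_summable[OF half_sums]])
      (use digit_fun_bounds in \<open>simp add: abs_of_nonneg divide_right_mono\<close>)
  then show ?thesis
    by (rule uniform_limit_theorem[rotated])
      (auto intro!: always_eventually continuous_intros continuous_on_digit_fun)
qed

lemma schoenberg_bounds: "0 \<le> schoenberg j t" "schoenberg j t \<le> 1"
proof -
  have sm: "summable (\<lambda>k. digit_fun (3 ^ prod_encode (j, k) * t) / 2 ^ Suc k)"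
    by (rule summable_comparison_test'[OF sums_summable[OF half_sums], of 0])
      (use digit_fun_bounds in \<open>simp add: abs_of_nonneg divide_right_mono\<close>)
  show "0 \<le> schoenberg j t"
    unfolding schoenberg_def by (rule suminf_nonneg[OF sm]) (rule schoenberg_term_bounds)
  have "schoenberg j t \<le> (\<Sum>k. 1 / (2::real) ^ Suc k)"
    unfolding schoenberg_def
    by (rule suminf_le[OF _ sm sums_summable[OF half_sums]]) (rule schoenberg_term_bounds)
  then show "schoenberg j t \<le> 1" using sums_unique[OF half_sums] by simp
qed

lemma schoenberg_surj:
  assumes "\<And>j. 0 \<le> y j" "\<And>j. y j < 1"
  obtains t where "t \<in> {0..1}" "\<And>j. schoenberg j t = y j"
proof -
  define a where "a i = binary_digit (y (fst (prod_decode i))) (snd (prod_decode i))" for i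
  obtain t where t01: "t \<in> {0..1}" and t: "\<And>n. digit_fun (3 ^ n * t) = a n"
    by (rule digit_fun_cantor[of a]) (auto simp: a_def binary_digit_cases)
  have "schoenberg j t = y j" for j
    using sums_unique[OF binary_digit_sums[OF assms(1)[of j] assms(2)[of j]]]
    unfolding schoenberg_def t by (simp add: a_def)
  with t01 show thesis by (rule that)
qed

lemma space_filling_curve:
  fixes R :: real
  assumes "R \<ge> 0"
  obtains p :: "real \<Rightarrow> 'a::euclidean_space"
  where "continuous_on UNIV p" "bounded (range p)" "cball 0 R \<subseteq> p ` {0..1}"
proof -
  obtain idx :: "'a \<Rightarrow> nat" where idx: "inj_on idx Basis"
    using finite_imp_inj_to_nat_seg[OF finite_Basis] by metis
  \<comment> \<open>The curve fills a cube of half-width \<open>R + 1\<close> rather than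
    \<open>R\<close>: rescaled coordinates of points of the ball then stay strictly below 1, as the
    binary expansion requires.\<close>
  define p :: "real \<Rightarrow> 'a" where
    "p t = (\<Sum>b\<in>Basis. (2 * (R + 1) * schoenberg (idx b) t - (R + 1)) *\<^sub>R b)" for t
  have "continuous_on UNIV p"
    unfolding p_def[abs_def] by (intro continuous_intros continuous_on_schoenberg)
  moreover have "norm (p t) \<le> real DIM('a) * (R + 1)" for t
  proof -
    have "norm (p t) \<le> (\<Sum>b\<in>(Basis :: 'a set). R + 1)"
      unfolding p_def
    proof (rule sum_norm_le)
      fix b :: 'a assume "b \<in> Basis"
      have "2 * (R + 1) * schoenberg (idx b) t \<le> 2 * (R + 1) * 1"
        using assms schoenberg_bounds by (intro mult_left_mono) auto
      moreover have "0 \<le> 2 * (R + 1) * schoenberg (idx b) t"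
        using assms schoenberg_bounds by (intro mult_nonneg_nonneg) auto
      ultimately show "norm ((2 * (R + 1) * schoenberg (idx b) t - (R + 1)) *\<^sub>R b) \<le> R + 1"
        using \<open>b \<in> Basis\<close> by simp
    qed
    then show ?thesis by simp
  qed
  then have "bounded (range p)" by (auto simp: bounded_iff)
  moreover have "cball 0 R \<subseteq> p ` {0..1}"
  proof
    fix z :: 'a assume "z \<in> cball 0 R"
    then have z: "\<bar>z \<bullet> b\<bar> \<le> R" if "b \<in> Basis" for b
      using Basis_le_norm[OF that, of z] by simp
    define y where "y j = (if j \<in> idx ` Basis then (z \<bullet> inv_into Basis idx j + R + 1) / (2 * (R + 1)) else 0)" for j
    have y: "y (idx b) = (z \<bullet> b + R + 1) / (2 * (R + 1))" if "b \<in> Basis" for b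
      using that idx by (simp add: y_def)
    have "0 \<le> y j \<and> y j < 1" for j
    proof (cases "j \<in> idx ` Basis")
      case True
      then obtain b where "b \<in> Basis" "j = idx b" by blast
      moreover have "0 \<le> (z \<bullet> b + R + 1) / (2 * (R + 1))" "(z \<bullet> b + R + 1) / (2 * (R + 1)) < 1"
        using z[OF \<open>b \<in> Basis\<close>] assms by (auto simp: divide_simps)
      ultimately show ?thesis using y[of b] by simp
    qed (simp add: y_def)
    then obtain t where t01: "t \<in> {0..1}" and t: "\<And>j. schoenberg j t = y j" using schoenberg_surj[of y] by blast
    have "p t = (\<Sum>b\<in>Basis. (z \<bullet> b) *\<^sub>R b)"
      unfolding p_def using assms by (intro sum.cong) (auto simp: t y)
    then have "p t = z" by (simp add: euclidean_representation)
    with t01 show "z \<in> p ` {0..1}" by blast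
  qed
  ultimately show thesis by (rule that)
qed

text \<open>Test functions may be arbitrary continuous functions: composed with the curve they are
  bounded, because the curve has bounded range on the whole line. This is what later permits testing
  with \<open>L\<close> itself.\<close>

lemma empirical_measures_compact:
  fixes z :: "nat \<Rightarrow> nat \<Rightarrow> 'a::euclidean_space" and k :: "nat \<Rightarrow> nat"
  assumes k: "\<And>n. k n > 0" and z: "\<And>n i. i < k n \<Longrightarrow> norm (z n i) \<le> R"
  obtains r :: "nat \<Rightarrow> nat" and M :: "'a measure"
  where "strict_mono r" "prob_space M" "sets M = sets borel"
    "\<And>f :: 'a \<Rightarrow> real. continuous_on UNIV f \<Longrightarrow> integrable M f \<and>
      (\<lambda>n. (\<Sum>i<k (r n). f (z (r n) i)) / k (r n)) \<longlonglongrightarrow> (\<integral>x. f x \<partial>M)"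
proof -
  have "R \<ge> 0" using z[of 0 0] k[of 0] norm_ge_zero order_trans by blast
  obtain p :: "real \<Rightarrow> 'a" where p: "continuous_on UNIV p" "bounded (range p)" "cball 0 R \<subseteq> p ` {0..1}"
    by (rule space_filling_curve[OF \<open>R \<ge> 0\<close>])
  have "\<exists>s\<in>{0..1}. p s = z n i" if "i < k n" for n i
  proof -
    have "z n i \<in> p ` {0..1}" using p(3) z[OF that] by auto
    then show ?thesis by auto
  qed
  then have *: "\<exists>s. i < k n \<longrightarrow> s \<in> {0..1} \<and> p s = z n i" for n i by blast
  define t where "t n i = (SOME s. i < k n \<longrightarrow> s \<in> {0..1} \<and> p s = z n i)" for n i
  have t: "t n i \<in> {0..1}" "p (t n i) = z n i" if "i < k n" for n i
    using someI_ex[OF *[of i n]] that by (auto simp: t_def)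
  define m where "m n = distr (measure_pmf (pmf_of_set {..<k n})) borel (t n)" for n
  have fin: "finite {..<k n}" "{..<k n} \<noteq> {}" for n using k[of n] by auto
  have m: "real_distribution (m n)" for n
    unfolding m_def by (rule prob_space.real_distribution_distr[OF prob_space_measure_pmf]) simp
  have int_m: "(\<integral>x. g x \<partial>m n) = (\<Sum>i<k n. g (t n i)) / k n" if "g \<in> borel_measurable borel"
    for g :: "real \<Rightarrow> real" and n
    unfolding m_def using that by (simp add: integral_distr integral_pmf_of_set[OF fin(2) fin(1)])
  have "tight m"
    unfolding tight_def
  proof (intro conjI allI impI m)
    fix e :: real assume "e > 0"
    \<comment> \<open>Tightness is formulated with intervals open on the left, so the left endpoint
      is moved to -1 to retain mass at 0.\<close>
    have "measure (m n) {-1<..1} = 1" for n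
    proof -
      have "measure (m n) {-1<..1} = measure (measure_pmf (pmf_of_set {..<k n})) (t n -` {-1<..1})"
        unfolding m_def by (subst measure_distr) auto
      also have "\<dots> = 1"
      proof (subst measure_pmf.prob_eq_1)
        have "-1 < t n i \<and> t n i \<le> 1" if "i < k n" for i using t(1)[OF that] by simp
        then show "AE i in measure_pmf (pmf_of_set {..<k n}). i \<in> t n -` {-1<..1}"
          using fin[of n] by (auto simp: AE_measure_pmf_iff)
      qed simp
      finally show ?thesis .
    qed
    then show "\<exists>a b. a < b \<and> (\<forall>n. measure (m n) {a<..b} > 1 - e)"
      using \<open>e > 0\<close> by (intro exI[of _ "-1"] exI[of _ 1]) simp
  qed
  from tight_imp_convergent_subsubsequence[OF this strict_mono_id]
  obtain r M where r: "strict_mono r" "real_distribution M" "weak_conv_m (m \<circ> r) M" by auto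
  have meas_p [measurable]: "p \<in> borel_measurable borel"
    using p(1) by (rule borel_measurable_continuous_onI)
  interpret M: real_distribution M by fact
  show thesis
  proof
    show "prob_space (distr M borel p)" by (rule M.prob_space_distr) simp
    fix f :: "'a \<Rightarrow> real" assume f: "continuous_on UNIV f"
    have [measurable]: "f \<in> borel_measurable borel" using f by (rule borel_measurable_continuous_onI)
    have fp: "continuous_on UNIV (\<lambda>s. f (p s))"
      by (rule continuous_on_compose2[OF f p(1)]) simp
    have "compact (f ` closure (range p))"
      using p(2) by (intro compact_continuous_image continuous_on_subset[OF f]) (auto simp: compact_closure)
    then obtain B where "\<And>y. y \<in> f ` closure (range p) \<Longrightarrow> norm y \<le> B"
      using compact_imp_bounded bounded_iff by metis
    then have B: "\<And>s. norm (f (p s)) \<le> B"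
      using closure_subset[of "range p"] by blast
    have "integrable M (\<lambda>s. f (p s))"
      by (rule M.integrable_const_bound[of _ B]) (use B in auto)
    then have "integrable (distr M borel p) f"
      by (subst integrable_distr_eq) simp_all
    moreover have "(\<lambda>n. (\<Sum>i<k (r n). f (z (r n) i)) / k (r n)) \<longlonglongrightarrow> (\<integral>x. f x \<partial>distr M borel p)"
    proof -
      have "(\<lambda>n. \<integral>s. f (p s) \<partial>(m \<circ> r) n) \<longlonglongrightarrow> (\<integral>s. f (p s) \<partial>M)"
        by (rule weak_conv_imp_integral_bdd_continuous_conv[OF _ r(2) r(3) _ B])
          (use m fp in \<open>auto simp: continuous_on_eq_continuous_at\<close>)
      moreover have "(\<integral>s. f (p s) \<partial>(m \<circ> r) n) = (\<Sum>i<k (r n). f (z (r n) i)) / k (r n)" for n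
        using t(2) by (simp add: int_m)
      ultimately show ?thesis by (simp add: integral_distr)
    qed
    ultimately show "integrable (distr M borel p) f \<and>
      (\<lambda>n. (\<Sum>i<k (r n). f (z (r n) i)) / k (r n)) \<longlonglongrightarrow> (\<integral>x. f x \<partial>distr M borel p)" ..
  qed (use r in auto)
qed

section \<open>A smoothing kernel on the grid\<close>


text \<open>This is the mean of the \<open>2 * m\<close>-th power of the cosine over a period, that
  is, its constant Fourier coefficient.\<close>

definition central_ratio :: "nat \<Rightarrow> real" where
  "central_ratio m = real (2 * m choose m) / 4 ^ m"

lemma central_ratio_pos: "central_ratio m > 0"
  by (simp add: central_ratio_def)

text \<open>The left side is the mean of cos^(2m) sin^2. Relative to the mean of cos^(2m) it is 1 /
  (2m + 2), the rate at which the kernel concentrates.\<close>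

lemma central_ratio_Suc: "central_ratio m - central_ratio (Suc m) = central_ratio m / (2 * m + 2)"
proof -
  define b where "b = real (2 * m choose m)"
  have "real (2 * Suc m choose Suc m) = fact (2 * Suc m) / (fact (Suc m) * fact (Suc m))"
    using binomial_fact[of "Suc m" "2 * Suc m", where ?'a = real] by simp
  also have "fact (2 * Suc m) = (2 * real m + 2) * (2 * real m + 1) * (b * (fact m * fact m))"
    using binomial_fact[of m "2 * m", where ?'a = real] by (simp add: b_def algebra_simps)
  also have "\<dots> / (fact (Suc m) * fact (Suc m)) = 2 * (2 * real m + 1) * b / (real m + 1)"
    by (simp add: divide_simps) (simp add: algebra_simps)
  finally have "real (2 * Suc m choose Suc m) = 2 * (2 * real m + 1) * b / (real m + 1)" .
  then have "central_ratio m - central_ratio (Suc m) =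
      b / 4 ^ m - 2 * (2 * real m + 1) * b / (real m + 1) / 4 ^ Suc m"
    by (simp only: central_ratio_def b_def)
  also have "\<dots> = b / 4 ^ m / (2 * m + 2)"
    by (simp add: divide_simps) (simp add: algebra_simps)
  finally show ?thesis by (simp only: central_ratio_def b_def)
qed

text \<open>Orthogonality of characters: the sum is geometric with ratio an \<open>N\<close>-th root
  of unity, which differs from 1 because \<open>N\<close> does not divide \<open>q\<close>.\<close>

lemma sum_cis_multiples:
  fixes q :: int
  assumes "N > 0" "\<bar>q\<bar> < int N" "q \<noteq> 0"
  shows "(\<Sum>j<N. cis (2 * pi * of_int q * (t - real j / real N))) = 0"
proof -
  define w where "w = cis (- (2 * pi * of_int q / real N))"
  have "w \<noteq> 1"
  proof
    assume "w = 1"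
    then have "cos (2 * pi * of_int q / real N) = 1" by (simp add: w_def cis.ctr complex_eq_iff)
    then obtain n :: int where "2 * pi * of_int q / real N = of_int n * 2 * pi"
      using cos_one_2pi_int by blast
    then have "of_int q = of_int n * real N" using assms(1) by (simp add: field_simps)
    then have "q = n * int N"
      by (metis of_int_eq_iff of_int_mult of_int_of_nat_eq)
    with assms show False by (auto simp: abs_mult)
  qed
  have "w ^ N = cis (2 * pi * of_int (- q))"
    using assms(1) by (simp add: w_def Complex.DeMoivre)
  then have "w ^ N = 1" by (simp only: cis_multiple_2pi Ints_of_int)
  have "cis (2 * pi * of_int q * (t - real j / real N)) = cis (2 * pi * of_int q * t) * w ^ j" for j
    using assms(1) by (simp add: w_def Complex.DeMoivre cis_mult field_simps)
  then have "(\<Sum>j<N. cis (2 * pi * of_int q * (t - real j / real N)))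
      = cis (2 * pi * of_int q * t) * (\<Sum>j<N. w ^ j)"
    by (simp add: sum_distrib_left)
  also have "(\<Sum>j<N. w ^ j) = 0"
    using \<open>w \<noteq> 1\<close> \<open>w ^ N = 1\<close> by (simp add: geometric_sum)
  finally show ?thesis by simp
qed

text \<open>The binomial expansion has frequencies between -m and m, and sampling at more than
  \<open>m\<close> equispaced nodes annihilates all but the zero frequency. The sum is therefore
  independent of the offset \<open>t\<close>.\<close>

lemma sum_cos_power:
  assumes "m < N"
  shows "(\<Sum>j<N. cos (pi * (t - real j / real N)) ^ (2 * m)) = real N * central_ratio m"
proof -
  have expand: "complex_of_real (cos (pi * s) ^ (2 * m)) =
      (\<Sum>q\<le>2*m. of_nat (2 * m choose q) / 4 ^ m * cis (2 * pi * of_int (int q - int m) * s))" for s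
  proof -
    have "complex_of_real (cos (pi * s)) = (cis (pi * s) + cis (- (pi * s))) / 2"
      by (simp add: complex_eq_iff)
    then have "complex_of_real (cos (pi * s) ^ (2 * m)) = (cis (pi * s) + cis (- (pi * s))) ^ (2 * m) / 4 ^ m"
      by (simp only: of_real_power power_divide) (simp add: power_mult)
    also have "(cis (pi * s) + cis (- (pi * s))) ^ (2 * m) =
        (\<Sum>q\<le>2*m. of_nat (2 * m choose q) * cis (pi * s) ^ q * cis (- (pi * s)) ^ (2 * m - q))"
      by (rule binomial_ring)
    also have "\<dots> = (\<Sum>q\<le>2*m. of_nat (2 * m choose q) * cis (2 * pi * of_int (int q - int m) * s))"
    proof (rule sum.cong)
      fix q assume "q \<in> {..2*m}"
      then have "real q * (pi * s) + real (2 * m - q) * (- (pi * s)) = 2 * pi * of_int (int q - int m) * s"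
        by (simp add: of_nat_diff algebra_simps)
      then show "of_nat (2 * m choose q) * cis (pi * s) ^ q * cis (- (pi * s)) ^ (2 * m - q) =
          of_nat (2 * m choose q) * cis (2 * pi * of_int (int q - int m) * s)"
        by (simp only: Complex.DeMoivre cis_mult mult.assoc)
    qed simp
    finally show ?thesis by (simp add: sum_divide_distrib)
  qed
  have "complex_of_real (\<Sum>j<N. cos (pi * (t - real j / real N)) ^ (2 * m)) =
      (\<Sum>j<N. \<Sum>q\<le>2*m. of_nat (2 * m choose q) / 4 ^ m * cis (2 * pi * of_int (int q - int m) * (t - real j / real N)))"
    by (simp only: of_real_sum expand)
  also have "\<dots> = (\<Sum>q\<le>2*m. of_nat (2 * m choose q) / 4 ^ m *
      (\<Sum>j<N. cis (2 * pi * of_int (int q - int m) * (t - real j / real N))))"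
    by (subst sum.swap) (simp only: sum_distrib_left)
  also have "\<dots> = (\<Sum>q\<le>2*m. if q = m then of_nat (2 * m choose m) / 4 ^ m * of_nat N else 0)"
  proof (rule sum.cong)
    fix q assume "q \<in> {..2*m}"
    show "of_nat (2 * m choose q) / 4 ^ m * (\<Sum>j<N. cis (2 * pi * of_int (int q - int m) * (t - real j / real N)))
        = (if q = m then of_nat (2 * m choose m) / 4 ^ m * of_nat N else 0)"
    proof (cases "q = m")
      case False
      then show ?thesis
        using sum_cis_multiples[of N "int q - int m" t] assms \<open>q \<in> _\<close> by simp
    qed simp
  qed simp
  also have "\<dots> = complex_of_real (real N * central_ratio m)"
    by (simp add: central_ratio_def)
  finally show ?thesis by (simp only: of_real_eq_iff)
qed

lemma sum_cos_power_sin_squared: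
  assumes "Suc m < N"
  shows "(\<Sum>j<N. cos (pi * (t - real j / real N)) ^ (2 * m) * sin (pi * (t - real j / real N)) ^ 2)
    = real N * central_ratio m / (2 * m + 2)"
proof -
  have "cos s ^ (2 * m) * sin s ^ 2 = cos s ^ (2 * m) - cos s ^ (2 * Suc m)" for s :: real
  proof -
    have "cos s ^ (2 * Suc m) = cos s ^ (2 * m) * cos s ^ 2"
      by (simp only: mult_Suc_right power_add mult.commute[of "cos s ^ 2"])
    then show ?thesis by (simp only: sin_squared_eq right_diff_distrib mult_1_right)
  qed
  then have "(\<Sum>j<N. cos (pi * (t - real j / real N)) ^ (2 * m) * sin (pi * (t - real j / real N)) ^ 2)
     = real N * (central_ratio m - central_ratio (Suc m))"
    using assms by (simp only: sum_subtractf sum_cos_power right_diff_distrib[of "real N"] Suc_lessD)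
  then show ?thesis by (simp add: central_ratio_Suc)
qed

section \<open>Sums over the grid and the cosine weights\<close>

definition grid_point :: "nat \<Rightarrow> ('n::finite \<Rightarrow> nat) \<Rightarrow> real ^ 'n" where
  "grid_point N i = (\<chi> k. real (i k) * (1 / real N))"

lemma grid_eq: "grid N = grid_point N ` (UNIV \<rightarrow>\<^sub>E {..<N})"
  by (auto simp: grid_def grid_point_def PiE_def Pi_def image_def)

lemma inj_grid_point: "N > 0 \<Longrightarrow> inj (grid_point N :: ('n::finite \<Rightarrow> nat) \<Rightarrow> _)"
  by (auto simp: inj_def grid_point_def vec_eq_iff fun_eq_iff)

lemma finite_grid: "finite (grid N :: (real ^ 'n::finite) set)"
  unfolding grid_eq by (intro finite_imageI finite_PiE) auto

lemma card_grid: "N > 0 \<Longrightarrow> card (grid N :: (real ^ 'n::finite) set) = N ^ CARD('n)"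
  unfolding grid_eq by (subst card_image) (auto intro: inj_on_subset[OF inj_grid_point] simp: card_PiE)

lemma grid_nonempty: "N > 0 \<Longrightarrow> (0 :: real ^ 'n::finite) \<in> grid N"
  by (auto simp: grid_def vec_eq_iff intro!: exI[of _ "\<lambda>_. 0"])

lemma sum_grid_prod:
  assumes "N > 0"
  shows "(\<Sum>z\<in>grid N. \<Prod>k\<in>(UNIV::'n::finite set). f k (z $ k)) = (\<Prod>k\<in>UNIV. \<Sum>j<N. (f k (real j / real N) :: real))"
proof -
  have "(\<Prod>k\<in>(UNIV::'n set). \<Sum>j<N. f k (real j / real N)) =
      (\<Sum>i\<in>UNIV \<rightarrow>\<^sub>E {..<N}. \<Prod>k\<in>(UNIV::'n set). f k (real (i k) / real N))"
    by (rule prod_sum_PiE) auto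
  also have "\<dots> = (\<Sum>z\<in>grid N. \<Prod>k\<in>UNIV. f k (z $ k))"
    unfolding grid_eq using inj_on_subset[OF inj_grid_point[OF assms]]
    by (subst sum.reindex) (auto simp: grid_point_def)
  finally show ?thesis by simp
qed

text \<open>The even exponent gives nonnegativity and also period 1, since cos(pi t) itself changes
  sign under t \<mapsto> t + 1.\<close>

definition kernel :: "nat \<Rightarrow> real ^ 'n::finite \<Rightarrow> real" where
  "kernel m x = (\<Prod>k\<in>UNIV. cos (pi * x $ k) ^ (2 * m))"

definition weight :: "nat \<Rightarrow> nat \<Rightarrow> real ^ 'n::finite \<Rightarrow> real" where
  "weight N m x = kernel m x / (real N * central_ratio m) ^ CARD('n)"

lemma kernel_nonneg: "kernel m x \<ge> 0"
  unfolding kernel_def by (intro prod_nonneg) simp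

lemma weight_nonneg: "weight N m x \<ge> 0"
  unfolding weight_def using central_ratio_pos[of m] by (intro divide_nonneg_nonneg kernel_nonneg) auto

lemma weight_eq_prod:
  "weight N m x = (\<Prod>k\<in>UNIV. cos (pi * x $ k) ^ (2 * m) / (real N * central_ratio m))"
  by (simp add: weight_def kernel_def prod_dividef)

lemma sum_weight:
  assumes "m < N"
  shows "(\<Sum>z\<in>grid N. weight N m (x - z)) = 1"
  using sum_grid_prod[of N "\<lambda>k s. cos (pi * (x $ k - s)) ^ (2 * m) / (real N * central_ratio m)"]
    assms central_ratio_pos[of m]
  by (simp add: weight_eq_prod sum_divide_distrib[symmetric] sum_cos_power)

text \<open>This is a second moment of the weights, with the sine as a periodic measure of distance.
  It tends to 0 as \<open>m\<close> grows and depends on neither \<open>N\<close> nor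
  \<open>x\<close>.\<close>

lemma sum_weight_sin_squared:
  assumes "Suc m < N"
  shows "(\<Sum>z\<in>grid N. weight N m (x - z) * sin (pi * (x $ q - z $ q)) ^ 2) = 1 / (2 * m + 2)"
proof -
  \<comment> \<open>The squared sine enters the factor of coordinate \<open>q\<close> only, so that
    the summand remains a product over coordinates.\<close>
  define f where "f k s = cos (pi * (x $ k - s)) ^ (2 * m) / (real N * central_ratio m) *
    (if k = q then sin (pi * (x $ k - s)) ^ 2 else 1)" for k s
  have "(\<Sum>z\<in>grid N. weight N m (x - z) * sin (pi * (x $ q - z $ q)) ^ 2) =
      (\<Sum>z\<in>grid N. \<Prod>k\<in>UNIV. f k (z $ k))"
    by (simp add: weight_eq_prod f_def prod.distrib del: times_divide_eq_left)
  also have "\<dots> = (\<Prod>k\<in>UNIV. \<Sum>j<N. f k (real j / real N))"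
    using assms by (intro sum_grid_prod) simp
  also have "\<dots> = (\<Prod>k\<in>UNIV. if k = q then 1 / (2 * m + 2) else 1)"
  proof (rule prod.cong)
    fix k :: 'a
    show "(\<Sum>j<N. f k (real j / real N)) = (if k = q then 1 / (2 * m + 2) else 1)"
      using assms central_ratio_pos[of m] sum_cos_power[of m N "x $ k"] sum_cos_power_sin_squared[of m N "x $ k"]
      by (cases "k = q") (simp_all add: f_def sum_divide_distrib[symmetric])
  qed simp
  finally show ?thesis by simp
qed

lemma kernel_periodic: "kernel m (x + int_vec l) = kernel m x"
proof -
  have "cos (pi * (s + of_int j)) ^ 2 = cos (pi * s) ^ 2" for s and j :: int
  proof -
    have "sin (pi * of_int j) = 0" by (simp add: sin_zero_iff_int2 mult.commute)
    then have "cos (pi * of_int j) ^ 2 = 1" by (simp add: cos_squared_eq)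
    with \<open>sin (pi * of_int j) = 0\<close> show ?thesis
      by (simp add: distrib_left cos_add power_mult_distrib)
  qed
  then show ?thesis by (simp add: kernel_def power_mult)
qed


section \<open>Bounded functions with bounded Lipschitz gradient\<close>

definition C11_bounded :: "(real ^ 'n::finite \<Rightarrow> real) \<Rightarrow> (real ^ 'n \<Rightarrow> real ^ 'n) \<Rightarrow> real \<Rightarrow> bool" where
  "C11_bounded f g C \<longleftrightarrow> (\<forall>x. GDERIV f x :> g x) \<and> (\<forall>x. \<bar>f x\<bar> \<le> C \<and> norm (g x) \<le> C) \<and>
     (\<forall>x y. \<bar>f x - f y\<bar> \<le> C * norm (x - y) \<and> norm (g x - g y) \<le> C * norm (x - y))"

lemma GDERIV_prod_rule:
  assumes "GDERIV f x :> a" "GDERIV g x :> b"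
  shows "GDERIV (\<lambda>x. f x * g x) x :> (f x *\<^sub>R b + g x *\<^sub>R a)"
  using assms unfolding gderiv_def
  by (auto intro!: derivative_eq_intros simp: inner_add_right algebra_simps)

text \<open>The factor 4 counts the terms in the Lipschitz estimate for the gradient of a product;
  the other estimates produce at most two.\<close>

lemma C11_bounded_mult:
  assumes "C11_bounded f f' C" "C11_bounded g g' D"
  shows "C11_bounded (\<lambda>x. f x * g x) (\<lambda>x. f x *\<^sub>R g' x + g x *\<^sub>R f' x) (4 * C * D)"
proof -
  have f: "GDERIV f x :> f' x" "\<bar>f x\<bar> \<le> C" "norm (f' x) \<le> C"
    "\<bar>f x - f y\<bar> \<le> C * norm (x - y)" "norm (f' x - f' y) \<le> C * norm (x - y)" for x y
    using assms(1) by (auto simp: C11_bounded_def)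
  have g: "GDERIV g x :> g' x" "\<bar>g x\<bar> \<le> D" "norm (g' x) \<le> D"
    "\<bar>g x - g y\<bar> \<le> D * norm (x - y)" "norm (g' x - g' y) \<le> D * norm (x - y)" for x y
    using assms(2) by (auto simp: C11_bounded_def)
  have C: "0 \<le> C" "0 \<le> D" using f(2)[of 0] g(2)[of 0] by auto
  then have CD: "0 \<le> C * D" by simp
  have "\<bar>f x * g x\<bar> \<le> C * D" for x
    unfolding abs_mult using f(2) g(2) C by (intro mult_mono) auto
  then have 1: "\<bar>f x * g x\<bar> \<le> 4 * C * D" for x
    using order_trans[of "\<bar>f x * g x\<bar>" "C * D" "4 * (C * D)" for x] CD by (simp add: mult.assoc)
  have sc: "norm (a *\<^sub>R v) \<le> p * q" if "\<bar>a\<bar> \<le> p" "norm v \<le> q" for a p q and v :: "real ^ 'a"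
    unfolding norm_scaleR using that by (intro mult_mono) auto
  have "norm (f x *\<^sub>R g' x + g x *\<^sub>R f' x) \<le> C * D + D * C" for x
    by (rule norm_triangle_le, rule add_mono) (intro sc f g)+
  then have 2: "norm (f x *\<^sub>R g' x + g x *\<^sub>R f' x) \<le> 4 * C * D" for x
    using CD by (simp add: mult.assoc mult.commute[of D]) (smt (verit) CD)
  have 3: "\<bar>f x * g x - f y * g y\<bar> \<le> 4 * C * D * norm (x - y)" for x y
  proof -
    have "f x * g x - f y * g y = f x * (g x - g y) + (f x - f y) * g y" by (simp add: algebra_simps)
    also have "\<bar>\<dots>\<bar> \<le> C * (D * norm (x - y)) + (C * norm (x - y)) * D"
      by (rule order_trans[OF abs_triangle_ineq], unfold abs_mult, intro add_mono mult_mono f g)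
        (use C in auto)
    also have "\<dots> \<le> 4 * C * D * norm (x - y)"
      using mult_nonneg_nonneg[OF CD norm_ge_zero[of "x - y"]] by (simp add: algebra_simps)
    finally show ?thesis .
  qed
  have 4: "norm (f x *\<^sub>R g' x + g x *\<^sub>R f' x - (f y *\<^sub>R g' y + g y *\<^sub>R f' y)) \<le> 4 * C * D * norm (x - y)" for x y
  proof -
    have "f x *\<^sub>R g' x + g x *\<^sub>R f' x - (f y *\<^sub>R g' y + g y *\<^sub>R f' y) =
        (f x *\<^sub>R (g' x - g' y) + (f x - f y) *\<^sub>R g' y) + (g x *\<^sub>R (f' x - f' y) + (g x - g y) *\<^sub>R f' y)"
      by (simp add: algebra_simps)
    also have "norm \<dots> \<le> (C * (D * norm (x - y)) + (C * norm (x - y)) * D) +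
        (D * (C * norm (x - y)) + (D * norm (x - y)) * C)"
      by (intro norm_triangle_mono sc f g)
    also have "\<dots> = 4 * C * D * norm (x - y)" by (simp add: algebra_simps)
    finally show ?thesis .
  qed
  show ?thesis
    unfolding C11_bounded_def using 1 2 3 4 GDERIV_prod_rule[OF f(1) g(1)] by blast
qed

lemma C11_bounded_const: "C11_bounded (\<lambda>_. c) (\<lambda>_. 0) \<bar>c\<bar>"
  by (auto simp: C11_bounded_def gderiv_def)

lemma C11_bounded_prod:
  assumes "\<And>i. i \<in> I \<Longrightarrow> \<exists>g C. C11_bounded (f i) g C"
  shows "\<exists>g C. C11_bounded (\<lambda>x. \<Prod>i\<in>I. f i x) g C"
  using assms
proof (induction I rule: infinite_finite_induct)
  case (insert i I)
  then obtain g C g' C' where "C11_bounded (f i) g C" "C11_bounded (\<lambda>x. \<Prod>i\<in>I. f i x) g' C'" by blast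
  from C11_bounded_mult[OF this] show ?case using insert(1,2) by auto
qed (use C11_bounded_const[of 1] in auto)

lemma abs_sin_diff_le: "\<bar>sin a - sin b\<bar> \<le> \<bar>a - b\<bar>" for a b :: real
proof -
  have "\<bar>sin a - sin b\<bar> = 2 * (\<bar>sin ((a - b) / 2)\<bar> * \<bar>cos ((a + b) / 2)\<bar>)"
    by (simp add: sin_diff_sin abs_mult)
  also have "\<dots> \<le> 2 * (\<bar>(a - b) / 2\<bar> * 1)"
    by (intro mult_left_mono mult_mono abs_sin_x_le_abs_x) auto
  finally show ?thesis by simp
qed

lemma C11_bounded_cos: "\<exists>g C. C11_bounded (\<lambda>x. cos (pi * x $ k)) g C"
proof (intro exI)
  have s: "\<bar>sin (pi * a) - sin (pi * b)\<bar> \<le> pi * \<bar>a - b\<bar>"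
    "\<bar>cos (pi * a) - cos (pi * b)\<bar> \<le> pi * \<bar>a - b\<bar>" for a b :: real
  proof -
    show "\<bar>sin (pi * a) - sin (pi * b)\<bar> \<le> pi * \<bar>a - b\<bar>"
      using abs_sin_diff_le[of "pi * a" "pi * b"] by (simp add: right_diff_distrib[symmetric] abs_mult)
    show "\<bar>cos (pi * a) - cos (pi * b)\<bar> \<le> pi * \<bar>a - b\<bar>"
      using abs_sin_diff_le[of "pi / 2 - pi * a" "pi / 2 - pi * b"]
      by (simp add: sin_diff right_diff_distrib[symmetric] abs_mult abs_minus_commute)
  qed
  have comp: "pi * \<bar>x $ k - y $ k\<bar> \<le> pi * norm (x - y)" for x y :: "real ^ 'a"
    using component_le_norm_cart[of "x - y" k] by simp
  have pp: "pi * norm (x - y) \<le> pi ^ 2 * norm (x - y)" for x y :: "real ^ 'a"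
    using pi_ge_two by (intro mult_right_mono) (auto simp: power2_eq_square)
  have ps: "pi * \<bar>c\<bar> \<le> pi\<^sup>2" if "\<bar>c\<bar> \<le> 1" for c
    using mult_mono[of pi pi "\<bar>c\<bar>" pi] that pi_ge_two by (simp add: power2_eq_square)
  \<comment> \<open>The constant is the Lipschitz constant of the gradient; it dominates the bounds
    1 and pi for the function and its first derivative.\<close>
  show "C11_bounded (\<lambda>x :: real ^ 'a. cos (pi * x $ k)) (\<lambda>x. - (pi * sin (pi * x $ k)) *\<^sub>R axis k 1) (pi ^ 2)"
    unfolding C11_bounded_def
  proof (intro conjI allI)
    fix x y :: "real ^ 'a"
    show "GDERIV (\<lambda>x. cos (pi * x $ k)) x :> - (pi * sin (pi * x $ k)) *\<^sub>R axis k 1"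
      unfolding gderiv_def
      by (auto intro!: derivative_eq_intros bounded_linear.has_derivative[OF bounded_linear_vec_nth]
          simp: inner_axis)
    show "\<bar>cos (pi * x $ k)\<bar> \<le> pi\<^sup>2"
      using ps[of 1] pi_ge_two abs_cos_le_one[of "pi * x $ k"] by linarith
    show "norm (- (pi * sin (pi * x $ k)) *\<^sub>R axis k 1 :: real ^ 'a) \<le> pi\<^sup>2"
      using ps[of "sin (pi * x $ k)"] by (simp add: abs_mult)
    show "\<bar>cos (pi * x $ k) - cos (pi * y $ k)\<bar> \<le> pi\<^sup>2 * norm (x - y)"
      using s(2)[of "x $ k" "y $ k"] comp[of x y] pp[of x y] by linarith
    have "- (pi * sin (pi * x $ k)) *\<^sub>R axis k 1 - - (pi * sin (pi * y $ k)) *\<^sub>R axis k 1 =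
        (pi * (sin (pi * y $ k) - sin (pi * x $ k))) *\<^sub>R (axis k 1 :: real ^ 'a)"
      by (simp add: algebra_simps)
    also have "norm \<dots> = pi * \<bar>sin (pi * x $ k) - sin (pi * y $ k)\<bar>"
      by (simp add: abs_mult abs_minus_commute)
    also have "\<dots> \<le> pi * (pi * norm (x - y))"
      using order_trans[OF s(1)[of "x $ k" "y $ k"] comp[of x y]] by (intro mult_left_mono) auto
    finally show "norm (- (pi * sin (pi * x $ k)) *\<^sub>R axis k 1 - - (pi * sin (pi * y $ k)) *\<^sub>R axis k 1 :: real ^ 'a)
        \<le> pi\<^sup>2 * norm (x - y)" by (simp add: power2_eq_square mult.assoc)
  qed
qed

lemma C11_bounded_kernel: obtains g C where "C11_bounded (kernel m) g C"
proof -
  have "\<exists>g C. C11_bounded (\<lambda>x. cos (pi * x $ k) ^ (2 * m)) g C" for k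
    using C11_bounded_prod[of "{..<2*m}" "\<lambda>_ x. cos (pi * x $ k)"] C11_bounded_cos[of k] by simp
  then have "\<exists>g C. C11_bounded (\<lambda>x. \<Prod>k\<in>UNIV. cos (pi * x $ k) ^ (2 * m)) g C"
    by (intro C11_bounded_prod)
  then show thesis using that by (auto simp: kernel_def[abs_def])
qed

lemma gradient_mean_value:
  fixes f :: "real ^ 'n::finite \<Rightarrow> real"
  assumes "\<And>x. GDERIV f x :> g x"
  obtains t where "0 < t" "t < 1" "f (x + w) - f x = w \<bullet> g (x + t *\<^sub>R w)"
proof -
  have "\<exists>t\<in>{0<..<1::real}. f (x + 1 *\<^sub>R w) - f (x + 0 *\<^sub>R w) = (1 - 0) * (w \<bullet> g (x + t *\<^sub>R w))"
  proof (rule bexE[OF mvt_simple[of 0 1 "\<lambda>t. f (x + t *\<^sub>R w)" "\<lambda>t h. (h *\<^sub>R w) \<bullet> g (x + t *\<^sub>R w)"]])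
    fix t :: real
    have "((\<lambda>t. x + t *\<^sub>R w) has_derivative (\<lambda>h. h *\<^sub>R w)) (at t within {0..1})"
      by (auto intro!: derivative_eq_intros)
    moreover have "(f has_derivative (\<lambda>h. h \<bullet> g (x + t *\<^sub>R w))) (at (x + t *\<^sub>R w))"
      using assms by (simp add: gderiv_def)
    ultimately show "((\<lambda>t. f (x + t *\<^sub>R w)) has_derivative (\<lambda>h. (h *\<^sub>R w) \<bullet> g (x + t *\<^sub>R w))) (at t within {0..1})"
      by (rule has_derivative_compose)
  qed auto
  then show thesis using that by auto
qed

lemma C11_bounded_taylor:
  assumes "C11_bounded f g C"
  shows "\<bar>f (x + w) - f x - g x \<bullet> w\<bar> \<le> C * norm w ^ 2"
proof -
  have "GDERIV f x :> g x" for x using assms by (simp add: C11_bounded_def)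
  then obtain t where t: "0 < t" "t < 1" "f (x + w) - f x = w \<bullet> g (x + t *\<^sub>R w)"
    by (rule gradient_mean_value)
  have "f (x + w) - f x - g x \<bullet> w = w \<bullet> (g (x + t *\<^sub>R w) - g x)"
    using t by (simp add: inner_diff_right inner_commute)
  also have "\<bar>\<dots>\<bar> \<le> norm w * norm (g (x + t *\<^sub>R w) - g x)" by (rule Cauchy_Schwarz_ineq2)
  also have "\<dots> \<le> norm w * (C * norm (t *\<^sub>R w))"
    using assms unfolding C11_bounded_def by (intro mult_left_mono) (metis add_diff_cancel_left', simp)
  also have "\<dots> \<le> norm w * (C * norm w)"
  proof -
    have "0 \<le> C" using assms unfolding C11_bounded_def by (meson abs_ge_zero order_trans)
    then show ?thesis using t by (intro mult_left_mono) (auto intro: mult_left_le_one_le)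
  qed
  finally show ?thesis by (simp add: power2_eq_square mult_ac)
qed

section \<open>Invariance of grid sums under lattice translations\<close>

lemma frac_vec_grid:
  assumes "N > 0" "\<And>k. x $ k * real N \<in> \<int>"
  shows "frac_vec x \<in> grid N"
proof -
  define i where "i k = nat \<lfloor>frac (x $ k) * real N\<rfloor>" for k
  have "frac (x $ k) * real N \<in> \<int>" for k
    using assms(2)[of k] by (simp add: frac_def left_diff_distrib)
  then have "real (i k) = frac (x $ k) * real N" for k
    unfolding i_def by (metis Ints_cases floor_of_int frac_ge_0 mult_nonneg_nonneg of_int_0_le_iff of_nat_0_le_iff of_nat_nat)
  moreover from this have "i k < N" for k
  proof -
    have "frac (x $ k) * real N < 1 * real N"
      using frac_lt_1 assms(1) by (intro mult_strict_right_mono) auto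
    with \<open>\<And>k. real (i k) = _\<close> show ?thesis by (metis mult_1 of_nat_less_iff)
  qed
  ultimately show ?thesis
    unfolding grid_def frac_vec_def using assms(1) by (auto simp: vec_eq_iff intro!: exI[of _ i])
qed

lemma grid_lattice: "z \<in> grid N \<Longrightarrow> z $ k * real N \<in> \<int>"
  by (cases "N = 0") (auto simp: grid_def)

lemma frac_vec_on_grid: "z \<in> grid N \<Longrightarrow> frac_vec z = z"
  by (cases "N = 0") (auto simp: grid_def frac_vec_def vec_eq_iff frac_eq)

text \<open>Translation by a lattice vector followed by reduction modulo the integers permutes the
  grid, its inverse being translation by the opposite vector.\<close>

lemma sum_grid_shift:
  fixes F :: "real ^ 'n::finite \<Rightarrow> real"
  assumes N: "N > 0" and s: "\<And>k. s $ k * real N \<in> \<int>" and F: "\<And>x l. F (x + int_vec l) = F x"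
  shows "(\<Sum>z\<in>grid N. F (z + s)) = (\<Sum>z\<in>grid N. F z)"
proof -
  have Ff: "F (frac_vec x) = F x" for x by (simp only: frac_vec_eq F)
  have mem: "frac_vec (z + s) \<in> grid N" "frac_vec (z - s) \<in> grid N" if "z \<in> grid N" for z
    using N s grid_lattice[OF that] by (auto intro!: frac_vec_grid simp: distrib_right left_diff_distrib)
  have "frac_vec (frac_vec (z + s) - s) = z" "frac_vec (frac_vec (z - s) + s) = z" if "z \<in> grid N" for z
  proof -
    have "frac_vec (frac_vec (z + s) - s) = frac_vec (z + int_vec (\<chi> k. - \<lfloor>(z + s) $ k\<rfloor>))"
      unfolding frac_vec_eq[of "z + s"] by (rule arg_cong[of _ _ frac_vec]) simp
    then show "frac_vec (frac_vec (z + s) - s) = z" by (simp only: frac_vec_add_int_vec frac_vec_on_grid[OF that])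
    have "frac_vec (frac_vec (z - s) + s) = frac_vec (z + int_vec (\<chi> k. - \<lfloor>(z - s) $ k\<rfloor>))"
      unfolding frac_vec_eq[of "z - s"] by (rule arg_cong[of _ _ frac_vec]) simp
    then show "frac_vec (frac_vec (z - s) + s) = z" by (simp only: frac_vec_add_int_vec frac_vec_on_grid[OF that])
  qed
  then show ?thesis
    using mem by (intro sum.reindex_bij_witness[of _ "\<lambda>z. frac_vec (z - s)" "\<lambda>z. frac_vec (z + s)"])
      (simp_all only: Ff)
qed

section \<open>Discrete weak KAM theory\<close>


text \<open>A factor depending on the finite coordinate turns the infinite sum into a finite sum of
  marginals. The holonomy constraint is an identity between marginals, so this form makes it
  applicable.\<close>

lemma has_sum_first_coordinate:
  fixes w :: "'a \<times> 'b \<Rightarrow> real"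
  assumes "finite G" "w summable_on G \<times> B" "\<And>z. z \<in> G \<times> B \<Longrightarrow> w z \<ge> 0"
  shows "((\<lambda>(x, p). u x * w (x, p)) has_sum (\<Sum>x\<in>G. u x * (\<Sum>\<^sub>\<infinity>p\<in>B. w (x, p)))) (G \<times> B)"
proof -
  define M where "M = (\<Sum>x\<in>G. \<bar>u x\<bar>)"
  have M: "\<bar>u x\<bar> \<le> M" if "x \<in> G" for x
    unfolding M_def using \<open>finite G\<close> that by (intro member_le_sum) auto
  have "M \<ge> 0" unfolding M_def by (intro sum_nonneg) simp
  have "(\<lambda>z. norm (case z of (x, p) \<Rightarrow> u x * w (x, p))) summable_on G \<times> B"
    by (rule Infinite_Sum.abs_summable_on_comparison_test'[OF summable_on_cmult_right[OF assms(2), of M]])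
      (use M assms(3) \<open>M \<ge> 0\<close> in \<open>auto simp: abs_mult intro!: mult_mono\<close>)
  then have "(\<lambda>(x, p). u x * w (x, p)) summable_on G \<times> B"
    using summable_on_iff_abs_summable_on_real by blast
  then obtain s where s: "((\<lambda>(x, p). u x * w (x, p)) has_sum s) (G \<times> B)"
    by (auto simp: summable_on_def)
  have "((\<lambda>x. u x * (\<Sum>\<^sub>\<infinity>p\<in>B. w (x, p))) has_sum s) G"
  proof (rule has_sum_Sigma'[OF s])
    fix x assume "x \<in> G"
    have "(\<lambda>p. w (x, p)) summable_on B"
      by (rule summable_on_SigmaD1[of "\<lambda>x p. w (x, p)", OF _ \<open>x \<in> G\<close>]) (use assms(2) in simp)
    then show "((\<lambda>p. case (x, p) of (x, p) \<Rightarrow> u x * w (x, p)) has_sum u x * (\<Sum>\<^sub>\<infinity>p\<in>B. w (x, p))) B"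
      by (simp add: has_sum_cmult_right)
  qed
  with has_sum_finite[OF \<open>finite G\<close>] have "s = (\<Sum>x\<in>G. u x * (\<Sum>\<^sub>\<infinity>p\<in>B. w (x, p)))"
    by (rule has_sum_unique[rotated])
  with s show ?thesis by simp
qed

text \<open>Discrete counterpart of closedness: differences of a potential integrate to zero because
  the marginals at the two endpoints agree. The second marginal is reached by exchanging the
  endpoints.\<close>

lemma holonomic_potential_difference:
  assumes "holonomic N \<nu>"
  shows "((\<lambda>(x, y, l). (u y - u x) * \<nu> x y l) has_sum 0) (grid N \<times> grid N \<times> UNIV)"
proof -
  let ?G = "grid N :: (real ^ 'a) set"
  let ?swap = "\<lambda>(y, x, l). (x, y, l)"
  have fin: "finite ?G" by (rule finite_grid)
  have nonneg: "\<nu> x y l \<ge> 0" if "x \<in> ?G" "y \<in> ?G" for x y l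
    using assms that by (auto simp: holonomic_def)
  have sm: "(\<lambda>(x, y, l). \<nu> x y l) summable_on ?G \<times> ?G \<times> UNIV"
    using assms by (auto simp: holonomic_def summable_on_def)
  have bij: "bij_betw ?swap (?G \<times> ?G \<times> (UNIV :: (int ^ 'a) set)) (?G \<times> ?G \<times> UNIV)"
    by (rule bij_betw_byWitness[of _ ?swap]) auto
  have "(\<lambda>z. case ?swap z of (x, y, l) \<Rightarrow> \<nu> x y l) summable_on ?G \<times> ?G \<times> UNIV"
    using summable_on_reindex_bij_betw[OF bij, of "\<lambda>(x, y, l). \<nu> x y l"] sm by simp
  then have sm': "(\<lambda>(y, x, l). \<nu> x y l) summable_on ?G \<times> ?G \<times> UNIV"
    by (simp add: case_prod_unfold)
  have 1: "((\<lambda>(x, y, l). u x * \<nu> x y l) has_sum (\<Sum>x\<in>?G. u x * (\<Sum>\<^sub>\<infinity>(y, l)\<in>?G \<times> UNIV. \<nu> x y l)))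
      (?G \<times> ?G \<times> UNIV)"
    using has_sum_first_coordinate[OF fin sm, of u] nonneg by (auto simp: case_prod_unfold)
  have "((\<lambda>(y, x, l). u y * \<nu> x y l) has_sum (\<Sum>y\<in>?G. u y * (\<Sum>\<^sub>\<infinity>(x, l)\<in>?G \<times> UNIV. \<nu> x y l)))
      (?G \<times> ?G \<times> UNIV)"
    using has_sum_first_coordinate[OF fin sm', of u] nonneg by (auto simp: case_prod_unfold)
  then have "((\<lambda>z. case ?swap z of (x, y, l) \<Rightarrow> u y * \<nu> x y l) has_sum
      (\<Sum>y\<in>?G. u y * (\<Sum>\<^sub>\<infinity>(x, l)\<in>?G \<times> UNIV. \<nu> x y l))) (?G \<times> ?G \<times> UNIV)"
    by (simp add: case_prod_unfold)
  then have "((\<lambda>(x, y, l). u y * \<nu> x y l) has_sum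
      (\<Sum>y\<in>?G. u y * (\<Sum>\<^sub>\<infinity>(x, l)\<in>?G \<times> UNIV. \<nu> x y l))) (?G \<times> ?G \<times> UNIV)"
    using has_sum_reindex_bij_betw[OF bij, of "\<lambda>(x, y, l). u y * \<nu> x y l"] by simp
  also have "(\<Sum>y\<in>?G. u y * (\<Sum>\<^sub>\<infinity>(x, l)\<in>?G \<times> UNIV. \<nu> x y l)) =
      (\<Sum>x\<in>?G. u x * (\<Sum>\<^sub>\<infinity>(y, l)\<in>?G \<times> UNIV. \<nu> x y l))"
    using assms by (intro sum.cong) (auto simp: holonomic_def)
  finally show ?thesis
    using has_sum_add[OF _ has_sum_cmult_right[OF 1, of "-1"]] by (fastforce simp: case_prod_unfold left_diff_distrib)
qed

text \<open>The measure is written as a sum of indicators so that coinciding points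
  \<open>e i\<close> are allowed and their masses add.\<close>

lemma has_sum_point_masses:
  fixes f :: "'a \<Rightarrow> real" and c :: "nat \<Rightarrow> real"
  assumes "\<And>i. i < k \<Longrightarrow> e i \<in> E"
  shows "((\<lambda>p. f p * (\<Sum>i<k. if e i = p then c i else 0)) has_sum (\<Sum>i<k. f (e i) * c i)) E"
proof -
  let ?g = "\<lambda>p. f p * (\<Sum>i<k. if e i = p then c i else 0)"
  let ?F = "e ` {..<k}"
  have "(?g has_sum sum ?g ?F) ?F" by simp
  also have "sum ?g ?F = (\<Sum>p\<in>?F. \<Sum>i<k. if e i = p then f (e i) * c i else 0)"
    by (auto intro!: sum.cong simp: sum_distrib_left)
  also have "\<dots> = (\<Sum>i<k. f (e i) * c i)"
    by (subst sum.swap) (auto intro!: sum.cong simp: sum.delta)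
  also have "(?g has_sum (\<Sum>i<k. f (e i) * c i)) ?F \<longleftrightarrow> ?thesis"
    using assms by (intro has_sum_cong_neutral) (auto intro!: sum.neutral)
  finally show ?thesis .
qed

definition cycle_measure :: "nat \<Rightarrow> (nat \<Rightarrow> 'a) \<Rightarrow> (nat \<Rightarrow> 'b) \<Rightarrow> 'a \<Rightarrow> 'a \<Rightarrow> 'b \<Rightarrow> real" where
  "cycle_measure k x l a b j = (\<Sum>i<k. if (x i, x (Suc i), l i) = (a, b, j) then 1 / k else 0)"

lemma has_sum_cycle_measure:
  assumes "\<And>i. x i \<in> G"
  shows "((\<lambda>(a, b, j). f (a, b, j) * cycle_measure k x l a b j) has_sum
    (\<Sum>i<k. f (x i, x (Suc i), l i)) / k) (G \<times> G \<times> UNIV)"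
  using has_sum_point_masses[of k "\<lambda>i. (x i, x (Suc i), l i)" "G \<times> G \<times> UNIV" f "\<lambda>_. 1 / k"] assms
  by (simp add: cycle_measure_def case_prod_unfold sum_divide_distrib prod_eq_iff)

text \<open>Outflow and inflow at \<open>a\<close> count the visits of \<open>x i\<close> and of
  \<open>x (Suc i)\<close>; the difference telescopes around the closed walk.\<close>

lemma holonomic_cycle_measure:
  fixes x :: "nat \<Rightarrow> real ^ 'n::finite"
  assumes "k > 0" "\<And>i. x i \<in> grid N" "x k = x 0"
  shows "holonomic N (cycle_measure k x l)"
  unfolding holonomic_def
proof (intro conjI ballI allI)
  show "((\<lambda>(a, b, j). cycle_measure k x l a b j) has_sum 1) (grid N \<times> grid N \<times> UNIV)"
    using has_sum_cycle_measure[OF assms(2), where f = "\<lambda>_. 1" and k = k and l = l] assms(1) by simp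
next
  fix a :: "real ^ 'n" assume "a \<in> grid N"
  let ?c = "\<lambda>i. if x i = a then 1 / real k else 0"
  have "(\<lambda>(b, j). cycle_measure k x l a b j) = (\<lambda>p. 1 * (\<Sum>i<k. if (x (Suc i), l i) = p then ?c i else 0))"
    unfolding cycle_measure_def by (auto simp: fun_eq_iff intro!: sum.cong)
  then have 1: "(\<Sum>\<^sub>\<infinity>(b, j)\<in>grid N \<times> UNIV. cycle_measure k x l a b j) = (\<Sum>i<k. 1 * ?c i)"
    using has_sum_point_masses[of k "\<lambda>i. (x (Suc i), l i)" "grid N \<times> UNIV" "\<lambda>_. 1" ?c] assms(2)
    by (auto intro!: infsumI)
  let ?d = "\<lambda>i. if x (Suc i) = a then 1 / real k else 0"
  have "(\<lambda>(b, j). cycle_measure k x l b a j) = (\<lambda>p. 1 * (\<Sum>i<k. if (x i, l i) = p then ?d i else 0))"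
    unfolding cycle_measure_def by (auto simp: fun_eq_iff intro!: sum.cong)
  then have 2: "(\<Sum>\<^sub>\<infinity>(b, j)\<in>grid N \<times> UNIV. cycle_measure k x l b a j) = (\<Sum>i<k. 1 * ?d i)"
    using has_sum_point_masses[of k "\<lambda>i. (x i, l i)" "grid N \<times> UNIV" "\<lambda>_. 1" ?d] assms(2)
    by (auto intro!: infsumI)
  have "(\<Sum>i<k. ?d i - ?c i) = 0"
    using sum_lessThan_telescope[of "?c" k] assms(3) by simp
  then show "(\<Sum>\<^sub>\<infinity>(b, j)\<in>grid N \<times> UNIV. cycle_measure k x l a b j) =
      (\<Sum>\<^sub>\<infinity>(b, j)\<in>grid N \<times> UNIV. cycle_measure k x l b a j)"
    unfolding 1 2 by (simp add: sum_subtractf)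
qed (auto simp: cycle_measure_def intro!: sum_nonneg)

lemma calibrated_cycle_discrete_mather:
  fixes L :: "'n::finite torus \<Rightarrow> real ^ 'n \<Rightarrow> real"
  assumes "\<tau> > 0" and k: "k > 0" "\<And>i. x i \<in> grid N" "x k = x 0"
    and u: "\<And>a b l. a \<in> grid N \<Longrightarrow> b \<in> grid N \<Longrightarrow>
      u b - u a \<le> \<tau> * (L (to_torus a) (grid_velocity \<tau> a b l) - A)"
    and calib: "\<And>i. i < k \<Longrightarrow> u (x (Suc i)) - u (x i) =
      \<tau> * (L (to_torus (x i)) (grid_velocity \<tau> (x i) (x (Suc i)) (l i)) - A)"
  shows "discrete_mather_measure L N \<tau> (cycle_measure k x l)"
  unfolding discrete_mather_measure_def
proof (intro conjI allI impI holonomic_cycle_measure k)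
  let ?E = "grid N \<times> grid N \<times> UNIV :: ((real ^ 'n) \<times> (real ^ 'n) \<times> (int ^ 'n)) set"
  let ?f = "\<lambda>(a, b, j). L (to_torus a) (grid_velocity \<tau> a b j)"
  have "(discrete_action_integrand L \<tau> (cycle_measure k x l) has_sum (\<Sum>i<k. ?f (x i, x (Suc i), l i)) / k) ?E"
    using has_sum_cycle_measure[OF k(2), where f = ?f and k = k and l = l] by (simp add: discrete_action_integrand_def)
  also have "(\<Sum>i<k. ?f (x i, x (Suc i), l i)) = (\<Sum>i<k. (u (x (Suc i)) - u (x i)) / \<tau> + A)"
    using \<open>\<tau> > 0\<close> calib by (intro sum.cong) (auto simp: field_simps)
  also have "\<dots> = (\<Sum>i<k. u (x (Suc i)) - u (x i)) / \<tau> + k * A"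
    by (simp add: sum.distrib sum_divide_distrib)
  also have "(\<Sum>i<k. u (x (Suc i)) - u (x i)) = 0"
    using sum_lessThan_telescope[of "\<lambda>i. u (x i)" k] k(3) by simp
  finally have act: "(discrete_action_integrand L \<tau> (cycle_measure k x l) has_sum A) ?E"
    using k(1) by simp
  then show "discrete_action_integrand L \<tau> (cycle_measure k x l) summable_on ?E"
    by (auto simp: summable_on_def)
  fix \<nu> :: "real ^ 'n \<Rightarrow> real ^ 'n \<Rightarrow> int ^ 'n \<Rightarrow> real"
  assume \<nu>: "holonomic N \<nu> \<and> discrete_action_integrand L \<tau> \<nu> summable_on ?E"
  \<comment> \<open>The summand is the lower bound \<open>A + (u y - u x) / \<tau>\<close> for
    \<open>L\<close>, weighted by \<open>\<nu>\<close>; the potential part contributes zero and the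
    total mass is one.\<close>
  have "((\<lambda>z. A * (case z of (x, y, l) \<Rightarrow> \<nu> x y l) + (1 / \<tau>) * (case z of (x, y, l) \<Rightarrow> (u y - u x) * \<nu> x y l))
      has_sum (A * 1 + (1 / \<tau>) * 0)) ?E"
    using \<nu> by (intro has_sum_add has_sum_cmult_right holonomic_potential_difference) (auto simp: holonomic_def)
  moreover have "(discrete_action_integrand L \<tau> \<nu> has_sum (\<Sum>\<^sub>\<infinity>e\<in>?E. discrete_action_integrand L \<tau> \<nu> e)) ?E"
    using \<nu> by (intro has_sum_infsum) simp
  ultimately have "A * 1 + (1 / \<tau>) * 0 \<le> (\<Sum>\<^sub>\<infinity>e\<in>?E. discrete_action_integrand L \<tau> \<nu> e)"
  proof (rule has_sum_mono)
    fix z assume z: "z \<in> ?E"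
    obtain a b j where [simp]: "z = (a, b, j)" by (cases z)
    have "\<nu> a b j \<ge> 0" using \<nu> z by (auto simp: holonomic_def)
    moreover have "A + (1 / \<tau>) * (u b - u a) \<le> L (to_torus a) (grid_velocity \<tau> a b j)"
      using u[of a b j] z \<open>\<tau> > 0\<close> by (simp add: field_simps)
    ultimately have "(A + (1 / \<tau>) * (u b - u a)) * \<nu> a b j \<le> L (to_torus a) (grid_velocity \<tau> a b j) * \<nu> a b j"
      by (rule mult_right_mono[rotated])
    then show "A * (case z of (x, y, l) \<Rightarrow> \<nu> x y l) + (1 / \<tau>) * (case z of (x, y, l) \<Rightarrow> (u y - u x) * \<nu> x y l)
        \<le> discrete_action_integrand L \<tau> \<nu> z"
      by (simp add: discrete_action_integrand_def algebra_simps)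
  qed
  then show "(\<Sum>\<^sub>\<infinity>e\<in>?E. discrete_action_integrand L \<tau> (cycle_measure k x l) e) \<le>
      (\<Sum>\<^sub>\<infinity>e\<in>?E. discrete_action_integrand L \<tau> \<nu> e)"
    using infsumI[OF act] by simp
qed

lemma finite_bounded_int_vec: "finite {l :: int ^ 'n::finite. \<forall>k. \<bar>l $ k\<bar> \<le> M}"
proof (rule finite_subset)
  show "{l :: int ^ 'n. \<forall>k. \<bar>l $ k\<bar> \<le> M} \<subseteq> vec_lambda ` (UNIV \<rightarrow>\<^sub>E {-M..M})"
  proof
    fix l :: "int ^ 'n" assume "l \<in> {l. \<forall>k. \<bar>l $ k\<bar> \<le> M}"
    then have "vec_nth l \<in> UNIV \<rightarrow>\<^sub>E {-M..M}" by (auto simp: abs_le_iff minus_le_iff)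
    then have "vec_lambda (vec_nth l) \<in> vec_lambda ` (UNIV \<rightarrow>\<^sub>E {-M..M})" by (rule imageI)
    then show "l \<in> vec_lambda ` (UNIV \<rightarrow>\<^sub>E {-M..M})" by simp
  qed
qed (intro finite_imageI finite_PiE, auto)

text \<open>By superlinearity only finitely many translations do at least as well as the zero
  translation. Keeping the best one leaves a single edge between any two grid points, so the graph
  becomes finite.\<close>

lemma optimal_translation_exists:
  assumes "superlinear L" "\<tau> > 0"
  shows "\<exists>m. \<forall>l. L X (grid_velocity \<tau> a b m) \<le> L X (grid_velocity \<tau> a b l)"
proof -
  obtain C where C: "\<And>x w. L x w \<ge> 1 * norm w - C"
    using assms(1) unfolding superlinear_def by (meson zero_less_one)
  define f where "f l = L X (grid_velocity \<tau> a b l)" for l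
  define S where "S = {l. f l \<le> f 0}"
  define M where "M = \<lceil>\<tau> * (f 0 + C) + norm (b - a)\<rceil>"
  have "S \<subseteq> {l. \<forall>k. \<bar>l $ k\<bar> \<le> M}"
  proof (intro subsetI CollectI allI)
    fix l k assume "l \<in> S"
    then have "norm (grid_velocity \<tau> a b l) \<le> f 0 + C"
      using C[of "grid_velocity \<tau> a b l" X] by (simp add: S_def f_def)
    moreover have "grid_velocity \<tau> a b l = (1 / \<tau>) *\<^sub>R ((b - a) + int_vec l)"
      unfolding grid_velocity_def by (rule arg_cong[of _ _ "scaleR _"]) simp
    ultimately have "norm ((b - a) + int_vec l) / \<tau> \<le> f 0 + C"
      using assms(2) by simp
    then have 1: "norm ((b - a) + int_vec l) \<le> \<tau> * (f 0 + C)"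
      using assms(2) by (simp add: pos_divide_le_eq mult.commute)
    have "\<bar>real_of_int (l $ k)\<bar> \<le> norm (int_vec l)"
      using component_le_norm_cart[of "int_vec l" k] by simp
    also have "\<dots> \<le> norm ((b - a) + int_vec l) + norm (b - a)"
      using norm_triangle_ineq4[of "(b - a) + int_vec l" "b - a"] by simp
    finally have "\<bar>real_of_int (l $ k)\<bar> \<le> \<tau> * (f 0 + C) + norm (b - a)" using 1 by linarith
    then show "\<bar>l $ k\<bar> \<le> M" unfolding M_def by linarith
  qed
  then have "finite S" using finite_bounded_int_vec by (rule finite_subset)
  moreover have "S \<noteq> {}" by (auto simp: S_def)
  ultimately obtain m where m: "m \<in> S" "\<And>l. l \<in> S \<Longrightarrow> f m \<le> f l"
    using arg_min_if_finite[of S f] by (meson not_le)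
  have "f m \<le> f l" for l
    using m(2)[of l] m(2)[of 0] by (cases "l \<in> S") (auto simp: S_def)
  then show ?thesis by (auto simp: f_def)
qed

text \<open>The preimage of the grid in the cover. On it an edge together with its integer
  translation is just a pair of points, and its velocity is a difference quotient.\<close>

definition lattice :: "nat \<Rightarrow> (real ^ 'n::finite) set" where
  "lattice N = {x. \<forall>k. x $ k * real N \<in> \<int>}"

text \<open>Here \<open>A\<close> is an action per unit time and \<open>U\<close> a periodic
  potential on the cover. The condition \<open>step\<close> holds modulo integers because
  \<open>x\<close> is kept among the grid representatives, which the displacement by
  \<open>\<tau> *\<^sub>R v i\<close> may leave.\<close>

locale calibrated_chain =
  fixes L :: "'n::finite torus \<Rightarrow> real ^ 'n \<Rightarrow> real" and N :: nat and \<tau> A :: real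
    and U :: "real ^ 'n \<Rightarrow> real" and x v :: "nat \<Rightarrow> real ^ 'n" and k :: nat
  assumes N_pos: "N > 0" and \<tau>_pos: "\<tau> > 0"
    and U_periodic: "U (y + int_vec l) = U y"
    and U_diff_le: "a \<in> lattice N \<Longrightarrow> b \<in> lattice N \<Longrightarrow>
      U b - U a \<le> \<tau> * (L (to_torus a) ((1 / \<tau>) *\<^sub>R (b - a)) - A)"
    and k_pos: "k > 0" and x_grid: "x i \<in> grid N" and x_closed: "x k = x 0"
    and step: "\<exists>l. x i + \<tau> *\<^sub>R v i = x (Suc i) + int_vec l"
    and calibrated: "i < k \<Longrightarrow> U (x (Suc i)) - U (x i) = \<tau> * (L (to_torus (x i)) (v i) - A)"

lemma discrete_weak_KAM:
  fixes L :: "'n::finite torus \<Rightarrow> real ^ 'n \<Rightarrow> real"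
  assumes "superlinear L" "\<tau> > 0" "N > 0"
  obtains A :: real and U :: "real ^ 'n \<Rightarrow> real" and x v and k :: nat where
    "calibrated_chain L N \<tau> A U x v k"
    "\<And>i. i < k \<Longrightarrow> (to_torus (x i), v i) \<in> discrete_mather_set L N \<tau>"
proof -
  define opt where "opt a b =
    (SOME m. \<forall>l. L (to_torus a) (grid_velocity \<tau> a b m) \<le> L (to_torus a) (grid_velocity \<tau> a b l))" for a b
  have opt: "L (to_torus a) (grid_velocity \<tau> a b (opt a b)) \<le> L (to_torus a) (grid_velocity \<tau> a b l)" for a b l
    using someI_ex[OF optimal_translation_exists[OF assms(1,2), of "to_torus a" a b]] by (auto simp: opt_def)
  define c where "c a b = \<tau> * L (to_torus a) (grid_velocity \<tau> a b (opt a b))" for a b :: "real ^ 'n"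
  obtain A u x and k :: nat where u: "\<And>a b. a \<in> grid N \<Longrightarrow> b \<in> grid N \<Longrightarrow> u b - u a \<le> c a b - A"
    and k: "k > 0" "\<And>i. x i \<in> grid N" "x k = x 0"
    and calib: "\<And>i. i < k \<Longrightarrow> u (x (Suc i)) - u (x i) = c (x i) (x (Suc i)) - A"
    using calibrated_cycle[OF finite_grid, of N c] grid_nonempty[OF assms(3)] by (metis empty_iff)
  define l where "l i = opt (x i) (x (Suc i))" for i
  define v where "v i = grid_velocity \<tau> (x i) (x (Suc i)) (l i)" for i
  have u': "u b - u a \<le> \<tau> * (L (to_torus a) (grid_velocity \<tau> a b j) - A / \<tau>)"
    if "a \<in> grid N" "b \<in> grid N" for a b j
  proof -
    have "c a b \<le> \<tau> * L (to_torus a) (grid_velocity \<tau> a b j)"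
      unfolding c_def using opt assms(2) by (intro mult_left_mono) auto
    with u[OF that] show ?thesis using assms(2) by (simp add: right_diff_distrib)
  qed
  have calib': "u (x (Suc i)) - u (x i) = \<tau> * (L (to_torus (x i)) (v i) - A / \<tau>)" if "i < k" for i
    using calib[OF that] assms(2) by (simp add: c_def v_def l_def right_diff_distrib)
  have mm: "discrete_mather_measure L N \<tau> (cycle_measure k x l)"
    by (rule calibrated_cycle_discrete_mather[where u = u and A = "A / \<tau>", OF assms(2) k u'])
      (use calib' in \<open>simp_all add: v_def\<close>)
  show thesis
  proof
    \<comment> \<open>The graph constant is a cost per edge; division by \<tau> converts it to an
      action per unit time.\<close>
    show "calibrated_chain L N \<tau> (A / \<tau>) (\<lambda>y. u (frac_vec y)) x v k"
    proof
    show "u (frac_vec (y + int_vec j)) = u (frac_vec y)" for y j by simp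
    show "u (frac_vec b) - u (frac_vec a) \<le> \<tau> * (L (to_torus a) ((1 / \<tau>) *\<^sub>R (b - a)) - A / \<tau>)"
      if "a \<in> lattice N" "b \<in> lattice N" for a b
    proof -
      have "frac_vec a \<in> grid N" "frac_vec b \<in> grid N"
        using that assms(3) by (auto simp: lattice_def intro: frac_vec_grid)
      \<comment> \<open>The integer parts of \<open>b\<close> and \<open>a\<close> supply the
        translation, so all translations of grid edges together give the inequality for every pair
        of lattice points.\<close>
      moreover have "grid_velocity \<tau> (frac_vec a) (frac_vec b) (\<chi> k. \<lfloor>b $ k\<rfloor> - \<lfloor>a $ k\<rfloor>) = (1 / \<tau>) *\<^sub>R (b - a)"
        by (simp add: grid_velocity_def frac_vec_def frac_def vec_eq_iff)
      ultimately show ?thesis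
        using u'[of "frac_vec a" "frac_vec b" "\<chi> k. \<lfloor>b $ k\<rfloor> - \<lfloor>a $ k\<rfloor>"] by simp
    qed
    show "u (frac_vec (x (Suc i))) - u (frac_vec (x i)) = \<tau> * (L (to_torus (x i)) (v i) - A / \<tau>)"
      if "i < k" for i
      using calib'[OF that] by (simp add: frac_vec_on_grid[OF k(2)])
    show "\<exists>l. x i + \<tau> *\<^sub>R v i = x (Suc i) + int_vec l" for i
      using assms(2) by (auto simp: v_def grid_velocity_def)
    qed (use k assms in auto)
    show "(to_torus (x i), v i) \<in> discrete_mather_set L N \<tau>" if "i < k" for i
    proof -
      have "cycle_measure k x l (x i) (x (Suc i)) (l i) > 0"
        unfolding cycle_measure_def using that by (intro sum_pos2[of _ i]) auto
      then have "(to_torus (x i), v i) \<in> {(to_torus a, grid_velocity \<tau> a b j) | a b j.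
          a \<in> grid N \<and> b \<in> grid N \<and> cycle_measure k x l a b j > 0}"
        using k(2) unfolding v_def by blast
      then show ?thesis
        unfolding discrete_mather_set_def using mm by (intro subsetD[OF closure_subset]) blast
    qed
  qed
qed


section \<open>Rounding to the lattice\<close>

lemma norm_le_card:
  fixes x :: "real ^ 'n::finite" and r :: real
  assumes "\<And>k. \<bar>x $ k\<bar> \<le> r" shows "norm x \<le> CARD('n) * r"
proof -
  have "norm x \<le> (\<Sum>k\<in>UNIV. \<bar>x $ k\<bar>)" by (rule norm_le_l1_cart)
  also have "\<dots> \<le> (\<Sum>k\<in>(UNIV::'n set). r)" by (intro sum_mono assms)
  finally show ?thesis by simp
qed

definition lattice_floor :: "nat \<Rightarrow> real ^ 'n::finite \<Rightarrow> real ^ 'n" where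
  "lattice_floor N x = (\<chi> k. of_int \<lfloor>x $ k * N\<rfloor> / N)"

lemma lattice_floor_in_lattice: "N > 0 \<Longrightarrow> lattice_floor N x \<in> lattice N"
  by (simp add: lattice_floor_def lattice_def)

lemma lattice_floor_error:
  fixes x :: "real ^ 'n::finite"
  assumes "N > 0" shows "norm (lattice_floor N x - x) \<le> CARD('n) * (1 / real N)"
proof (rule norm_le_card)
  fix k
  have "lattice_floor N x $ k - x $ k = (of_int \<lfloor>x $ k * N\<rfloor> - x $ k * N) / N"
    using assms by (simp add: lattice_floor_def field_simps)
  moreover have "\<bar>of_int \<lfloor>x $ k * N\<rfloor> - x $ k * N\<bar> \<le> 1" by linarith
  ultimately show "\<bar>(lattice_floor N x - x) $ k\<bar> \<le> 1 / real N"
    using assms by (simp add: abs_divide divide_right_mono)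
qed

lemma lattice_floor_lattice: "N > 0 \<Longrightarrow> x \<in> lattice N \<Longrightarrow> lattice_floor N x = x"
  by (auto simp: lattice_floor_def lattice_def vec_eq_iff field_simps)

lemma lattice_add: "a \<in> lattice N \<Longrightarrow> b \<in> lattice N \<Longrightarrow> a + b \<in> lattice N"
  by (auto simp: lattice_def distrib_right)

lemma lattice_diff: "a \<in> lattice N \<Longrightarrow> b \<in> lattice N \<Longrightarrow> a - b \<in> lattice N"
  by (auto simp: lattice_def left_diff_distrib)

lemma grid_subset_lattice: "grid N \<subseteq> lattice N"
  by (auto simp: lattice_def grid_lattice)

lemma int_vec_in_lattice: "int_vec l \<in> lattice N"
  by (simp add: lattice_def)

section \<open>A priori bounds for the critical value, the potential and the velocities\<close>

context calibrated_chain
begin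

lemma mean_action: "(\<Sum>i<k. L (to_torus (x i)) (v i)) = k * A"
proof -
  have "(\<Sum>i<k. L (to_torus (x i)) (v i)) = (\<Sum>i<k. (U (x (Suc i)) - U (x i)) / \<tau> + A)"
    using calibrated \<tau>_pos by (intro sum.cong) (auto simp: field_simps)
  also have "\<dots> = (\<Sum>i<k. U (x (Suc i)) - U (x i)) / \<tau> + k * A"
    by (simp add: sum.distrib sum_divide_distrib)
  also have "(\<Sum>i<k. U (x (Suc i)) - U (x i)) = 0"
    using sum_lessThan_telescope[of "\<lambda>i. U (x i)" k] x_closed by simp
  finally show ?thesis by simp
qed

text \<open>The edge from the origin to itself has velocity zero and no potential
  difference.\<close>

lemma A_le: "A \<le> L (to_torus 0) 0"
  using U_diff_le[of 0 0] \<tau>_pos by (simp add: lattice_def zero_le_mult_iff)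

lemma A_ge:
  fixes c :: real
  assumes "\<And>x w. L x w \<ge> c" shows "A \<ge> c"
proof -
  have "k * c = (\<Sum>i<k. c)" by simp
  also have "\<dots> \<le> k * A" unfolding mean_action[symmetric] by (intro sum_mono assms)
  finally show ?thesis using k_pos by simp
qed

text \<open>The segment from \<open>a\<close> to \<open>b\<close> is followed by about \<open>norm (b - a) / \<tau>\<close> lattice steps of bounded
  velocity. This is where \<open>h \<le> \<tau>\<close> is needed.\<close>

lemma U_growth:
  fixes B :: real
  assumes B: "\<And>x w. norm w \<le> 1 + 2 * CARD('n) \<Longrightarrow> L x w \<le> B" and h: "1 / real N \<le> \<tau>"
    and a: "a \<in> lattice N" and b: "b \<in> lattice N"
  shows "U b - U a \<le> (norm (b - a) + \<tau>) * (B - A)"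
proof -
  have BA: "A \<le> B" using A_le B[of 0 "to_torus 0"] by simp
  define M where "M = nat \<lceil>norm (b - a) / \<tau>\<rceil>"
  show ?thesis
  proof (cases "a = b")
    case True
    then show ?thesis using BA \<tau>_pos by simp
  next
    case False
    then have pos: "norm (b - a) / \<tau> > 0" using \<tau>_pos by simp
    then have M: "real M \<ge> norm (b - a) / \<tau>" "real M \<le> norm (b - a) / \<tau> + 1" "M > 0"
      unfolding M_def by (linarith, linarith, simp)
    \<comment> \<open>Rounding moves each end of a step by at most \<open>CARD('n) / N\<close>,
      hence by at most \<open>CARD('n) * \<tau>\<close>; with the length at most \<tau> of the
      unrounded step this gives the velocity bound \<open>1 + 2 * CARD('n)\<close>.\<close>
    define p where "p j = a + lattice_floor N ((real j / real M) *\<^sub>R (b - a))" for j :: nat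
    have p: "p j \<in> lattice N" for j
      unfolding p_def by (intro lattice_add a lattice_floor_in_lattice N_pos)
    have p0: "p 0 = a" by (simp add: p_def lattice_floor_def vec_eq_iff)
    have pM: "p M = b"
      using M lattice_floor_lattice[OF N_pos lattice_diff[OF b a]] by (simp add: p_def)
    have step: "U (p (Suc j)) - U (p j) \<le> \<tau> * (B - A)" for j
    proof -
      let ?r = "\<lambda>j. (real j / real M) *\<^sub>R (b - a)"
      have "p (Suc j) - p j = (lattice_floor N (?r (Suc j)) - ?r (Suc j)) - (lattice_floor N (?r j) - ?r j)
          + (1 / real M) *\<^sub>R (b - a)"
        by (simp add: p_def scaleR_left_distrib add_divide_distrib)
      also have "norm \<dots> \<le> CARD('n) * (1 / real N) + CARD('n) * (1 / real N) + norm ((1 / real M) *\<^sub>R (b - a))"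
        by (intro norm_triangle_mono norm_triangle_le_diff add_mono lattice_floor_error N_pos order_refl)
      also have "norm ((1 / real M) *\<^sub>R (b - a)) = norm (b - a) / real M" by simp
      also have "CARD('n) * (1 / real N) + CARD('n) * (1 / real N) + \<dots> \<le> CARD('n) * \<tau> + CARD('n) * \<tau> + \<tau>"
      proof (intro add_mono mult_left_mono h)
        show "norm (b - a) / real M \<le> \<tau>" using M \<tau>_pos by (simp add: field_simps)
      qed auto
      finally have "norm (p (Suc j) - p j) \<le> \<tau> * (1 + 2 * CARD('n))"
        by (simp add: algebra_simps)
      then have "norm (p (Suc j) - p j) / \<tau> \<le> 1 + 2 * CARD('n)"
        using \<tau>_pos by (simp add: pos_divide_le_eq mult.commute)
      then have "norm ((1 / \<tau>) *\<^sub>R (p (Suc j) - p j)) \<le> 1 + 2 * CARD('n)"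
        using \<tau>_pos by simp
      then have "L (to_torus (p j)) ((1 / \<tau>) *\<^sub>R (p (Suc j) - p j)) \<le> B" by (rule B)
      then have "\<tau> * (L (to_torus (p j)) ((1 / \<tau>) *\<^sub>R (p (Suc j) - p j)) - A) \<le> \<tau> * (B - A)"
        using \<tau>_pos by simp
      with U_diff_le[OF p p] show ?thesis by (rule order_trans)
    qed
    have "U b - U a = (\<Sum>j<M. U (p (Suc j)) - U (p j))"
      using sum_lessThan_telescope[of "\<lambda>j. U (p j)" M] p0 pM by simp
    also have "\<dots> \<le> (\<Sum>j<M. \<tau> * (B - A))" by (intro sum_mono step)
    also have "\<dots> = (real M * \<tau>) * (B - A)" by simp
    also have "\<dots> \<le> (norm (b - a) + \<tau>) * (B - A)"
      using BA M(2) \<tau>_pos by (intro mult_right_mono) (auto simp: field_simps)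
    finally show ?thesis .
  qed
qed

text \<open>Calibration equates the excess action of a step with the growth of \<open>U\<close>,
  which is at most affine in the speed with slope \<open>B + c\<close>. Superlinearity with slope
  \<open>B + c + 1\<close> leaves one \<open>norm (v i)\<close> bounded by constants.\<close>

lemma velocity_bound:
  fixes B c C :: real
  assumes B: "\<And>x w. norm w \<le> 1 + 2 * CARD('n) \<Longrightarrow> L x w \<le> B" and h: "1 / real N \<le> \<tau>"
    and C: "\<And>x w. L x w \<ge> (B + c + 1) * norm w - C" and c: "\<And>x w. L x w \<ge> - c"
    and i: "i < k"
  shows "norm (v i) \<le> 2 * B + c + C"
proof -
  obtain l where l: "x i + \<tau> *\<^sub>R v i = x (Suc i) + int_vec l" using step by blast
  have A: "- c \<le> A" "A \<le> B" using A_ge[OF c] A_le B[of 0 "to_torus 0"] by auto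
  have "\<tau> * (L (to_torus (x i)) (v i) - A) = U (x (Suc i) + int_vec l) - U (x i)"
    using calibrated[OF i] U_periodic by simp
  also have "\<dots> \<le> (norm (x (Suc i) + int_vec l - x i) + \<tau>) * (B - A)"
    using x_grid grid_subset_lattice int_vec_in_lattice by (intro U_growth B h lattice_add) auto
  also have "x (Suc i) + int_vec l - x i = \<tau> *\<^sub>R v i" using l by (simp add: algebra_simps)
  also have "(norm (\<tau> *\<^sub>R v i) + \<tau>) * (B - A) = \<tau> * ((norm (v i) + 1) * (B - A))"
    using \<tau>_pos by (simp add: algebra_simps)
  finally have "L (to_torus (x i)) (v i) - A \<le> (norm (v i) + 1) * (B - A)"
    using \<tau>_pos by simp
  also have "\<dots> \<le> (norm (v i) + 1) * (B + c)" using A by (intro mult_left_mono) auto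
  finally show ?thesis using C[of "v i" "to_torus (x i)"] A by (simp add: algebra_simps)
qed

lemma U_oscillation:
  fixes B c :: real
  assumes B: "\<And>x w. norm w \<le> 1 + 2 * CARD('n) \<Longrightarrow> L x w \<le> B" and h: "1 / real N \<le> \<tau>" "\<tau> \<le> 1"
    and c: "\<And>x w. L x w \<ge> - c" and z: "z \<in> grid N"
  shows "\<bar>U z - U 0\<bar> \<le> (CARD('n) + 1) * (B + c)"
proof -
  have A: "- c \<le> A" "A \<le> B" using A_ge[OF c] A_le B[of 0 "to_torus 0"] by auto
  have "\<bar>z $ k\<bar> \<le> 1" for k using z N_pos by (auto simp: grid_def less_imp_le)
  then have nz: "norm z \<le> CARD('n) * (1 :: real)" by (rule norm_le_card)
  have zl: "z \<in> lattice N" "0 \<in> lattice N" using z grid_subset_lattice by (auto simp: lattice_def)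
  have "(norm z + \<tau>) * (B - A) \<le> (CARD('n) + 1) * (B + c)"
    using nz A h \<tau>_pos by (intro mult_mono) auto
  then show ?thesis
    using U_growth[OF B h(1) zl] U_growth[OF B h(1) zl(2,1)] by (simp add: abs_le_iff)
qed

end

section \<open>Proximity to the integers measured by sines\<close>

lemma sin_pi_small:
  assumes "r > 0"
  obtains s where "s > 0" "\<And>t. \<bar>sin (pi * t)\<bar> < s \<Longrightarrow> \<bar>t - of_int (round t)\<bar> < r"
proof
  \<comment> \<open>The cap 1/2 keeps \<open>pi * q\<close> in the range where the sine
    increases.\<close>
  define q where "q = min r (1/2)"
  have q: "0 < q" "q \<le> 1/2" "q \<le> r" using assms by (auto simp: q_def)
  show "sin (pi * q) > 0" using q by (intro sin_gt_zero) auto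
  fix t assume s: "\<bar>sin (pi * t)\<bar> < sin (pi * q)"
  define u where "u = t - of_int (round t)"
  have u: "\<bar>u\<bar> \<le> 1/2" unfolding u_def using of_int_round_abs_le[of t] by linarith
  have "sin (pi * of_int (round t)) = 0" by (simp add: sin_zero_iff_int2 mult.commute)
  moreover from this have "\<bar>cos (pi * of_int (round t))\<bar> = 1"
    using sin_zero_abs_cos_one by blast
  moreover have "pi * t = pi * u + pi * of_int (round t)" by (simp add: u_def algebra_simps)
  ultimately have "\<bar>sin (pi * t)\<bar> = \<bar>sin (pi * u)\<bar>" by (simp add: sin_add abs_mult)
  also have "\<dots> \<ge> sin (pi * \<bar>u\<bar>)" by (cases "u \<ge> 0") auto
  finally have sin_less: "sin (pi * \<bar>u\<bar>) < sin (pi * q)" using s by simp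
  have "\<not> q \<le> \<bar>u\<bar>"
  proof (intro notI)
    assume "q \<le> \<bar>u\<bar>"
    moreover have "- (pi / 2) \<le> pi * q" by (rule order_trans[of _ 0]) (use q in auto)
    moreover have "pi * \<bar>u\<bar> \<le> pi / 2" using u by (simp add: field_simps)
    ultimately have "sin (pi * q) \<le> sin (pi * \<bar>u\<bar>)" by (intro sin_monotone_2pi_le) auto
    with sin_less show False by simp
  qed
  then show "\<bar>u\<bar> < r" using q by simp
qed

lemma sin_pi_small_vec:
  assumes "r > 0"
  obtains s where "s > 0" "\<And>(y :: real ^ 'n::finite). (\<And>k. \<bar>sin (pi * y $ k)\<bar> < s) \<Longrightarrow> \<exists>l. norm (y - int_vec l) < r"
proof -
  obtain s where s: "s > 0" "\<And>t. \<bar>sin (pi * t)\<bar> < s \<Longrightarrow> \<bar>t - of_int (round t)\<bar> < r / (2 * CARD('n))"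
    using sin_pi_small[of "r / (2 * CARD('n))"] assms by (metis divide_pos_pos mult_pos_pos of_nat_0_less_iff zero_less_card_finite zero_less_numeral)
  show thesis
  proof (rule that[OF s(1)])
    fix y :: "real ^ 'n" assume "\<And>k. \<bar>sin (pi * y $ k)\<bar> < s"
    then have "norm (y - int_vec (\<chi> k. round (y $ k))) \<le> CARD('n) * (r / (2 * CARD('n)))"
      by (intro norm_le_card) (use s(2) in \<open>auto intro: less_imp_le\<close>)
    also have "\<dots> < r" using assms by simp
    finally show "\<exists>l. norm (y - int_vec l) < r" by blast
  qed
qed

text \<open>A periodic function descends to the torus and becomes an admissible test function there;
  \<open>G\<close> is the torus gradient of the descended function. Arguments can then stay on the
  cover.\<close>

lemma closed_measure_lift:
  assumes "closed_prob_measure \<mu>" "\<And>x l. \<phi> (x + int_vec l) = \<phi> x" "\<And>x. GDERIV \<phi> x :> g x" "continuous_on UNIV g"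
  obtains G where "\<And>x. G (to_torus x) = g x" "has_bochner_integral \<mu> (\<lambda>(x, v). v \<bullet> G x) 0"
proof -
  define \<psi> where "\<psi> X = \<phi> (rep_torus X)" for X
  have \<psi>: "\<psi> (to_torus x) = \<phi> x" for x
  proof -
    have "to_torus (rep_torus (to_torus x)) = to_torus x"
      by (rule Quotient3_abs_rep[OF Quotient3_torus])
    then obtain l where "x = rep_torus (to_torus x) + int_vec l" unfolding to_torus_eq_iff by blast
    then show ?thesis unfolding \<psi>_def using assms(2) by metis
  qed
  have "C1_torus \<psi>"
    unfolding C1_torus_def C1_def \<psi>
  proof (intro exI[of _ "\<lambda>x. blinfun_inner_left (g x)"] conjI allI)
    show "(\<phi> has_derivative blinfun_apply (blinfun_inner_left (g x))) (at x)" for x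
      using assms(3)[of x] by (simp add: gderiv_def fun_eq_iff[symmetric])
    show "continuous_on UNIV (\<lambda>x. blinfun_inner_left (g x))"
      by (intro continuous_intros assms bounded_linear.continuous_on[OF bounded_linear_blinfun_inner_left])
  qed
  show thesis
  proof (rule that)
    show "torus_grad \<psi> (to_torus x) = g x" for x
      by (rule torus_grad_eq) (simp add: \<psi> assms(3))
    show "has_bochner_integral \<mu> (\<lambda>(x, v). v \<bullet> torus_grad \<psi> x) 0"
      using assms(1) \<open>C1_torus \<psi>\<close> by (simp add: closed_prob_measure_def)
  qed
qed

section \<open>Comparison of the discrete and the continuous action\<close>


text \<open>Potentials are determined only up to additive constants and only their oscillation is
  controlled, hence the subtraction of \<open>U 0\<close>.\<close>

definition mollified :: "nat \<Rightarrow> nat \<Rightarrow> (real ^ 'n::finite \<Rightarrow> real) \<Rightarrow> real ^ 'n \<Rightarrow> real" where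
  "mollified N m U x = (\<Sum>z\<in>grid N. (U z - U 0) * weight N m (x - z))"

text \<open>The number of grid points cancels the power of \<open>N\<close> in the normalisation of
  the weights, so \<open>C\<close> depends on the kernel but not on the grid.\<close>

lemma C11_bounded_mollified:
  obtains C where "C \<ge> 0" "\<And>N (U :: real ^ 'n::finite \<Rightarrow> real) K. N > 0 \<Longrightarrow> K \<ge> 0 \<Longrightarrow>
    (\<And>z. z \<in> grid N \<Longrightarrow> \<bar>U z - U 0\<bar> \<le> K) \<Longrightarrow> \<exists>g. C11_bounded (mollified N m U) g (K * C)"
proof -
  obtain \<kappa> C where \<kappa>: "C11_bounded (kernel m :: real ^ 'n \<Rightarrow> real) \<kappa> C" by (rule C11_bounded_kernel)
  then have C: "C \<ge> 0" unfolding C11_bounded_def by (meson abs_ge_zero order_trans)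
  let ?c = "central_ratio m ^ CARD('n)"
  have c: "?c > 0" using central_ratio_pos by simp
  show thesis
  proof
    show "C / ?c \<ge> 0" using C c by simp
    fix N :: nat and U :: "real ^ 'n \<Rightarrow> real" and K :: real
    assume N: "N > 0" and K: "K \<ge> 0" and U: "\<And>z. z \<in> grid N \<Longrightarrow> \<bar>U z - U 0\<bar> \<le> K"
    define p where "p = real N ^ CARD('n) * ?c"
    have p: "p > 0" using N c by (simp add: p_def)
    define a where "a z = (U z - U 0) / p" for z
    have a: "\<bar>a z\<bar> \<le> K / p" if "z \<in> grid N" for z
      using U[OF that] p by (simp add: a_def abs_divide divide_right_mono)
    have moll: "mollified N m U = (\<lambda>x. \<Sum>z\<in>grid N. a z * kernel m (x - z))"
      by (simp add: mollified_def weight_def a_def p_def fun_eq_iff power_mult_distrib)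
    define g where "g x = (\<Sum>z\<in>grid N. a z *\<^sub>R \<kappa> (x - z))" for x
    have bound: "norm (\<Sum>z\<in>grid N. a z *\<^sub>R f z) \<le> K * (C / ?c) * r"
      if "\<And>z. norm (f z) \<le> C * r" "r \<ge> 0" for f :: "real ^ 'n \<Rightarrow> 'x::real_normed_vector" and r
    proof -
      have "norm (\<Sum>z\<in>grid N. a z *\<^sub>R f z) \<le> (\<Sum>z\<in>(grid N :: (real ^ 'n) set). (K / p) * (C * r))"
      proof (rule sum_norm_le)
        fix z :: "real ^ 'n" assume "z \<in> grid N"
        then have "\<bar>a z\<bar> * norm (f z) \<le> (K / p) * (C * r)"
          using a that K p by (intro mult_mono) auto
        then show "norm (a z *\<^sub>R f z) \<le> (K / p) * (C * r)" by simp
      qed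
      also have "\<dots> = K * (C / ?c) * r"
        using N by (simp add: card_grid p_def field_simps)
      finally show ?thesis .
    qed
    have "C11_bounded (mollified N m U) g (K * (C / ?c))"
      unfolding C11_bounded_def
    proof (intro conjI allI)
      fix x y :: "real ^ 'n"
      have "((\<lambda>x. a z * kernel m (x - z)) has_derivative (\<lambda>h. h \<bullet> (a z *\<^sub>R \<kappa> (x - z)))) (at x)" for z
      proof -
        have "((\<lambda>x. x - z) has_derivative (\<lambda>h. h)) (at x)" by (auto intro!: derivative_eq_intros)
        moreover have "(kernel m has_derivative (\<lambda>h. h \<bullet> \<kappa> (x - z))) (at (x - z))"
          using \<kappa> by (simp add: C11_bounded_def gderiv_def)
        ultimately have "((\<lambda>x. kernel m (x - z)) has_derivative (\<lambda>h. h \<bullet> \<kappa> (x - z))) (at x)"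
          by (rule has_derivative_compose)
        from has_derivative_mult_right[OF this, of "a z"] show ?thesis by simp
      qed
      then show "GDERIV (mollified N m U) x :> g x"
        unfolding gderiv_def moll g_def inner_sum_right by (rule has_derivative_sum)
      show "\<bar>mollified N m U x\<bar> \<le> K * (C / ?c)"
        using bound[of "\<lambda>z. kernel m (x - z)" 1] \<kappa> by (simp add: moll C11_bounded_def)
      show "norm (g x) \<le> K * (C / ?c)"
        unfolding g_def using bound[of "\<lambda>z. \<kappa> (x - z)" 1] \<kappa> by (simp add: C11_bounded_def)
      have xy: "norm ((x - z) - (y - z)) = norm (x - y)" for z by simp
      show "\<bar>mollified N m U x - mollified N m U y\<bar> \<le> K * (C / ?c) * norm (x - y)"
      proof -
        have "norm (kernel m (x - z) - kernel m (y - z)) \<le> C * norm (x - y)" for z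
          using \<kappa> xy[of z] unfolding C11_bounded_def real_norm_def by metis
        from bound[of "\<lambda>z. kernel m (x - z) - kernel m (y - z)", OF this]
        show ?thesis by (simp add: moll sum_subtractf right_diff_distrib)
      qed
      have "norm (\<kappa> (x - z) - \<kappa> (y - z)) \<le> C * norm (x - y)" for z
        using \<kappa> xy[of z] unfolding C11_bounded_def by metis
      from bound[of "\<lambda>z. \<kappa> (x - z) - \<kappa> (y - z)", OF this]
      show "norm (g x - g y) \<le> K * (C / ?c) * norm (x - y)"
        by (simp add: g_def sum_subtractf scaleR_right_diff_distrib)
    qed
    then show "\<exists>g. C11_bounded (mollified N m U) g (K * (C / ?c))" by blast
  qed
qed

context
  fixes L :: "'n::finite torus \<Rightarrow> real ^ 'n \<Rightarrow> real"
  assumes contL: "torus_continuous L" and superL: "superlinear L"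
begin

text \<open>A Korovkin argument: \<open>L\<close> is bounded by its value at the centre plus a
  multiple of the squared sines, and for such functions the weighted sums are known exactly. Since
  the second moment does not involve \<open>N\<close>, one exponent \<open>m\<close> serves all fine
  grids.\<close>

lemma kernel_average_le:
  fixes e R :: real
  assumes e: "e > 0" and R: "R \<ge> 0"
  obtains m and d :: real where "d > 0"
    "\<And>N x v w. Suc m < N \<Longrightarrow> norm v \<le> R \<Longrightarrow> norm w \<le> R \<Longrightarrow> norm (v - w) < d \<Longrightarrow>
      (\<Sum>z\<in>grid N. weight N m (x - z) * L (to_torus z) w) \<le> L (to_torus x) v + e"
proof -
  obtain M where M: "M \<ge> 0" "\<And>x v. norm v \<le> R \<Longrightarrow> \<bar>L x v\<bar> \<le> M"
    using torus_continuous_bounded[OF contL, where R = R] by blast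
  have e2: "e / 2 > 0" using e by simp
  obtain d where d: "d > 0" "\<And>x y v w. norm v \<le> R \<Longrightarrow> norm w \<le> R \<Longrightarrow>
    norm (x - y) < d \<Longrightarrow> norm (v - w) < d \<Longrightarrow> \<bar>L (to_torus x) v - L (to_torus y) w\<bar> < e / 2"
    using torus_uniformly_continuous[OF contL e2, where R = R] by blast
  obtain s where s: "s > 0"
    "\<And>(y :: real ^ 'n). (\<And>k. \<bar>sin (pi * y $ k)\<bar> < s) \<Longrightarrow> \<exists>l. norm (y - int_vec l) < d"
    using sin_pi_small_vec[OF d(1)] by metis
  define Q where "Q = 2 * M / s\<^sup>2"
  have Q: "Q \<ge> 0" using M by (simp add: Q_def)
  obtain m :: nat where m: "CARD('n) * Q / (e / 2) < real m"
    using reals_Archimedean2 by blast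
  text \<open>Away from \<open>x\<close> modulo the integers, one of the sines is at least \<open>s\<close> and the quadratic term
    exceeds the oscillation \<open>2 * M\<close> of \<open>L\<close>.\<close>
  have pt: "L (to_torus z) w \<le> L (to_torus x) v + e / 2 + Q * (\<Sum>k\<in>UNIV. sin (pi * (x $ k - z $ k)) ^ 2)"
    if "norm v \<le> R" "norm w \<le> R" "norm (v - w) < d" for x z v w :: "real ^ 'n"
  proof (cases "\<forall>k. \<bar>sin (pi * (x - z) $ k)\<bar> < s")
    case True
    then obtain l where "norm ((x - z) - int_vec l) < d" using s(2) by blast
    then have "norm (x - (z + int_vec l)) < d" by (simp add: algebra_simps)
    from d(2)[OF that(1,2) this that(3)] have "\<bar>L (to_torus x) v - L (to_torus z) w\<bar> < e / 2"
      by (simp only: to_torus_add_int_vec)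
    then have "L (to_torus z) w \<le> L (to_torus x) v + e / 2" by linarith
    moreover have "0 \<le> Q * (\<Sum>k\<in>UNIV. sin (pi * (x $ k - z $ k)) ^ 2)"
      using Q by (intro mult_nonneg_nonneg sum_nonneg) auto
    ultimately show ?thesis by linarith
  next
    case False
    then obtain q where "s \<le> \<bar>sin (pi * (x $ q - z $ q))\<bar>" by (auto simp: not_less)
    then have "s\<^sup>2 \<le> sin (pi * (x $ q - z $ q)) ^ 2"
      using s(1) power_mono[of s "\<bar>sin (pi * (x $ q - z $ q))\<bar>" 2] by simp
    also have "\<dots> \<le> (\<Sum>k\<in>UNIV. sin (pi * (x $ k - z $ k)) ^ 2)"
      by (rule member_le_sum[where f = "\<lambda>k. sin (pi * (x $ k - z $ k)) ^ 2"]) auto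
    finally have "Q * s\<^sup>2 \<le> Q * (\<Sum>k\<in>UNIV. sin (pi * (x $ k - z $ k)) ^ 2)"
      using Q by (rule mult_left_mono)
    then have "2 * M \<le> Q * (\<Sum>k\<in>UNIV. sin (pi * (x $ k - z $ k)) ^ 2)"
      using s(1) by (simp add: Q_def)
    then show ?thesis
      using M(2)[OF that(1), of "to_torus x"] M(2)[OF that(2), of "to_torus z"] e by linarith
  qed
  show thesis
  proof (rule that[OF d(1)])
    fix N :: nat and x v w :: "real ^ 'n"
    assume *: "Suc m < N" "norm v \<le> R" "norm w \<le> R" "norm (v - w) < d"
    let ?W = "\<lambda>z. weight N m (x - z)"
    have "(\<Sum>z\<in>grid N. ?W z * L (to_torus z) w) \<le>
        (\<Sum>z\<in>grid N. ?W z * (L (to_torus x) v + e / 2 + Q * (\<Sum>k\<in>UNIV. sin (pi * (x $ k - z $ k)) ^ 2)))"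
      by (intro sum_mono mult_left_mono pt * weight_nonneg)
    also have "\<dots> = (L (to_torus x) v + e / 2) * (\<Sum>z\<in>grid N. ?W z) +
        Q * (\<Sum>z\<in>grid N. \<Sum>k\<in>UNIV. ?W z * sin (pi * (x $ k - z $ k)) ^ 2)"
    proof -
      have "(\<Sum>z\<in>grid N. ?W z * (a + Q * S z)) = a * (\<Sum>z\<in>grid N. ?W z) + Q * (\<Sum>z\<in>grid N. ?W z * S z)" for a S
        by (simp add: algebra_simps sum.distrib sum_distrib_left)
      from this[of "L (to_torus x) v + e / 2" "\<lambda>z. \<Sum>k\<in>UNIV. sin (pi * (x $ k - z $ k)) ^ 2"]
      show ?thesis by (simp only: sum_distrib_left[of "?W _"])
    qed
    also have "(\<Sum>z\<in>grid N. \<Sum>k\<in>UNIV. ?W z * sin (pi * (x $ k - z $ k)) ^ 2) =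
        (\<Sum>k\<in>UNIV. \<Sum>z\<in>grid N. ?W z * sin (pi * (x $ k - z $ k)) ^ 2)"
      by (rule sum.swap)
    also have "(L (to_torus x) v + e / 2) * (\<Sum>z\<in>grid N. ?W z) + Q * \<dots> =
        L (to_torus x) v + e / 2 + CARD('n) * Q / (2 * m + 2)"
      using * by (simp add: sum_weight sum_weight_sin_squared) (simp add: mult.commute add.commute)
    also have "CARD('n) * Q / (2 * m + 2) \<le> e / 2"
    proof -
      have "CARD('n) * Q \<le> real m * (e / 2)" using m e by (simp add: field_simps)
      also have "\<dots> \<le> (2 * m + 2) * (e / 2)" using e by (intro mult_right_mono) auto
      finally show ?thesis by (simp add: field_simps)
    qed
    finally show "(\<Sum>z\<in>grid N. ?W z * L (to_torus z) w) \<le> L (to_torus x) v + e" by simp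
  qed
qed

lemma calibrated_value_le:
  fixes e :: real
  assumes \<mu>: "closed_prob_measure \<mu>" "integrable \<mu> (\<lambda>(x, v). L x v)" and e: "e > 0"
  obtains d where "d > 0" "\<And>N \<tau> A U x v k. calibrated_chain L N \<tau> A U x v k \<Longrightarrow> \<tau> < d \<Longrightarrow>
    1 / real N < d * \<tau> \<Longrightarrow> A \<le> (\<integral>(x, v). L x v \<partial>\<mu>) + e"
proof -
  let ?D = "real CARD('n)"
  obtain B where B: "B \<ge> 0" "\<And>x w. norm w \<le> 1 + 2 * ?D \<Longrightarrow> \<bar>L x w\<bar> \<le> B"
    using torus_continuous_bounded[OF contL, where R = "1 + 2 * ?D"] by blast
  obtain c0 where c0: "\<And>x w. L x w \<ge> 1 * norm w - c0"
    using superL unfolding superlinear_def by (meson zero_less_one)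
  define c where "c = \<bar>c0\<bar>"
  have c: "c \<ge> 0" "L x w \<ge> - c" for x w
    using c0[of w x] norm_ge_zero[of w] unfolding c_def by linarith+
  \<comment> \<open>This will bound the gradient of the averaged potential: testing the inequality
    with unit velocities gives at most \<open>B - A + e\<close>, and \<open>A\<close> is at least
    \<open>- c\<close>.\<close>
  define K1 where "K1 = B + c + e"
  have K1: "K1 > 0" using B c e by (simp add: K1_def)
  obtain C2 where C2: "\<And>x w. L x w \<ge> (K1 + 1) * norm w - C2"
    using superL K1 unfolding superlinear_def by (metis add_pos_pos zero_less_one)
  \<comment> \<open>Beyond \<open>R\<close> the slope \<open>K1 + 1\<close> of \<open>L\<close>
    beats the linear term of slope \<open>K1\<close> and covers \<open>A\<close> as well;
    \<open>R\<close> is at least 1 so that unit velocities belong to the bounded case.\<close>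
  define R where "R = max 1 (C2 + B)"
  have R: "R \<ge> 1" "R \<ge> C2 + B" by (auto simp: R_def)
  have e4: "e / 4 > 0" "R + 1 \<ge> 0" using e R by auto
  obtain m and d1 :: real where d1: "d1 > 0"
    "\<And>N x v w. Suc m < N \<Longrightarrow> norm v \<le> R + 1 \<Longrightarrow> norm w \<le> R + 1 \<Longrightarrow> norm (v - w) < d1 \<Longrightarrow>
      (\<Sum>z\<in>grid N. weight N m (x - z) * L (to_torus z) w) \<le> L (to_torus x) v + e / 4"
    by (rule kernel_average_le[OF e4]) blast
  obtain C where C: "C \<ge> 0" "\<And>N (U :: real ^ 'n \<Rightarrow> real) K. N > 0 \<Longrightarrow> K \<ge> 0 \<Longrightarrow>
    (\<And>z. z \<in> grid N \<Longrightarrow> \<bar>U z - U 0\<bar> \<le> K) \<Longrightarrow> \<exists>g. C11_bounded (mollified N m U) g (K * C)"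
    by (rule C11_bounded_mollified) blast
  define Q where "Q = (?D + 1) * (B + c) * C"
  have Q: "Q \<ge> 0" using B c C by (simp add: Q_def)
  \<comment> \<open>In this order the entries ensure \<open>1 / N \<le> \<tau> \<le> 1\<close>,
    enough nodes for the kernel, a velocity rounding below \<open>d1\<close>, rounded velocities of
    norm at most \<open>R + 1\<close>, and errors of at most \<open>e / 4\<close> each from the
    Taylor remainder and from rounding in the gradient term. Another \<open>e / 4\<close> is spent
    on averaging \<open>L\<close>.\<close>
  define d where "d = Min {1, 1 / real (m + 2), d1 / (2 * ?D), 1 / ?D, e / (4 * (Q + 1) * (R + 1)\<^sup>2), e / (4 * (Q + 1) * ?D)}"
  have d_le: "d \<le> 1" "d \<le> 1 / real (m + 2)" "d \<le> d1 / (2 * ?D)" "d \<le> 1 / ?D"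
    "d \<le> e / (4 * (Q + 1) * (R + 1)\<^sup>2)" "d \<le> e / (4 * (Q + 1) * ?D)"
    unfolding d_def by (rule Min_le; simp)+
  have d_pos: "d > 0"
    unfolding d_def using d1 e Q R by (subst Min_gr_iff) (auto intro!: divide_pos_pos mult_pos_pos)
  have cancel: "q * (r * (e / (4 * q * r))) = e / 4" if "q > 0" "r > 0" for q r :: real
    using that by simp
  have dD: "?D * d < d1" "?D * d \<le> 1" "Q * (?D * d) \<le> e / 4"
  proof -
    have "?D * d \<le> d1 / 2" using d_le(3) by (simp add: field_simps)
    then show "?D * d < d1" using d1 by linarith
    show "?D * d \<le> 1" using d_le(4) by (simp add: field_simps)
    have "Q * (?D * d) \<le> (Q + 1) * (?D * (e / (4 * (Q + 1) * ?D)))"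
      using Q d_le(6) d_pos by (intro mult_mono mult_left_mono) auto
    also have "\<dots> = e / 4" by (rule cancel) (use Q in auto)
    finally show "Q * (?D * d) \<le> e / 4" .
  qed
  have dQ: "Q * (d * (R + 1)\<^sup>2) \<le> e / 4"
  proof -
    have "Q * (d * (R + 1)\<^sup>2) \<le> (Q + 1) * ((R + 1)\<^sup>2 * (e / (4 * (Q + 1) * (R + 1)\<^sup>2)))"
      unfolding mult.commute[of d] using Q d_le(5) d_pos by (intro mult_mono mult_left_mono) auto
    also have "\<dots> = e / 4" by (rule cancel) (use Q R in auto)
    finally show ?thesis .
  qed
  show thesis
  proof (rule that[OF d_pos])
    fix N \<tau> A U x v k
    assume chain: "calibrated_chain L N \<tau> A U x v k" and \<tau>: "\<tau> < d" and h: "1 / real N < d * \<tau>"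
    interpret calibrated_chain L N \<tau> A U x v k by fact
    have hd: "1 / real N \<le> \<tau>" "\<tau> \<le> 1" "1 / real N < d"
    proof -
      have "d * \<tau> \<le> 1 * \<tau>" "d * \<tau> \<le> d * 1"
        using \<tau> d_le(1) \<tau>_pos d_pos by (intro mult_right_mono mult_left_mono; simp)+
      then show "1 / real N \<le> \<tau>" "\<tau> \<le> 1" "1 / real N < d" using h \<tau> d_le(1) by linarith+
    qed
    have "1 / real N < 1 / real (m + 2)" using hd(3) d_le(2) by linarith
    then have mN: "Suc m < N" using N_pos by (simp add: field_simps)
    have A: "- c \<le> A" "A \<le> B" using A_ge[OF c(2)] A_le B(2)[of 0 "to_torus 0"] by auto
    have osc: "\<bar>U z - U 0\<bar> \<le> (?D + 1) * (B + c)" if "z \<in> grid N" for z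
    proof -
      have "L x w \<le> B" if "norm w \<le> 1 + 2 * ?D" for x w using B(2)[OF that, of x] by linarith
      then show ?thesis using U_oscillation[OF _ hd(1,2) c(2) that, of B] by (simp add: add.commute)
    qed
    define \<phi> where "\<phi> = mollified N m U"
    obtain g where g: "C11_bounded \<phi> g Q"
      using C(2)[where U = U, OF N_pos _ osc] B c unfolding \<phi>_def Q_def by auto
    have W_per: "weight N m (y + int_vec l) = weight N m y" for y :: "real ^ 'n" and l
      by (simp add: weight_def kernel_periodic)
    have \<phi>_per: "\<phi> (y + int_vec l) = \<phi> y" for y l
      unfolding \<phi>_def mollified_def using W_per[of "y - _" l] by (simp add: algebra_simps)
    \<comment> \<open>The translation is moved from the weights to \<open>U\<close> by invariance of
      the grid sum; each term is then the potential inequality for the edge from \<open>z\<close> to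
      \<open>z + s\<close>, whose velocity does not depend on \<open>z\<close>.\<close>
    have shift: "\<phi> (y + s) - \<phi> y \<le> \<tau> * ((\<Sum>z\<in>grid N. weight N m (y - z) * L (to_torus z) ((1 / \<tau>) *\<^sub>R s)) - A)"
      if s: "s \<in> lattice N" for y s
    proof -
      define F where "F z = (U z - U 0) * weight N m (y + s - z)" for z
      have F_per: "F (z + int_vec l) = F z" for z l
      proof -
        have "y + s - (z + int_vec l) = (y + s - z) + int_vec (- l)" by (simp add: vec_eq_iff)
        then show ?thesis unfolding F_def U_periodic by (simp only: W_per)
      qed
      have "\<phi> (y + s) = (\<Sum>z\<in>grid N. F z)" by (simp add: \<phi>_def mollified_def F_def)
      also have "\<dots> = (\<Sum>z\<in>grid N. F (z + s))"
        using s by (intro sum_grid_shift[symmetric] N_pos F_per) (simp add: lattice_def)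
      finally have "\<phi> (y + s) - \<phi> y = (\<Sum>z\<in>grid N. weight N m (y - z) * (U (z + s) - U z))"
        by (simp add: \<phi>_def mollified_def F_def sum_subtractf[symmetric] algebra_simps)
      also have "\<dots> \<le> (\<Sum>z\<in>grid N. weight N m (y - z) * (\<tau> * (L (to_torus z) ((1 / \<tau>) *\<^sub>R s) - A)))"
      proof (intro sum_mono mult_left_mono weight_nonneg)
        fix z :: "real ^ 'n" assume "z \<in> grid N"
        then have "z \<in> lattice N" using grid_subset_lattice by blast
        then show "U (z + s) - U z \<le> \<tau> * (L (to_torus z) ((1 / \<tau>) *\<^sub>R s) - A)"
          using U_diff_le[OF _ lattice_add[OF _ s], of z z] by simp
      qed
      also have "\<dots> = \<tau> * ((\<Sum>z\<in>grid N. weight N m (y - z) * L (to_torus z) ((1 / \<tau>) *\<^sub>R s)) -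
          (\<Sum>z\<in>grid N. weight N m (y - z)) * A)"
        by (simp add: sum_distrib_left sum_distrib_right sum_subtractf[symmetric] algebra_simps)
      finally show ?thesis using mN by (simp add: sum_weight)
    qed
    \<comment> \<open>The velocity \<open>w\<close> is replaced by \<open>w'\<close>, for which
      \<open>\<tau> *\<^sub>R w'\<close> is a lattice vector, and the difference quotient of \<phi>
      over one time step by its gradient.\<close>
    have bounded_case: "g y \<bullet> w \<le> L (to_torus y) w - A + e" if w: "norm w \<le> R" for y w
    proof -
      define s where "s = lattice_floor N (\<tau> *\<^sub>R w)"
      define w' where "w' = (1 / \<tau>) *\<^sub>R s"
      have sw: "s = \<tau> *\<^sub>R w'" using \<tau>_pos by (simp add: w'_def)
      have s: "s \<in> lattice N" unfolding s_def by (rule lattice_floor_in_lattice[OF N_pos])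
      have "\<tau> * norm (w' - w) = norm (s - \<tau> *\<^sub>R w)"
        using \<tau>_pos by (simp add: sw scaleR_right_diff_distrib[symmetric] del: scaleR_right_diff_distrib)
      also have "\<dots> \<le> ?D * (1 / real N)" unfolding s_def by (rule lattice_floor_error[OF N_pos])
      also have "\<dots> \<le> ?D * (d * \<tau>)" using h by (intro mult_left_mono) auto
      finally have ww: "norm (w' - w) \<le> ?D * d"
        using \<tau>_pos by (simp add: mult.left_commute mult.commute[of d])
      have w'R: "norm w' \<le> R + 1"
        using norm_triangle_sub[of w' w] ww dD(2) w by linarith
      have gQ: "norm (g y) \<le> Q" using g by (simp add: C11_bounded_def)
      have "\<bar>\<phi> (y + s) - \<phi> y - g y \<bullet> s\<bar> \<le> Q * norm s ^ 2" by (rule C11_bounded_taylor[OF g])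
      then have "g y \<bullet> s \<le> \<phi> (y + s) - \<phi> y + Q * norm s ^ 2" by linarith
      also have "\<dots> \<le> \<tau> * ((\<Sum>z\<in>grid N. weight N m (y - z) * L (to_torus z) w') - A) + Q * (\<tau> * norm w') ^ 2"
        using shift[OF s, of y] \<tau>_pos by (simp add: w'_def[symmetric] sw)
      finally have "\<tau> * (g y \<bullet> w') \<le> \<tau> * (((\<Sum>z\<in>grid N. weight N m (y - z) * L (to_torus z) w') - A) +
          Q * (\<tau> * norm w' ^ 2))"
        by (simp add: sw power2_eq_square algebra_simps)
      then have "g y \<bullet> w' \<le> ((\<Sum>z\<in>grid N. weight N m (y - z) * L (to_torus z) w') - A) + Q * (\<tau> * norm w' ^ 2)"
        using \<tau>_pos by simp
      also have "(\<Sum>z\<in>grid N. weight N m (y - z) * L (to_torus z) w') \<le> L (to_torus y) w + e / 4"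
        using w w'R ww dD(1) by (intro d1(2) mN) (auto simp: norm_minus_commute)
      also have "Q * (\<tau> * norm w' ^ 2) \<le> Q * (d * (R + 1)\<^sup>2)"
        using Q \<tau> \<tau>_pos d_pos w'R by (intro mult_left_mono mult_mono power_mono) auto
      also note dQ
      finally have 1: "g y \<bullet> w' \<le> L (to_torus y) w + e / 4 - A + e / 4" by simp
      have "g y \<bullet> w - g y \<bullet> w' = g y \<bullet> (w - w')" by (simp add: inner_diff_right)
      also have "\<dots> \<le> norm (g y) * norm (w - w')" by (rule norm_cauchy_schwarz)
      also have "\<dots> \<le> Q * (?D * d)"
        using gQ ww Q by (intro mult_mono) (auto simp: norm_minus_commute)
      finally show ?thesis using 1 dD(3) e by linarith
    qed
    have g_bound: "norm (g y) \<le> K1" for y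
    proof (cases "g y = 0")
      case False
      have "norm (g y) = g y \<bullet> sgn (g y)"
        using False by (simp add: sgn_div_norm power2_norm_eq_inner[symmetric] power2_eq_square)
      also have "\<dots> \<le> L (to_torus y) (sgn (g y)) - A + e"
        by (rule bounded_case) (use R in \<open>simp add: norm_sgn\<close>)
      also have "\<dots> \<le> B + c + e"
      proof -
        have "norm (sgn (g y)) \<le> 1 + 2 * ?D" by (simp add: norm_sgn)
        from B(2)[OF this, of "to_torus y"] A show ?thesis by linarith
      qed
      finally show ?thesis by (simp add: K1_def)
    qed (use K1 in simp)
    have pointwise: "g y \<bullet> w \<le> L (to_torus y) w - A + e" for y w
    proof (cases "norm w \<le> R")
      case False
      have "g y \<bullet> w \<le> norm (g y) * norm w" by (rule norm_cauchy_schwarz)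
      also have "\<dots> \<le> K1 * norm w" by (intro mult_right_mono g_bound) simp
      finally show ?thesis using C2[of w "to_torus y"] False R A e by (simp add: algebra_simps)
    qed (rule bounded_case)
    have "continuous_on UNIV g"
    proof (rule uniformly_continuous_imp_continuous, rule lipschitz_on_uniformly_continuous[of Q], rule lipschitz_onI)
      show "dist (g y) (g z) \<le> Q * dist y z" for y z using g by (simp add: C11_bounded_def dist_norm)
    qed (rule Q)
    moreover have "GDERIV \<phi> y :> g y" for y using g by (simp add: C11_bounded_def)
    ultimately obtain G where G: "\<And>y. G (to_torus y) = g y" "has_bochner_integral \<mu> (\<lambda>(y, w). w \<bullet> G y) 0"
      using closed_measure_lift[OF \<mu>(1) \<phi>_per] by metis
    interpret \<mu>: prob_space \<mu> using \<mu>(1) by (simp add: closed_prob_measure_def)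
    \<comment> \<open>Closedness of \<mu> removes the gradient term from the integrated pointwise
      inequality.\<close>
    have "0 = (\<integral>(y, w). w \<bullet> G y \<partial>\<mu>)" using G(2) by (simp add: has_bochner_integral_integral_eq)
    also have "\<dots> \<le> (\<integral>z. (case z of (y, w) \<Rightarrow> L y w) + (e - A) \<partial>\<mu>)"
    proof (rule integral_mono)
      show "integrable \<mu> (\<lambda>(y, w). w \<bullet> G y)" using G(2) by (rule integrable.intros)
      show "integrable \<mu> (\<lambda>z. (case z of (y, w) \<Rightarrow> L y w) + (e - A))" using \<mu>(2) by simp
      fix z :: "'n torus \<times> (real ^ 'n)"
      obtain y w where "z = (to_torus y, w)" by (metis surj_pair to_torus_surj)
      then show "(case z of (y, w) \<Rightarrow> w \<bullet> G y) \<le> (case z of (y, w) \<Rightarrow> L y w) + (e - A)"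
        using pointwise[of y w] by (simp add: G(1) inner_commute)
    qed
    also have "\<dots> = (\<integral>(x, v). L x v \<partial>\<mu>) + (e - A)"
      using \<mu>(2) by (simp add: \<mu>.prob_space)
    finally show "A \<le> (\<integral>(x, v). L x v \<partial>\<mu>) + e" by simp
  qed
qed

end

section \<open>Limits of periodic discrete orbits\<close>


lemma C1_gradient:
  fixes f :: "real ^ 'n::finite \<Rightarrow> real"
  assumes "C1 f"
  obtains g where "\<And>x. GDERIV f x :> g x" "continuous_on UNIV g"
proof -
  obtain f' where f': "\<And>x. (f has_derivative blinfun_apply (f' x)) (at x)" "continuous_on UNIV f'"
    using assms unfolding C1_def by blast
  define g where "g x = (\<Sum>b\<in>Basis. blinfun_apply (f' x) b *\<^sub>R b)" for x
  have "h \<bullet> g x = blinfun_apply (f' x) h" for h x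
  proof -
    have "h \<bullet> g x = (\<Sum>b\<in>Basis. (h \<bullet> b) * blinfun_apply (f' x) b)"
      by (simp add: g_def inner_sum_right mult.commute)
    also have "\<dots> = blinfun_apply (f' x) (\<Sum>b\<in>Basis. (h \<bullet> b) *\<^sub>R b)"
      by (simp add: blinfun.bilinear_simps blinfun.sum_right)
    finally show ?thesis by (simp add: euclidean_representation)
  qed
  then have "(\<lambda>h. h \<bullet> g x) = blinfun_apply (f' x)" for x by (simp add: fun_eq_iff)
  then have "GDERIV f x :> g x" for x unfolding gderiv_def using f'(1) by simp
  moreover have "continuous_on UNIV g"
    unfolding g_def by (intro continuous_intros f'(2))
  ultimately show thesis by (rule that)
qed

text \<open>The increments of a periodic test function telescope to zero around each cycle, integer
  jumps being invisible to it. Each increment equals \<tau> times \<open>F\<close> up to o(\<tau>),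
  uniformly in the step, so the mean of \<open>F\<close> over the cycle tends to zero.\<close>

lemma calibrated_limit_closed:
  fixes L :: "'n::finite torus \<Rightarrow> real ^ 'n \<Rightarrow> real" and R :: real
  assumes chain: "\<And>n. calibrated_chain L (N n) (\<tau> n) (A n) (U n) (x n) (v n) (k n)"
    and \<tau>: "\<tau> \<longlonglongrightarrow> 0" and R: "\<And>n i. i < k n \<Longrightarrow> norm (v n i) \<le> R"
    and M: "prob_space M" "sets M = sets borel"
    and conv: "\<And>F :: (real ^ 'n) \<times> (real ^ 'n) \<Rightarrow> real. continuous_on UNIV F \<Longrightarrow> integrable M F \<and>
      (\<lambda>n. (\<Sum>i<k n. F (x n i, v n i)) / k n) \<longlonglongrightarrow> (\<integral>p. F p \<partial>M)"
  shows "closed_prob_measure (distr M borel lift_pair)"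
  unfolding closed_prob_measure_def
proof (intro conjI allI impI)
  interpret M: prob_space M by fact
  have meas: "lift_pair \<in> measurable M borel"
    using borel_measurable_continuous_onI[OF continuous_on_lift_pair] M(2)
    by (simp cong: measurable_cong_sets)
  show "prob_space (distr M borel lift_pair)" by (rule M.prob_space_distr[OF meas])
  fix \<phi> :: "'n torus \<Rightarrow> real" assume "C1_torus \<phi>"
  define \<Phi> where "\<Phi> y = \<phi> (to_torus y)" for y
  have \<Phi>_per: "\<Phi> (y + int_vec l) = \<Phi> y" for y l by (simp add: \<Phi>_def)
  obtain g where g: "\<And>y. GDERIV \<Phi> y :> g y" "continuous_on UNIV g"
    using C1_gradient \<open>C1_torus \<phi>\<close> unfolding C1_torus_def \<Phi>_def[abs_def] by blast
  have grad: "torus_grad \<phi> (to_torus y) = g y" for y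
    by (rule torus_grad_eq) (use g(1) in \<open>simp add: \<Phi>_def[abs_def]\<close>)
  define F where "F p = snd p \<bullet> g (fst p)" for p
  have contF: "continuous_on UNIV F"
    unfolding F_def by (intro continuous_intros continuous_on_compose2[OF g(2)]) auto
  have "R \<ge> 0" using R[of 0 0] calibrated_chain.k_pos[OF chain[of 0]] norm_ge_zero order_trans by blast
  have "(\<lambda>n. (\<Sum>i<k n. F (x n i, v n i)) / k n) \<longlonglongrightarrow> 0"
  proof (rule LIMSEQ_I)
    fix e :: real assume "e > 0"
    \<comment> \<open>Grid points have norm at most \<open>CARD('n)\<close>, and for \<tau> < 1 a
      step has length at most \<open>R\<close>, so \<open>K\<close> contains all segments
      considered.\<close>
    define K where "K = cball (0 :: real ^ 'n) (CARD('n) + R)"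
    have "uniformly_continuous_on K g"
      unfolding K_def by (intro compact_uniformly_continuous continuous_on_subset[OF g(2)]) auto
    moreover have "e / (2 * (R + 1)) > 0" using \<open>e > 0\<close> \<open>R \<ge> 0\<close> by simp
    ultimately obtain d where d: "d > 0" "\<And>y z. y \<in> K \<Longrightarrow> z \<in> K \<Longrightarrow> dist z y < d \<Longrightarrow>
        dist (g z) (g y) < e / (2 * (R + 1))"
      unfolding uniformly_continuous_on_def by meson
    have "min 1 (d / (R + 1)) > 0" using d \<open>R \<ge> 0\<close> by simp
    then obtain n0 where n0: "\<And>n. n \<ge> n0 \<Longrightarrow> norm (\<tau> n - 0) < min 1 (d / (R + 1))"
      using LIMSEQ_D[OF \<tau>] by blast
    show "\<exists>n0. \<forall>n\<ge>n0. norm ((\<Sum>i<k n. F (x n i, v n i)) / k n - 0) < e"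
    proof (intro exI[of _ n0] allI impI)
      fix n assume "n \<ge> n0"
      interpret calibrated_chain L "N n" "\<tau> n" "A n" "U n" "x n" "v n" "k n" by (rule chain)
      have \<tau>n: "\<tau> n < 1" "\<tau> n < d / (R + 1)" using n0[OF \<open>n \<ge> n0\<close>] \<tau>_pos by auto
      have small: "\<bar>\<Phi> (x n (Suc i)) - \<Phi> (x n i) - \<tau> n * F (x n i, v n i)\<bar> \<le> \<tau> n * (e / 2)"
        if i: "i < k n" for i
      proof -
        let ?w = "\<tau> n *\<^sub>R v n i"
        have w: "norm ?w \<le> \<tau> n * R" using R[OF i] \<tau>_pos by simp
        have wd: "norm ?w < d"
        proof -
          have "\<tau> n * R \<le> \<tau> n * (R + 1)" using \<tau>_pos by simp
          also have "\<dots> < d" using \<tau>n(2) \<open>R \<ge> 0\<close> by (simp add: pos_less_divide_eq)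
          finally show ?thesis using w by linarith
        qed
        have wR: "norm ?w \<le> R"
          using w mult_right_mono[of "\<tau> n" 1 R] \<tau>n(1) \<open>R \<ge> 0\<close> by simp
        obtain l where l: "x n i + ?w = x n (Suc i) + int_vec l" using step by blast
        obtain t where t: "0 < t" "t < 1" "\<Phi> (x n i + ?w) - \<Phi> (x n i) = ?w \<bullet> g (x n i + t *\<^sub>R ?w)"
          by (rule gradient_mean_value[OF g(1)])
        have tw: "norm (t *\<^sub>R ?w) \<le> norm ?w"
        proof -
          have "norm (t *\<^sub>R ?w) = t * norm ?w" using t(1) by (simp only: norm_scaleR abs_of_pos)
          also have "\<dots> \<le> 1 * norm ?w" using t by (intro mult_right_mono) auto
          finally show ?thesis by simp
        qed
        have "norm (x n i) \<le> CARD('n) * (1 :: real)"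
          by (rule norm_le_card) (use x_grid[of i] N_pos in \<open>auto simp: grid_def less_imp_le\<close>)
        then have "x n i \<in> K" "x n i + t *\<^sub>R ?w \<in> K"
          using tw wR \<open>R \<ge> 0\<close> norm_triangle_ineq[of "x n i" "t *\<^sub>R ?w"] by (auto simp: K_def)
        then have gd: "norm (g (x n i + t *\<^sub>R ?w) - g (x n i)) \<le> e / (2 * (R + 1))"
          using d(2)[of "x n i" "x n i + t *\<^sub>R ?w"] tw wd by (simp add: dist_norm less_imp_le)
        have "\<Phi> (x n (Suc i)) - \<Phi> (x n i) - \<tau> n * F (x n i, v n i) =
            ?w \<bullet> (g (x n i + t *\<^sub>R ?w) - g (x n i))"
          using t(3) \<Phi>_per[of "x n (Suc i)" l] by (simp add: l F_def inner_diff_right)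
        also have "\<bar>\<dots>\<bar> \<le> norm ?w * norm (g (x n i + t *\<^sub>R ?w) - g (x n i))"
          by (rule Cauchy_Schwarz_ineq2)
        also have "\<dots> \<le> (\<tau> n * (R + 1)) * (e / (2 * (R + 1)))"
        proof (intro mult_mono gd)
          have "\<tau> n * R \<le> \<tau> n * (R + 1)" using \<tau>_pos by simp
          with w show "norm ?w \<le> \<tau> n * (R + 1)" by linarith
        qed (use \<tau>_pos \<open>R \<ge> 0\<close> in auto)
        also have "\<dots> = \<tau> n * (e / 2)"
        proof -
          have "\<tau> n * q * (e / (2 * q)) = \<tau> n * (e / 2)" if "q > 0" for q using that by simp
          from this[of "R + 1"] \<open>R \<ge> 0\<close> show ?thesis by simp
        qed
        finally show ?thesis .
      qed
      have "(\<Sum>i<k n. \<Phi> (x n (Suc i)) - \<Phi> (x n i)) = 0"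
        using sum_lessThan_telescope[of "\<lambda>i. \<Phi> (x n i)" "k n"] x_closed by simp
      then have "\<tau> n * (\<Sum>i<k n. F (x n i, v n i)) =
          - (\<Sum>i<k n. \<Phi> (x n (Suc i)) - \<Phi> (x n i) - \<tau> n * F (x n i, v n i))"
        by (simp add: sum_subtractf sum_distrib_left)
      then have "\<bar>\<tau> n * (\<Sum>i<k n. F (x n i, v n i))\<bar> \<le>
          (\<Sum>i<k n. \<bar>\<Phi> (x n (Suc i)) - \<Phi> (x n i) - \<tau> n * F (x n i, v n i)\<bar>)"
        by (simp only: abs_minus_cancel sum_abs)
      also have "\<dots> \<le> (\<Sum>i<k n. \<tau> n * (e / 2))" by (rule sum_mono) (use small in simp)
      finally have "\<tau> n * \<bar>\<Sum>i<k n. F (x n i, v n i)\<bar> \<le> \<tau> n * (k n * (e / 2))"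
        using \<tau>_pos by (simp add: abs_mult mult.left_commute)
      then have "\<bar>\<Sum>i<k n. F (x n i, v n i)\<bar> \<le> k n * (e / 2)" using \<tau>_pos by simp
      then have "\<bar>\<Sum>i<k n. F (x n i, v n i)\<bar> / k n \<le> e / 2"
        using k_pos by (simp add: field_simps)
      then show "norm ((\<Sum>i<k n. F (x n i, v n i)) / k n - 0) < e"
      proof -
        have "norm ((\<Sum>i<k n. F (x n i, v n i)) / k n - 0) = \<bar>\<Sum>i<k n. F (x n i, v n i)\<bar> / k n"
          by (simp add: abs_divide)
        with \<open>_ \<le> e / 2\<close> \<open>e > 0\<close> show ?thesis by linarith
      qed
    qed
  qed
  with conv[OF contF] have F: "integrable M F" "(\<integral>p. F p \<partial>M) = 0"
    using LIMSEQ_unique by blast+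
  have eq: "(case lift_pair p of (X, v) \<Rightarrow> v \<bullet> torus_grad \<phi> X) = F p" for p
    by (cases p) (simp add: F_def grad)
  have "continuous_on UNIV (\<lambda>(X, v). v \<bullet> torus_grad \<phi> X)"
    by (rule continuous_on_torus_prodI) (use contF in \<open>simp only: eq\<close>)
  then have m: "(\<lambda>(X, v). v \<bullet> torus_grad \<phi> X) \<in> borel_measurable borel"
    by (rule borel_measurable_continuous_onI)
  show "has_bochner_integral (distr M borel lift_pair) (\<lambda>(X, v). v \<bullet> torus_grad \<phi> X) 0"
    unfolding has_bochner_integral_iff
    by (simp only: integrable_distr_eq[OF meas m] integral_distr[OF meas m] eq F)
qed simp

section \<open>Supports and points avoided by the cycles\<close>

lemma closed_spt: "closed (spt \<mu>)"
proof -
  have "- spt \<mu> = \<Union>{U. open U \<and> \<not> emeasure \<mu> U > 0}" by (auto simp: spt_def)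
  moreover have "open \<dots>" by (rule open_Union) auto
  ultimately show ?thesis by (simp add: closed_def)
qed


text \<open>A bump function around a translate of the point vanishes on all cycles, hence has
  integral zero in the limit. As \<open>M\<close> lives on the cover while the support lies on the
  torus, every integer translate has to be excluded; countability combines the null sets.\<close>

lemma not_spt_if_avoided:
  fixes y0 v0 :: "real ^ 'n::finite" and M :: "((real ^ 'n) \<times> (real ^ 'n)) measure"
  assumes M: "prob_space M" "sets M = sets borel" and e: "e > 0"
    and conv: "\<And>F :: (real ^ 'n) \<times> (real ^ 'n) \<Rightarrow> real. continuous_on UNIV F \<Longrightarrow> integrable M F \<and>
      (\<lambda>n. (\<Sum>i<k n. F (p n i)) / real (k n)) \<longlonglongrightarrow> (\<integral>p. F p \<partial>M)"
    and far: "\<And>n i l. i < k n \<Longrightarrow> dist (y0 + int_vec l, v0) (p n i) \<ge> e"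
  shows "(to_torus y0, v0) \<notin> spt (distr M borel lift_pair)"
proof -
  interpret M: prob_space M by fact
  have meas: "lift_pair \<in> measurable M borel"
    using borel_measurable_continuous_onI[OF continuous_on_lift_pair] M(2)
    by (simp cong: measurable_cong_sets)
  have avoid: "AE p in M. dist (y0 + int_vec l, v0) p \<ge> e" for l
  proof -
    define F where "F p = max 0 (e - dist (y0 + int_vec l, v0) p)" for p
    have contF: "continuous_on UNIV F" unfolding F_def by (intro continuous_intros)
    have "(\<Sum>i<k n. F (p n i)) = 0" for n
      using far by (intro sum.neutral) (auto simp: F_def)
    then have "integrable M F" "(\<integral>p. F p \<partial>M) = 0"
      using conv[OF contF] LIMSEQ_unique[OF _ tendsto_const] by auto
    then have "AE p in M. F p = 0"
      by (subst (asm) integral_nonneg_eq_0_iff_AE) (auto simp: F_def)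
    then show ?thesis by eventually_elim (simp add: F_def max_def split: if_splits)
  qed
  then have all: "AE p in M. \<forall>l. dist (y0 + int_vec l, v0) p \<ge> e"
    by (subst AE_all_countable) blast
  define W where "W = lift_pair ` ball (y0, v0) e"
  have "open W" unfolding W_def by (rule open_image_lift_pair) simp
  have "AE p in M. lift_pair p \<notin> W"
    using all
  proof eventually_elim
    fix p assume *: "\<forall>l. dist (y0 + int_vec l, v0) p \<ge> e"
    show "lift_pair p \<notin> W"
    proof
      assume "lift_pair p \<in> W"
      then obtain q where q: "q \<in> ball (y0, v0) e" "lift_pair p = lift_pair q" by (auto simp: W_def)
      then have "to_torus (fst q) = to_torus (fst p)" "snd p = snd q" by (cases p; cases q; simp)+
      then obtain l where l: "fst p = fst q + int_vec l" unfolding to_torus_eq_iff by blast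
      have "dist (y0 + int_vec l, v0) p = dist (y0, v0) q"
        by (cases p, cases q) (use l \<open>snd p = snd q\<close> in \<open>simp add: dist_Pair_Pair dist_norm\<close>)
      moreover have "e \<le> dist (y0 + int_vec l, v0) p" using * by blast
      ultimately show False using q(1) by simp
    qed
  qed
  moreover have "{z. z \<notin> W} \<in> sets borel"
    using borel_comp[OF borel_open[OF \<open>open W\<close>]] by (simp add: Compl_eq)
  ultimately have "AE z in distr M borel lift_pair. z \<notin> W"
    by (subst AE_distr_iff[OF meas]) auto
  then have "emeasure (distr M borel lift_pair) W = 0"
    by (subst (asm) AE_iff_measurable[of W]) (use \<open>open W\<close> in auto)
  moreover have "(to_torus y0, v0) \<in> W" using e by (auto simp: W_def intro!: image_eqI[of _ _ "(y0, v0)"])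
  ultimately show ?thesis using \<open>open W\<close> by (auto simp: spt_def)
qed

text \<open>Avoidance is assumed along the whole sequence, which in the application is already a
  subsequence; the contradiction arises there, for a point chosen in the support.\<close>

lemma spt_avoidance_contradiction:
  fixes L :: "'n::finite torus \<Rightarrow> real ^ 'n \<Rightarrow> real"
  assumes L: "torus_continuous L" "superlinear L"
    and mather: "mather_measure L \<mu>" and unique: "\<And>\<nu>. mather_measure L \<nu> \<Longrightarrow> \<nu> = \<mu>"
    and chain: "\<And>n. calibrated_chain L (N n) (\<tau> n) (A n) (U n) (x n) (v n) (k n)"
    and \<tau>: "\<tau> \<longlonglongrightarrow> 0" and ratio: "(\<lambda>n. 1 / real (N n) / \<tau> n) \<longlonglongrightarrow> 0"
    and e: "e > 0" and far: "\<And>n i l. i < k n \<Longrightarrow> dist (y0 + int_vec l, v0) (x n i, v n i) \<ge> e"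
  shows "(to_torus y0, v0) \<notin> spt \<mu>"
proof -
  have \<tau>_pos: "\<tau> n > 0" for n using calibrated_chain.\<tau>_pos[OF chain] .
  obtain B where B: "B \<ge> 0" "\<And>x w. norm w \<le> 1 + 2 * real CARD('n) \<Longrightarrow> \<bar>L x w\<bar> \<le> B"
    using torus_continuous_bounded[OF L(1), where R = "1 + 2 * real CARD('n)"] by blast
  obtain c0 where c0: "\<And>x w. L x w \<ge> 1 * norm w - c0"
    using L(2) unfolding superlinear_def by (meson zero_less_one)
  define c where "c = \<bar>c0\<bar>"
  have c: "L x w \<ge> - c" "c \<ge> 0" for x w
    using c0[of w x] norm_ge_zero[of w] unfolding c_def by linarith+
  have "B + c + 1 > 0" using B c by simp
  then obtain C where C: "\<And>x w. L x w \<ge> (B + c + 1) * norm w - C"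
    using L(2) unfolding superlinear_def by meson
  define R where "R = 2 * B + c + C"
  have "\<forall>\<^sub>F n in sequentially. 1 / real (N n) / \<tau> n < 1"
    using ratio by (rule order_tendstoD) simp
  \<comment> \<open>From \<open>n0\<close> on the mesh size is at most the time step, as the
    velocity bound requires; compactness is therefore applied to the sequence shifted by
    \<open>n0\<close>.\<close>
  then obtain n0 where n0: "\<And>n. n \<ge> n0 \<Longrightarrow> 1 / real (N n) / \<tau> n < 1"
    unfolding eventually_sequentially by blast
  have vR: "norm (v n i) \<le> R" if "n \<ge> n0" "i < k n" for n i
  proof -
    have "L x w \<le> B" if "norm w \<le> 1 + 2 * real CARD('n)" for x w using B(2)[OF that, of x] by linarith
    moreover have "1 / real (N n) \<le> \<tau> n"
      using n0[OF that(1)] by (simp add: pos_divide_less_eq[OF \<tau>_pos] del: divide_divide_eq_left)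
    ultimately show ?thesis
      unfolding R_def using calibrated_chain.velocity_bound[OF chain _ _ C c(1) that(2)] by simp
  qed
  have xb: "norm (x n i) \<le> CARD('n) * (1 :: real)" for n i
    using calibrated_chain.x_grid[OF chain, of n i] calibrated_chain.N_pos[OF chain, of n]
    by (intro norm_le_card) (auto simp: grid_def less_imp_le)
  have pb: "norm (x n i, v n i) \<le> CARD('n) + R" if "n \<ge> n0" "i < k n" for n i
    using xb[of n i] vR[OF that] norm_Pair_le[of "x n i" "v n i"] by simp
  obtain r' M where r': "strict_mono r'" and M: "prob_space M" "sets M = sets borel"
    and conv': "\<And>F :: (real ^ 'n) \<times> (real ^ 'n) \<Rightarrow> real. continuous_on UNIV F \<Longrightarrow> integrable M F \<and>
      (\<lambda>n. (\<Sum>i<k (r' n + n0). F (x (r' n + n0) i, v (r' n + n0) i)) / k (r' n + n0)) \<longlonglongrightarrow> (\<integral>p. F p \<partial>M)"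
    using empirical_measures_compact[of "\<lambda>n. k (n + n0)" "\<lambda>n i. (x (n + n0) i, v (n + n0) i)" "CARD('n) + R"]
      calibrated_chain.k_pos[OF chain] pb by auto
  define r where "r n = r' n + n0" for n
  have r: "strict_mono r" using r' by (simp add: r_def strict_mono_def)
  have conv: "integrable M F" "(\<lambda>n. (\<Sum>i<k (r n). F (x (r n) i, v (r n) i)) / k (r n)) \<longlonglongrightarrow> (\<integral>p. F p \<partial>M)"
    if "continuous_on UNIV F" for F :: "(real ^ 'n) \<times> (real ^ 'n) \<Rightarrow> real"
    using conv'[OF that] by (simp_all add: r_def)
  have sub: "(\<lambda>n. f (r n)) \<longlonglongrightarrow> a" if "f \<longlonglongrightarrow> a" for f :: "nat \<Rightarrow> real" and a
    using LIMSEQ_subseq_LIMSEQ[OF that r] by (simp add: o_def)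
  define \<nu> where "\<nu> = distr M borel lift_pair"
  have closed: "closed_prob_measure \<nu>"
    unfolding \<nu>_def
    by (rule calibrated_limit_closed[OF chain sub[OF \<tau>] _ M, where R = R]) (use conv vR in \<open>auto simp: r_def\<close>)
  have contL: "continuous_on UNIV (\<lambda>p. case lift_pair p of (X, w) \<Rightarrow> L X w)"
  proof -
    have "(case lift_pair p of (X, w) \<Rightarrow> L X w) = (case p of (y, w) \<Rightarrow> L (to_torus y) w)" for p
      by (cases p) simp
    then show ?thesis using L(1) by (simp only: torus_continuous_def)
  qed
  have mL: "(\<lambda>(X, w). L X w) \<in> borel_measurable borel"
    by (intro borel_measurable_continuous_onI continuous_on_torus_prodI contL)
  have meas: "lift_pair \<in> measurable M borel"
    using borel_measurable_continuous_onI[OF continuous_on_lift_pair] M(2)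
    by (simp cong: measurable_cong_sets)
  have intL: "integrable \<nu> (\<lambda>(X, w). L X w)"
    unfolding \<nu>_def integrable_distr_eq[OF meas mL] by (rule conv(1)[OF contL])
  have "(\<integral>(X, w). L X w \<partial>\<nu>) = (\<integral>p. (case lift_pair p of (X, w) \<Rightarrow> L X w) \<partial>M)"
    unfolding \<nu>_def by (rule integral_distr[OF meas mL])
  \<comment> \<open>Calibration makes the mean of \<open>L\<close> along each cycle equal to
    \<open>A\<close> exactly, so testing the limit with \<open>L\<close> identifies the limit of
    these values with the action of \<nu>.\<close>
  moreover have "(\<Sum>i<k (r n). (case lift_pair (x (r n) i, v (r n) i) of (X, w) \<Rightarrow> L X w)) / k (r n) = A (r n)" for n
    using calibrated_chain.mean_action[OF chain, of "r n"] calibrated_chain.k_pos[OF chain, of "r n"] by simp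
  ultimately have A_lim: "(\<lambda>n. A (r n)) \<longlonglongrightarrow> (\<integral>(X, w). L X w \<partial>\<nu>)"
    using conv(2)[OF contL] by simp
  have \<mu>: "closed_prob_measure \<mu>" "integrable \<mu> (\<lambda>(x, v). L x v)"
    using mather by (auto simp: mather_measure_def)
  have "(\<integral>(X, w). L X w \<partial>\<nu>) \<le> (\<integral>(X, w). L X w \<partial>\<mu>)"
  proof (rule field_le_epsilon)
    fix \<epsilon> :: real assume "\<epsilon> > 0"
    obtain d where d: "d > 0" "\<And>N \<tau> A U x v k. calibrated_chain L N \<tau> A U x v k \<Longrightarrow> \<tau> < d \<Longrightarrow>
        1 / real N < d * \<tau> \<Longrightarrow> A \<le> (\<integral>(x, v). L x v \<partial>\<mu>) + \<epsilon>"
      by (rule calibrated_value_le[OF L \<mu> \<open>\<epsilon> > 0\<close>]) blast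
    have "\<forall>\<^sub>F n in sequentially. \<tau> (r n) < d" using sub[OF \<tau>] d(1) by (rule order_tendstoD)
    moreover have "\<forall>\<^sub>F n in sequentially. 1 / real (N (r n)) / \<tau> (r n) < d"
      using sub[OF ratio] d(1) by (rule order_tendstoD)
    ultimately have "\<forall>\<^sub>F n in sequentially. A (r n) \<le> (\<integral>(x, v). L x v \<partial>\<mu>) + \<epsilon>"
    proof eventually_elim
      case (elim n)
      then have "1 / real (N (r n)) < d * \<tau> (r n)"
        using \<tau>_pos[of "r n"] by (simp only: pos_divide_less_eq)
      then show ?case by (rule d(2)[OF chain elim(1)])
    qed
    then show "(\<integral>(X, w). L X w \<partial>\<nu>) \<le> (\<integral>(X, w). L X w \<partial>\<mu>) + \<epsilon>"
      by (rule tendsto_upperbound[OF A_lim]) simp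
  qed
  then have "mather_measure L \<nu>"
    using closed intL mather unfolding mather_measure_def by (meson order_trans)
  then have "\<nu> = \<mu>" by (rule unique)
  moreover have "(to_torus y0, v0) \<notin> spt \<nu>"
    unfolding \<nu>_def
    by (rule not_spt_if_avoided[OF M e, where k = "\<lambda>n. k (r n)" and p = "\<lambda>n i. (x (r n) i, v (r n) i)"])
      (use conv far in auto)
  ultimately show ?thesis by simp
qed

theorem proposition5p4:
  fixes H :: "'n::finite torus \<Rightarrow> real ^ 'n \<Rightarrow> real"
    and L :: "'n torus \<Rightarrow> real ^ 'n \<Rightarrow> real"
    and N :: "nat \<Rightarrow> nat" and h \<tau> :: "nat \<Rightarrow> real"
    and \<mu> :: "('n torus \<times> (real ^ 'n)) measure"
  assumes tonelli: "tonelli_hamiltonian H"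
    and L: "L = lagrangian H"
    and N: "\<And>n. N n \<ge> 1"
    and h: "\<And>n. h n = 1 / real (N n)"
    and \<tau>: "\<And>n. \<tau> n > 0"
    and \<tau>_lim: "\<tau> \<longlonglongrightarrow> 0"
    and h_lim: "h \<longlonglongrightarrow> 0"
    and ratio_lim: "(\<lambda>n. h n / \<tau> n) \<longlonglongrightarrow> 0"
    and mather: "mather_measure L \<mu>"
    and unique: "\<And>\<nu>. mather_measure L \<nu> \<Longrightarrow> \<nu> = \<mu>"
  shows "spt \<mu> = mather_set L \<and>
    mather_set L \<subseteq> kuratowski_liminf (\<lambda>n. discrete_mather_set L (N n) (\<tau> n))"
proof -
  have "C2 (\<lambda>(x, p). H (to_torus x) p)" and superH: "superlinear H"
    using tonelli by (auto simp: tonelli_hamiltonian_def)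
  then have contH: "torus_continuous H" by (simp add: torus_continuous_def C2_imp_continuous)
  have contL: "torus_continuous L" and superL: "superlinear L"
    unfolding L by (rule torus_continuous_lagrangian[OF contH superH], rule superlinear_lagrangian[OF contH superH])
  have "{\<nu>. mather_measure L \<nu>} = {\<mu>}" using mather unique by blast
  \<comment> \<open>The union consists of a single support, and the closure adds nothing to a closed
    set.\<close>
  then have spt_eq: "spt \<mu> = mather_set L" by (simp add: mather_set_def closed_spt)
  let ?D = "\<lambda>n. discrete_mather_set L (N n) (\<tau> n)"
  have "\<exists>A U x v k. calibrated_chain L (N n) (\<tau> n) A U x v k \<and> (\<forall>i<k. (to_torus (x i), v i) \<in> ?D n)" for n
  proof -
    have "N n > 0" using N[of n] by simp
    from discrete_weak_KAM[OF superL \<tau> this] show ?thesis by metis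
  qed
  then obtain A U x v k where chain: "\<And>n. calibrated_chain L (N n) (\<tau> n) (A n) (U n) (x n) (v n) (k n)"
    and mem: "\<And>n i. i < k n \<Longrightarrow> (to_torus (x n i), v n i) \<in> ?D n"
    by metis
  have "spt \<mu> \<subseteq> kuratowski_liminf ?D"
  proof
    fix z assume z: "z \<in> spt \<mu>"
    obtain y0 v0 where z_eq: "z = (to_torus y0, v0)" by (metis surj_pair to_torus_surj)
    \<comment> \<open>Lifting the discrete Mather sets to the cover makes a metric available;
      convergence on the torus follows from convergence there.\<close>
    define E where "E n = (lift_pair -` ?D n :: ((real ^ 'n) \<times> (real ^ 'n)) set)" for n
    have E_mem: "(x n i + int_vec l, v n i) \<in> E n" if "i < k n" for n i l
      using mem[OF that] by (simp add: E_def)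
    have E_ne: "E n \<noteq> {}" for n
      using E_mem[OF calibrated_chain.k_pos[OF chain]] by blast
    have lim: "(\<lambda>n. infdist (y0, v0) (E n)) \<longlonglongrightarrow> 0"
    proof (rule ccontr)
      assume "\<not> ?thesis"
      then obtain e where e: "e > 0" "\<And>m. \<exists>n\<ge>m. infdist (y0, v0) (E n) \<ge> e"
        unfolding LIMSEQ_def by (auto simp: dist_real_def infdist_nonneg not_less)
      have inf: "infinite {n. infdist (y0, v0) (E n) \<ge> e}"
        unfolding infinite_nat_iff_unbounded_le using e(2) by auto
      obtain s :: "nat \<Rightarrow> nat" where s: "strict_mono s" "\<And>n. infdist (y0, v0) (E (s n)) \<ge> e"
        using infinite_enumerate[OF inf] by auto
      have "(to_torus y0, v0) \<notin> spt \<mu>"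
      proof (rule spt_avoidance_contradiction[OF contL superL mather unique chain _ _ e(1)])
        show "(\<lambda>n. \<tau> (s n)) \<longlonglongrightarrow> 0"
          using LIMSEQ_subseq_LIMSEQ[OF \<tau>_lim s(1)] by (simp add: o_def)
        show "(\<lambda>n. 1 / real (N (s n)) / \<tau> (s n)) \<longlonglongrightarrow> 0"
          using LIMSEQ_subseq_LIMSEQ[OF ratio_lim s(1)] by (simp add: o_def h)
        fix n i l assume "i < k (s n)"
        have "e \<le> infdist (y0, v0) (E (s n))" by (rule s)
        \<comment> \<open>\<open>E\<close> is invariant under integer translations, so moving
          \<open>y0\<close> by \<open>l\<close> can be traded for moving the cycle point by
          \<open>- l\<close>.\<close>
        also have "\<dots> \<le> dist (y0, v0) (x (s n) i + int_vec (- l), v (s n) i)"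
          by (rule infdist_le[OF E_mem[OF \<open>i < k (s n)\<close>]])
        also have "\<dots> = dist (y0 + int_vec l, v0) (x (s n) i, v (s n) i)"
        proof -
          have "y0 - (x (s n) i + int_vec (- l)) = y0 + int_vec l - x (s n) i" by (simp add: vec_eq_iff)
          then show ?thesis by (simp only: dist_norm diff_Pair)
        qed
        finally show "dist (y0 + int_vec l, v0) (x (s n) i, v (s n) i) \<ge> e" .
      qed
      with z z_eq show False by simp
    qed
    \<comment> \<open>Closedness makes the distance attained, which yields a point in every set at
      once and not only along a subsequence.\<close>
    have "closed (E n)" for n
      unfolding E_def by (intro closed_vimage continuous_on_lift_pair) (simp add: discrete_mather_set_def)
    then have "\<exists>q\<in>E n. infdist (y0, v0) (E n) = dist (y0, v0) q" for n
      using infdist_attains_inf E_ne by metis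
    then obtain q where q: "\<And>n. q n \<in> E n" "\<And>n. infdist (y0, v0) (E n) = dist (y0, v0) (q n)"
      by metis
    have "(\<lambda>n. dist (q n) (y0, v0)) \<longlonglongrightarrow> 0"
      using lim by (simp add: q(2) dist_commute)
    then have "q \<longlonglongrightarrow> (y0, v0)" by (subst tendsto_dist_iff)
    then have "(\<lambda>n. lift_pair (q n)) \<longlonglongrightarrow> lift_pair (y0, v0)"
      by (rule continuous_on_tendsto_compose[OF continuous_on_lift_pair]) auto
    then show "z \<in> kuratowski_liminf ?D"
      unfolding kuratowski_liminf_def using q(1)
      by (intro CollectI exI[of _ "\<lambda>n. lift_pair (q n)"]) (simp add: z_eq E_def)
  qed
  then show ?thesis using spt_eq by simp
qed

end
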